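(* Let $\sigma\in M^1(\mathbb{Z}^n\times\mathbb{T}^n)$. Let $(\Phi,\Psi)$ be a complementary Young pair, where $\Phi$ satisfies a local $\Delta_2$-condition, is continuous, and satisfies $\Phi(x)=-x^2\log x$ for $0\le x\le e^{-2/3}$. Let $g_1\in M^\Psi(\mathbb{Z}^n)$ and $g_2\in M^\Phi(\mathbb{Z}^n)$. Then the localization operator $\mathfrak{L}^{g_1,g_2}_\sigma:M^\Phi(\mathbb{Z}^n)\to M^\Phi(\mathbb{Z}^n)$ is a bounded linear operator, and $$\|\mathfrak{L}^{g_1,g_2}_\sigma\|_{\mathcal{B}(M^\Phi(\mathbb{Z}^n))}\le\|\sigma\|_{M^1(\mathbb{Z}^n\times\mathbb{T}^n)}\,\|g_1\|_{M^\Psi(\mathbb{Z}^n)}\,\|g_2\|_{M^\Phi(\mathbb{Z}^n)}.$$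
   Context: A Young function is a convex function $\Phi:[0,\infty]\to[0,\infty]$ with $\Phi(0)=0$ and $\lim_{t\to\infty}\Phi(t)=\Phi(\infty)=\infty$. Its complementary function is $\Psi(y)=\sup\{x|y|-\Phi(x):x\ge 0\}$, and $(\Phi,\Psi)$ is then called a complementary Young pair. $\Phi$ satisfies a local $\Delta_2$-condition if there are $r>0$, $C>0$ with $\Phi(2x)\le C\Phi(x)$ for $x\in[0,r]$. $\mathcal{S}(\mathbb{Z}^n)$ is the space of rapidly decreasing functions on $\mathbb{Z}^n$ ($|g(k)|\le C_{g,M}(1+|k|)^{-M}$ for every $M$) with seminorms $\sup_k(1+|k|)^j|g(k)|$, $j\in\mathbb{N}_0$; $\mathcal{S}'(\mathbb{Z}^n)$ is its topological dual. Translation and modulation are $T_kf(m)=f(m-k)$, $M_wf(m)=e^{2\pi i w\cdot m}f(m)$. The short-time Fourier transform is $V_gf(m,w)=\langle f,M_wT_mg\rangle$ $\big(=\sum_{k\in\mathbb{Z}^n}f(k)\overline{g(k-m)}e^{-2\pi i w\cdot k}\big)$, $(m,w)\in\mathbb{Z}^n\times\mathbb{T}^n$. $L^\Phi(\mathbb{Z}^n\times\mathbb{T}^n)$ has norm $\|F\|_{L^\Phi}=\inf\{b>0:\sum_{m}\int_{\mathbb{T}^n}\Phi(|F(m,w)|/b)\,dw\le 1\}$. With a fixed non-zero window $g_0\in\mathcal{S}(\mathbb{Z}^n)$, $M^\Phi(\mathbb{Z}^n)$ is the space of $f\in\mathcal{S}'(\mathbb{Z}^n)$ with $\|f\|_{M^\Phi(\mathbb{Z}^n)}=\|V_{g_0}f\|_{L^\Phi(\mathbb{Z}^n\times\mathbb{T}^n)}<\infty$,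 and similarly $M^\Psi(\mathbb{Z}^n)$; the spaces are independent of the choice of window. $M^\Psi(\mathbb{Z}^n)$ is identified with the dual of $M^\Phi(\mathbb{Z}^n)$ via $\langle f,h\rangle=\sum_m\int_{\mathbb{T}^n}V_{g_0}f(m,w)\overline{V_{g_0}h(m,w)}\,dw$, $f\in M^\Phi$, $h\in M^\Psi$. $M^1(\mathbb{Z}^n\times\mathbb{T}^n)$ is the standard modulation space on the locally compact abelian group $\mathbb{Z}^n\times\mathbb{T}^n$ (dual group $\mathbb{T}^n\times\mathbb{Z}^n$): with a fixed non-zero Schwartz window $G$ on $\mathbb{Z}^n\times\mathbb{T}^n$, $\|\sigma\|_{M^1}$ is the $L^1$-norm over $(\mathbb{Z}^n\times\mathbb{T}^n)\times(\mathbb{T}^n\times\mathbb{Z}^n)$ of $V_G\sigma((m,w),(x,l))=\sum_{k\in\mathbb{Z}^n}\int_{\mathbb{T}^n}\sigma(k,y)\overline{G(k-m,y-w)}e^{-2\pi i(x\cdot k+l\cdot y)}\,dy$. The localization operator with symbol $\sigma$ and windows $g_1,g_2$ is $\mathfrak{L}^{g_1,g_2}_\sigma f(k)=\sum_{m\in\mathbb{Z}^n}\int_{\mathbb{T}^n}\sigma(m,w)V_{g_1}f(m,w)\,M_wT_mg_2(k)\,dw$, understood in the weak sense: $\langle\mathfrak{L}^{g_1,g_2}_\sigma f,h\rangle=\sum_{m\in\mathbb{Z}^n}\int_{\mathbb{T}^n}\sigma(m,w)V_{g_1}f(m,w)\overline{V_{g_2}h(m,w)}\,dw$ for $f\in M^\Phi(\mathbb{Z}^n)$,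 $h\in M^\Psi(\mathbb{Z}^n)$. $\mathcal{B}(M^\Phi(\mathbb{Z}^n))$ denotes the bounded linear operators on $M^\Phi(\mathbb{Z}^n)$ with the operator norm.
   Formalization: Φ(x) = −x² log x is asked on [0,a] for any 0 < a ≤ e^{-2/3}, as no Young function has this form on all of [0,e^{-2/3}]; the norm bound with constant 1 fails for arbitrary fixed windows, so it is stated with G replaced by cG, where c > 0 depends only on g_0 and G. *)

theory Defs
  imports "HOL-Analysis.Analysis"
begin

section \<open>Young functions\<close>

text \<open>
  Arithmetic is that of \<open>ennreal\<close>, in particular \<open>0 * \<infinity> = 0\<close>.
\<close>

definition young_function :: "(ennreal \<Rightarrow> ennreal) \<Rightarrow> bool" where
  "young_function \<Phi> \<longleftrightarrow>
     (\<forall>x y u v. u + v = 1 \<longrightarrow> \<Phi> (u * x + v * y) \<le> u * \<Phi> x + v * \<Phi> y) \<and>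
     \<Phi> 0 = 0 \<and>
     ((\<lambda>t::real. \<Phi> (ennreal t)) \<longlongrightarrow> \<infinity>) at_top \<and>
     \<Phi> \<infinity> = \<infinity>"

text \<open>
  Subtraction on \<open>ennreal\<close> is truncated at 0. This does not change the supremum, because
  \<open>x = 0\<close> contributes \<open>0\<close>.
\<close>

definition complementary :: "(ennreal \<Rightarrow> ennreal) \<Rightarrow> ennreal \<Rightarrow> ennreal" where
  "complementary \<Phi> y = (SUP x\<in>{x. x < \<infinity>}. x * y - \<Phi> x)"

definition complementary_young_pair :: "(ennreal \<Rightarrow> ennreal) \<Rightarrow> (ennreal \<Rightarrow> ennreal) \<Rightarrow> bool" where
  "complementary_young_pair \<Phi> \<Psi> \<longleftrightarrow> young_function \<Phi> \<and> \<Psi> = complementary \<Phi>"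

definition local_Delta2 :: "(ennreal \<Rightarrow> ennreal) \<Rightarrow> bool" where
  "local_Delta2 \<Phi> \<longleftrightarrow>
     (\<exists>r>0. \<exists>C>0. \<forall>x\<in>{0..r::real}. \<Phi> (ennreal (2 * x)) \<le> ennreal C * \<Phi> (ennreal x))"

text \<open>
  The second derivative of \<open>- x^2 ln x\<close> is \<open>- 2 ln x - 3\<close>, so this function is convex on
  \<open>[0, e^(-3/2)]\<close> only. No Young function agrees with it on \<open>[0, e^(-2/3)]\<close>; agreement is
  therefore asked for on \<open>[0, a]\<close>, where \<open>a\<close> is any number with \<open>0 < a \<le> e^(-2/3)\<close>.
\<close>

section \<open>The groups\<close>

text \<open>
  The group \<open>Z^n\<close> is the type \<open>int ^ 'n\<close>. Functions on the torus \<open>T^n\<close> are functions on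
  \<open>real ^ 'n\<close> with period 1 in every coordinate; its normalized Haar measure is Lebesgue
  measure on the fundamental domain \<open>[0,1)^n\<close>.
\<close>

definition rvec :: "int ^ 'n \<Rightarrow> real ^ 'n" where
  "rvec k = (\<chi> i. real_of_int (k $ i))"

definition unit_char :: "real \<Rightarrow> complex" where
  "unit_char t = exp (2 * of_real pi * \<i> * of_real t)"

definition torus :: "(real ^ 'n) measure" where
  "torus = restrict_space lborel {w. \<forall>i. 0 \<le> w $ i \<and> w $ i < 1}"

definition ZT :: "((int ^ 'n) \<times> (real ^ 'n)) measure" where
  "ZT = count_space UNIV \<Otimes>\<^sub>M torus"

definition TZ :: "((real ^ 'n) \<times> (int ^ 'n)) measure" where
  "TZ = torus \<Otimes>\<^sub>M count_space UNIV"

definition torus_periodic :: "(int ^ 'n \<Rightarrow> real ^ 'n \<Rightarrow> complex) \<Rightarrow> bool" where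
  "torus_periodic F \<longleftrightarrow> (\<forall>k y j. F k (y + rvec j) = F k y)"

section \<open>Rapidly decreasing functions and distributions on \<open>Z^n\<close>\<close>

definition schwartz :: "(int ^ 'n \<Rightarrow> complex) set" where
  "schwartz = {g. \<forall>M::nat. \<exists>C. \<forall>k. cmod (g k) \<le> C / (1 + norm (rvec k)) ^ M}"

definition schwartz_seminorm :: "nat \<Rightarrow> (int ^ 'n \<Rightarrow> complex) \<Rightarrow> real" where
  "schwartz_seminorm j g = (SUP k. (1 + norm (rvec k)) ^ j * cmod (g k))"

text \<open>
  The topological dual: complex linear functionals on \<open>schwartz\<close>, continuous for the topology
  generated by the seminorms. They are extended by 0 to functions outside \<open>schwartz\<close>, so that
  HOL equality is equality of functionals on \<open>schwartz\<close>.
\<close>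

definition distributions :: "((int ^ 'n \<Rightarrow> complex) \<Rightarrow> complex) set" where
  "distributions = {f.
     (\<forall>\<phi>\<in>schwartz. \<forall>\<psi>\<in>schwartz. \<forall>a b.
        f (\<lambda>k. a * \<phi> k + b * \<psi> k) = a * f \<phi> + b * f \<psi>) \<and>
     (\<forall>\<phi>\<in>schwartz. \<forall>\<epsilon>>0. \<exists>N. \<exists>\<delta>>0. \<forall>\<psi>\<in>schwartz.
        (\<forall>j\<le>N. schwartz_seminorm j (\<lambda>k. \<psi> k - \<phi> k) < \<delta>) \<longrightarrow> cmod (f \<psi> - f \<phi>) < \<epsilon>) \<and>
     (\<forall>\<phi>. \<phi> \<notin> schwartz \<longrightarrow> f \<phi> = 0)}"

definition translation :: "int ^ 'n \<Rightarrow> (int ^ 'n \<Rightarrow> complex) \<Rightarrow> int ^ 'n \<Rightarrow> complex" where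
  "translation k f m = f (m - k)"

definition modulation :: "real ^ 'n \<Rightarrow> (int ^ 'n \<Rightarrow> complex) \<Rightarrow> int ^ 'n \<Rightarrow> complex" where
  "modulation w f m = unit_char (w \<bullet> rvec m) * f m"

text \<open>
  Distributions act linearly, whereas the bracket \<open>\<langle>f, g\<rangle>\<close> is antilinear in \<open>g\<close>:
  \<open>\<langle>f, g\<rangle>\<close> is \<open>f\<close> applied to the complex conjugate of \<open>g\<close>.
\<close>

definition stft ::
  "(int ^ 'n \<Rightarrow> complex) \<Rightarrow> ((int ^ 'n \<Rightarrow> complex) \<Rightarrow> complex) \<Rightarrow> int ^ 'n \<Rightarrow> real ^ 'n \<Rightarrow> complex" where
  "stft g f m w = f (\<lambda>k. cnj (modulation w (translation m g) k))"

section \<open>Orlicz modulation spaces\<close>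

definition luxemburg :: "'a measure \<Rightarrow> (ennreal \<Rightarrow> ennreal) \<Rightarrow> ('a \<Rightarrow> complex) \<Rightarrow> ennreal" where
  "luxemburg M \<Phi> F =
     Inf {ennreal b |b. b > 0 \<and> (\<integral>\<^sup>+ z. \<Phi> (ennreal (cmod (F z) / b)) \<partial>M) \<le> 1}"

definition mod_norm ::
  "(int ^ 'n \<Rightarrow> complex) \<Rightarrow> (ennreal \<Rightarrow> ennreal) \<Rightarrow> ((int ^ 'n \<Rightarrow> complex) \<Rightarrow> complex) \<Rightarrow> ennreal" where
  "mod_norm g0 \<Phi> f = luxemburg ZT \<Phi> (\<lambda>(m, w). stft g0 f m w)"

definition mod_space ::
  "(int ^ 'n \<Rightarrow> complex) \<Rightarrow> (ennreal \<Rightarrow> ennreal) \<Rightarrow> ((int ^ 'n \<Rightarrow> complex) \<Rightarrow> complex) set" where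
  "mod_space g0 \<Phi> = {f \<in> distributions. mod_norm g0 \<Phi> f < \<infinity>}"

definition duality_integrand ::
  "(int ^ 'n \<Rightarrow> complex) \<Rightarrow> ((int ^ 'n \<Rightarrow> complex) \<Rightarrow> complex) \<Rightarrow> ((int ^ 'n \<Rightarrow> complex) \<Rightarrow> complex)
     \<Rightarrow> (int ^ 'n) \<times> (real ^ 'n) \<Rightarrow> complex" where
  "duality_integrand g0 f h = (\<lambda>(m, w). stft g0 f m w * cnj (stft g0 h m w))"

section \<open>Schwartz functions on \<open>Z^n \<times> T^n\<close> and the space \<open>M^1\<close>\<close>

definition partial_deriv :: "'n \<Rightarrow> (real ^ 'n \<Rightarrow> complex) \<Rightarrow> real ^ 'n \<Rightarrow> complex" where
  "partial_deriv i F y = vector_derivative (\<lambda>t. F (y + t *\<^sub>R axis i 1)) (at 0)"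

text \<open>A list of directions plays the role of a multi-index.\<close>

definition schwartz_ZT :: "(int ^ 'n \<Rightarrow> real ^ 'n \<Rightarrow> complex) set" where
  "schwartz_ZT = {G. torus_periodic G \<and>
     (\<forall>k is. foldr partial_deriv is (G k) differentiable_on UNIV) \<and>
     (\<forall>is. \<forall>M::nat. \<exists>C. \<forall>k y.
        cmod (foldr partial_deriv is (G k) y) \<le> C / (1 + norm (rvec k)) ^ M)}"

definition stft_ZT ::
  "(int ^ 'n \<Rightarrow> real ^ 'n \<Rightarrow> complex) \<Rightarrow> (int ^ 'n \<Rightarrow> real ^ 'n \<Rightarrow> complex)
     \<Rightarrow> (int ^ 'n) \<times> (real ^ 'n) \<Rightarrow> (real ^ 'n) \<times> (int ^ 'n) \<Rightarrow> complex" where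
  "stft_ZT G \<sigma> = (\<lambda>(m, w) (x, l).
     (LINT (k, y)|ZT. \<sigma> k y * cnj (G (k - m) (y - w)) * unit_char (- (x \<bullet> rvec k + rvec l \<bullet> y))))"

definition M1_norm ::
  "(int ^ 'n \<Rightarrow> real ^ 'n \<Rightarrow> complex) \<Rightarrow> (int ^ 'n \<Rightarrow> real ^ 'n \<Rightarrow> complex) \<Rightarrow> ennreal" where
  "M1_norm G \<sigma> = (\<integral>\<^sup>+ (p, q). ennreal (cmod (stft_ZT G \<sigma> p q)) \<partial>(ZT \<Otimes>\<^sub>M TZ))"

text \<open>
  The norm is multiplied by \<open>\<bar>c\<bar>\<close> when the window \<open>G\<close> is multiplied by \<open>c\<close>, so an estimate
  with constant 1 can hold only for a suitable normalization of the fixed window.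
\<close>

text \<open>
  Functions that define a tempered distribution on \<open>Z^n \<times> T^n\<close>. For these the integral in
  \<open>stft_ZT\<close> converges absolutely; without such an a priori class a function with divergent
  integrals would get norm 0. Nothing is lost: every element of \<open>M^1\<close> is a bounded
  integrable function.
\<close>

definition tempered_functions :: "(int ^ 'n \<Rightarrow> real ^ 'n \<Rightarrow> complex) set" where
  "tempered_functions = {\<sigma>. torus_periodic \<sigma> \<and>
     (\<lambda>(k, y). \<sigma> k y) \<in> borel_measurable ZT \<and>
     (\<exists>C N. \<forall>k. (\<integral>\<^sup>+ y. ennreal (cmod (\<sigma> k y)) \<partial>torus) \<le> ennreal (C * (1 + norm (rvec k)) ^ N))}"

definition M1_space ::
  "(int ^ 'n \<Rightarrow> real ^ 'n \<Rightarrow> complex) \<Rightarrow> (int ^ 'n \<Rightarrow> real ^ 'n \<Rightarrow> complex) set" where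
  "M1_space G = {\<sigma> \<in> tempered_functions. M1_norm G \<sigma> < \<infinity>}"

section \<open>Localization operators\<close>

text \<open>
  In \<open>V\<^bsub>g1\<^esub> f\<close> and \<open>V\<^bsub>g2\<^esub> h\<close> the windows are themselves distributions, so the transform is
  given by the series \<open>\<Sum>k. f(k) cnj (g(k - m)) e^(-2 pi i w.k)\<close>, where the value of a
  distribution at \<open>k\<close> is its value on the unit vector at \<open>k\<close>.
\<close>

definition value_at :: "((int ^ 'n \<Rightarrow> complex) \<Rightarrow> complex) \<Rightarrow> int ^ 'n \<Rightarrow> complex" where
  "value_at f k = f (\<lambda>j. if j = k then 1 else 0)"

definition stft_term ::
  "((int ^ 'n \<Rightarrow> complex) \<Rightarrow> complex) \<Rightarrow> ((int ^ 'n \<Rightarrow> complex) \<Rightarrow> complex)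
     \<Rightarrow> int ^ 'n \<Rightarrow> real ^ 'n \<Rightarrow> int ^ 'n \<Rightarrow> complex" where
  "stft_term g f m w k =
     value_at f k * cnj (value_at g (k - m)) * unit_char (- (w \<bullet> rvec k))"

definition stft_dist ::
  "((int ^ 'n \<Rightarrow> complex) \<Rightarrow> complex) \<Rightarrow> ((int ^ 'n \<Rightarrow> complex) \<Rightarrow> complex)
     \<Rightarrow> int ^ 'n \<Rightarrow> real ^ 'n \<Rightarrow> complex" where
  "stft_dist g f m w = (\<Sum>\<^sub>\<infinity>k. stft_term g f m w k)"

definition loc_integrand ::
  "(int ^ 'n \<Rightarrow> real ^ 'n \<Rightarrow> complex)
     \<Rightarrow> ((int ^ 'n \<Rightarrow> complex) \<Rightarrow> complex) \<Rightarrow> ((int ^ 'n \<Rightarrow> complex) \<Rightarrow> complex)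
     \<Rightarrow> ((int ^ 'n \<Rightarrow> complex) \<Rightarrow> complex) \<Rightarrow> ((int ^ 'n \<Rightarrow> complex) \<Rightarrow> complex)
     \<Rightarrow> (int ^ 'n) \<times> (real ^ 'n) \<Rightarrow> complex" where
  "loc_integrand \<sigma> g1 g2 f h =
     (\<lambda>(m, w). \<sigma> m w * stft_dist g1 f m w * cnj (stft_dist g2 h m w))"

text \<open>
  \<open>u\<close> is the image of \<open>f\<close> under the localization operator in the weak sense. The convergence
  conditions exclude the default value 0 of divergent sums and integrals.
\<close>

definition weak_loc_image ::
  "(int ^ 'n \<Rightarrow> complex) \<Rightarrow> (ennreal \<Rightarrow> ennreal) \<Rightarrow> (ennreal \<Rightarrow> ennreal)
     \<Rightarrow> (int ^ 'n \<Rightarrow> real ^ 'n \<Rightarrow> complex)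
     \<Rightarrow> ((int ^ 'n \<Rightarrow> complex) \<Rightarrow> complex) \<Rightarrow> ((int ^ 'n \<Rightarrow> complex) \<Rightarrow> complex)
     \<Rightarrow> ((int ^ 'n \<Rightarrow> complex) \<Rightarrow> complex) \<Rightarrow> ((int ^ 'n \<Rightarrow> complex) \<Rightarrow> complex) \<Rightarrow> bool" where
  "weak_loc_image g0 \<Phi> \<Psi> \<sigma> g1 g2 f u \<longleftrightarrow>
     u \<in> mod_space g0 \<Phi> \<and>
     (\<forall>m w. stft_term g1 f m w summable_on UNIV) \<and>
     (\<forall>h\<in>mod_space g0 \<Psi>.
        (\<forall>m w. stft_term g2 h m w summable_on UNIV) \<and>
        integrable ZT (duality_integrand g0 u h) \<and>
        integrable ZT (loc_integrand \<sigma> g1 g2 f h) \<and>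
        (LINT z|ZT. duality_integrand g0 u h z) = (LINT z|ZT. loc_integrand \<sigma> g1 g2 f h z))"

definition loc_op ::
  "(int ^ 'n \<Rightarrow> complex) \<Rightarrow> (ennreal \<Rightarrow> ennreal) \<Rightarrow> (ennreal \<Rightarrow> ennreal)
     \<Rightarrow> (int ^ 'n \<Rightarrow> real ^ 'n \<Rightarrow> complex)
     \<Rightarrow> ((int ^ 'n \<Rightarrow> complex) \<Rightarrow> complex) \<Rightarrow> ((int ^ 'n \<Rightarrow> complex) \<Rightarrow> complex)
     \<Rightarrow> ((int ^ 'n \<Rightarrow> complex) \<Rightarrow> complex) \<Rightarrow> ((int ^ 'n \<Rightarrow> complex) \<Rightarrow> complex)" where
  "loc_op g0 \<Phi> \<Psi> \<sigma> g1 g2 f = (THE u. weak_loc_image g0 \<Phi> \<Psi> \<sigma> g1 g2 f u)"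

section \<open>Bounded operators on \<open>M^\<Phi>\<close>\<close>

definition bounded_linear_on_mod_space ::
  "(int ^ 'n \<Rightarrow> complex) \<Rightarrow> (ennreal \<Rightarrow> ennreal)
     \<Rightarrow> (((int ^ 'n \<Rightarrow> complex) \<Rightarrow> complex) \<Rightarrow> ((int ^ 'n \<Rightarrow> complex) \<Rightarrow> complex)) \<Rightarrow> bool" where
  "bounded_linear_on_mod_space g0 \<Phi> T \<longleftrightarrow>
     (\<forall>f\<in>mod_space g0 \<Phi>. T f \<in> mod_space g0 \<Phi>) \<and>
     (\<forall>f\<in>mod_space g0 \<Phi>. \<forall>h\<in>mod_space g0 \<Phi>. \<forall>a b.
        T (\<lambda>\<phi>. a * f \<phi> + b * h \<phi>) = (\<lambda>\<phi>. a * T f \<phi> + b * T h \<phi>)) \<and>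
     (\<exists>C::real. \<forall>f\<in>mod_space g0 \<Phi>. mod_norm g0 \<Phi> (T f) \<le> ennreal C * mod_norm g0 \<Phi> f)"

definition op_norm ::
  "(int ^ 'n \<Rightarrow> complex) \<Rightarrow> (ennreal \<Rightarrow> ennreal)
     \<Rightarrow> (((int ^ 'n \<Rightarrow> complex) \<Rightarrow> complex) \<Rightarrow> ((int ^ 'n \<Rightarrow> complex) \<Rightarrow> complex)) \<Rightarrow> ennreal" where
  "op_norm g0 \<Phi> T = (SUP f\<in>{f \<in> mod_space g0 \<Phi>. mod_norm g0 \<Phi> f \<le> 1}. mod_norm g0 \<Phi> (T f))"

end

theory Submission
  imports Defs
begin

text \<open>
  A distribution \<open>f\<close> on \<open>\<int>\<^sup>n\<close> is the sequence of its values, and \<open>f(k) cnj (g0(k - m))\<close> are the Fourier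
  coefficients of \<open>V\<^bsub>g0\<^esub> f(m, \<cdot>)\<close>. So \<open>|g0(k0)| |f(k)|\<close> is at most the mean of \<open>|V\<^bsub>g0\<^esub> f(k - k0, \<cdot>)|\<close>, and
  Jensen's inequality turns a bound on the Orlicz modular of \<open>V\<^bsub>g0\<^esub> f\<close> into one on the modular of the values.
  Young's inequality then bounds \<open>V\<^bsub>g1\<^esub> f\<close> uniformly by \<open>\<parallel>f\<parallel> \<parallel>g1\<parallel>\<close>, and Parseval's identity gives
  \<open>\<langle>u, h\<rangle> = \<parallel>g0\<parallel>\<^sup>2 \<Sum> u(k) cnj (h(k))\<close>. The operator therefore sends \<open>f\<close> to the sequence
  \<open>u(k) = \<parallel>g0\<parallel>\<^sup>-\<^sup>2 \<integral> \<sigma> V\<^bsub>g1\<^esub> f e\<^sup>2\<^sup>\<pi>\<^sup>i\<^sup>w\<^sup>k g2(k - m)\<close>. Its transform is dominated by the convolution of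
  \<open>|\<sigma> V\<^bsub>g1\<^esub> f|\<close> with \<open>|V\<^bsub>g0\<^esub> g2|\<close>, and Jensen's inequality for the measure \<open>|\<sigma> V\<^bsub>g1\<^esub> f|\<close> bounds its norm by
  \<open>\<parallel>\<sigma>\<parallel>\<^sub>1 \<parallel>f\<parallel> \<parallel>g1\<parallel> \<parallel>g2\<parallel>\<close> up to a constant that depends on the windows only.

  The \<open>L\<^sup>1\<close> norm of \<open>\<sigma>\<close> is at most a multiple of the \<open>M\<^sup>1\<close> norm because \<open>|\<sigma> cnj (G(\<cdot> - p))|\<close> is bounded by
  \<open>\<integral> |V\<^bsub>G\<^esub> \<sigma>(p, q)| dq\<close>: an integrable function on the torus is bounded by the sum of its Fourier coefficients.
  The logarithmic form of \<open>\<Phi>\<close> near \<open>0\<close> puts the point masses into \<open>M\<^sup>\<Psi>\<close>. This makes the image unique and the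
  sequence \<open>g2\<close> bounded.
\<close>

section \<open>The torus and its Haar measure\<close>

text \<open>The windows \<open>g1\<close> and \<open>g2\<close> are themselves only elements of
  Orlicz modulation spaces, so convergence of the series for \<open>stft_dist\<close> and
  interchanges of sums and integrals cannot come from decay. They are drawn instead from pairs of
  modulars at most 1, one for \<Phi> and one for its complementary function, from the boundedness of
  the values of \<open>g2\<close>, and from the integrability of \<sigma>. To treat both Young
  functions alike, estimates are made for a \<open>gauge\<close>: a monotone function vanishing at 0
  with Y(u x) \<le> u Y(x) for u \<le> 1. The price is a factor 2 at each use of Jensen's
  inequality. Such factors do no harm. They depend only on \<open>g0\<close> and \<open>G\<close>;
  multiplying \<open>G\<close> by c multiplies the norm of \<sigma> by c, and c is chosen to absorb
  them before \<Phi>, \<sigma>, \<open>g1\<close> and \<open>g2\<close> are given. Exactness in the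
  remaining norms is recovered by a limit: estimates are proved for admissible bounds b of the
  Luxemburg infimum, these are taken within \<epsilon> of the norms, and \<epsilon> tends to 0.
  Since the image is unique, it does not vary with the bounds.\<close>

abbreviation unit_cube :: "(real ^ 'n) set" where
  "unit_cube \<equiv> {w. \<forall>i. 0 \<le> w $ i \<and> w $ i < 1}"

abbreviation lattice :: "(int ^ 'n) measure" where
  "lattice \<equiv> count_space UNIV"

lemma rvec_add: "rvec (j + k) = rvec j + rvec k"
  and rvec_minus: "rvec (- k) = - rvec k"
  and rvec_diff: "rvec (j - k) = rvec j - rvec k"
  and rvec_zero: "rvec 0 = 0"
  and rvec_nth: "rvec k $ i = real_of_int (k $ i)"
  by (simp_all add: rvec_def vec_eq_iff)

lemma unit_cube_borel [measurable]: "unit_cube \<in> sets (borel :: (real ^ 'n) measure)"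
proof -
  have [measurable]: "(\<lambda>w::real ^ 'n. w $ i) \<in> borel_measurable borel" for i
    by (intro borel_measurable_continuous_onI continuous_intros)
  show ?thesis by measurable
qed

lemma space_torus: "space torus = (unit_cube :: (real ^ 'n) set)"
  by (simp add: torus_def space_restrict_space)

lemma sets_torus: "sets (torus :: (real ^ 'n) measure) = sets (restrict_space borel unit_cube)"
  by (simp add: torus_def sets_restrict_space)

lemma measurable_torus: "f \<in> measurable borel N \<Longrightarrow> f \<in> measurable torus N"
  unfolding torus_def by (intro measurable_restrict_space1) simp

lemma measurable_into_torus:
  "f \<in> measurable M borel \<Longrightarrow> (\<And>x. x \<in> space M \<Longrightarrow> f x \<in> unit_cube) \<Longrightarrow> f \<in> measurable M torus"
  unfolding torus_def by (intro measurable_restrict_space2) (auto simp: measurable_lborel1)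

lemma nn_integral_torus:
  fixes f :: "real ^ 'n \<Rightarrow> ennreal"
  shows "(\<integral>\<^sup>+ w. f w \<partial>torus) = (\<integral>\<^sup>+ w. f w * indicator unit_cube w \<partial>lborel)"
  unfolding torus_def by (subst nn_integral_restrict_space) auto

text \<open>The half-open cube lies between the open and the closed unit box, both of volume
  1.\<close>

lemma prob_space_torus: "emeasure torus (space (torus :: (real ^ 'n) measure)) = 1"
proof -
  have *: "emeasure lborel (unit_cube :: (real ^ 'n) set) = 1"
  proof (rule antisym)
    have b: "1 \<bullet> b = (1::real)" if "b \<in> Basis" for b :: "real ^ 'n"
      using that by (auto simp: Basis_vec_def cart_eq_inner_axis[symmetric])
    have "emeasure lborel (unit_cube :: (real ^ 'n) set) \<le> emeasure lborel (cbox 0 (1 :: real ^ 'n))"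
      by (intro emeasure_mono) (auto simp: mem_box_cart less_imp_le)
    also have "\<dots> = 1"
      by (simp add: emeasure_lborel_cbox_eq b)
    finally show "emeasure lborel (unit_cube :: (real ^ 'n) set) \<le> 1" .
    have "1 = emeasure lborel (box 0 (1 :: real ^ 'n))"
      by (simp add: emeasure_lborel_box_eq b)
    also have "\<dots> \<le> emeasure lborel (unit_cube :: (real ^ 'n) set)"
      by (intro emeasure_mono) (auto simp: mem_box_cart less_imp_le)
    finally show "1 \<le> emeasure lborel (unit_cube :: (real ^ 'n) set)" .
  qed
  then show ?thesis
    by (simp add: space_torus) (simp add: torus_def emeasure_restrict_space)
qed

interpretation torus: finite_measure "torus :: (real ^ 'n) measure"
  by (rule finite_measureI) (simp add: prob_space_torus)

interpretation torus: sigma_finite_measure "torus :: (real ^ 'n) measure"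
  by (rule torus.sigma_finite_measure_axioms)

interpretation lattice: sigma_finite_measure "lattice :: (int ^ 'n) measure"
  by (rule sigma_finite_measure_count_space)

interpretation ZT: pair_sigma_finite "lattice :: (int ^ 'n) measure" "torus :: (real ^ 'n) measure" ..

section \<open>Change of fundamental domain; rotations and reflections of the torus\<close>

lemma nn_integral_shift_lborel:
  fixes f :: "real ^ 'n \<Rightarrow> ennreal"
  assumes [measurable]: "f \<in> borel_measurable borel"
  shows "(\<integral>\<^sup>+ w. f w \<partial>lborel) = (\<integral>\<^sup>+ w. f (a + w) \<partial>lborel)"
  by (subst lborel_distr_plus[of a, symmetric], subst nn_integral_distr) auto

lemma nn_integral_reflect_lborel:
  fixes f :: "real ^ 'n \<Rightarrow> ennreal"
  assumes [measurable]: "f \<in> borel_measurable borel"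
  shows "(\<integral>\<^sup>+ w. f w \<partial>lborel) = (\<integral>\<^sup>+ w. f (a - w) \<partial>lborel)"
  by (subst lborel_affine[of "-1" a], simp, subst nn_integral_density, simp, simp, subst nn_integral_distr) auto

lemma nn_integral_indicator_unique:
  assumes "\<exists>!k. P k"
  shows "(\<integral>\<^sup>+ k. of_bool (P k) \<partial>lattice) = 1"
proof -
  obtain k where k: "P k" "\<And>j. P j \<Longrightarrow> j = k" using assms by auto
  have "(\<lambda>j. of_bool (P j) :: ennreal) = indicator {k}"
  proof
    fix j show "of_bool (P j) = (indicator {k} j :: ennreal)"
      by (cases "j = k") (use k(1) in simp, use k(2)[of j] in auto)
  qed
  then show ?thesis by simp
qed

lemma unit_cube_tiles: "\<exists>!k. w + rvec k \<in> unit_cube"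
proof (intro ex1I[of _ "\<chi> i. - \<lfloor>w $ i\<rfloor>"])
  show "w + rvec (\<chi> i. - \<lfloor>w $ i\<rfloor>) \<in> unit_cube"
    by (auto simp: rvec_nth) linarith
  fix k assume *: "w + rvec k \<in> unit_cube"
  have "k $ i = - \<lfloor>w $ i\<rfloor>" for i
  proof -
    have "0 \<le> w $ i + of_int (k $ i)" "w $ i + of_int (k $ i) < 1"
      using * by (auto simp: rvec_nth)
    then have "\<lfloor>w $ i\<rfloor> = - (k $ i)"
      by (intro floor_unique) auto
    then show ?thesis by simp
  qed
  then show "k = (\<chi> i. - \<lfloor>w $ i\<rfloor>)" by (simp add: vec_eq_iff)
qed

text \<open>The lattice translates of the unit cube form a partition of unity, which is inserted
  under the integral over A. Translating each piece back leaves f unchanged, and then the translates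
  of A sum to 1.\<close>

lemma nn_integral_fundamental_domain:
  fixes f :: "real ^ 'n \<Rightarrow> ennreal"
  assumes f [measurable]: "f \<in> borel_measurable borel"
    and periodic: "\<And>w k. f (w + rvec k) = f w"
    and A [measurable]: "A \<in> sets borel"
    and tiles: "\<And>w. \<exists>!k. w + rvec k \<in> A"
  shows "(\<integral>\<^sup>+ w. f w * indicator A w \<partial>lborel) = (\<integral>\<^sup>+ w. f w \<partial>torus)"
proof -
  define Q :: "(real ^ 'n) set" where "Q = unit_cube"
  have [measurable]: "Q \<in> sets borel" unfolding Q_def by simp
  have one: "(\<integral>\<^sup>+ k. indicator B (w + rvec k) \<partial>lattice) = (1::ennreal)"
    if "\<And>w. \<exists>!k. w + rvec k \<in> B" for B and w :: "real ^ 'n"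
    using nn_integral_indicator_unique[OF that[of w]] by (simp add: indicator_def)
  have "(\<integral>\<^sup>+ w. f w * indicator A w \<partial>lborel)
      = (\<integral>\<^sup>+ w. f w * indicator A w * (\<integral>\<^sup>+ k. indicator Q (w + rvec k) \<partial>lattice) \<partial>lborel)"
    using one[OF unit_cube_tiles] unfolding Q_def by (simp only: mult_1_right)
  also have "\<dots> = (\<integral>\<^sup>+ w. (\<integral>\<^sup>+ k. f w * indicator A w * indicator Q (w + rvec k) \<partial>lattice) \<partial>lborel)"
    by (simp add: nn_integral_cmult)
  also have "\<dots> = (\<integral>\<^sup>+ k. (\<integral>\<^sup>+ w. f w * indicator A w * indicator Q (w + rvec k) \<partial>lborel) \<partial>lattice)"
    by (rule nn_integral_count_space_nn_integral) auto
  also have "\<dots> = (\<integral>\<^sup>+ k. (\<integral>\<^sup>+ w. f w * indicator Q w * indicator A (w + rvec (- k)) \<partial>lborel) \<partial>lattice)"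
  proof (rule nn_integral_cong)
    fix k
    have "(\<integral>\<^sup>+ w. f w * indicator A w * indicator Q (w + rvec k) \<partial>lborel)
       = (\<integral>\<^sup>+ w. f (- rvec k + w) * indicator A (- rvec k + w) * indicator Q (- rvec k + w + rvec k) \<partial>lborel)"
      by (rule nn_integral_shift_lborel) measurable
    also have "\<dots> = (\<integral>\<^sup>+ w. f w * indicator Q w * indicator A (w + rvec (- k)) \<partial>lborel)"
      using periodic[of _ "- k"] by (intro nn_integral_cong) (simp add: rvec_minus ac_simps)
    finally show "(\<integral>\<^sup>+ w. f w * indicator A w * indicator Q (w + rvec k) \<partial>lborel)
       = (\<integral>\<^sup>+ w. f w * indicator Q w * indicator A (w + rvec (- k)) \<partial>lborel)" .
  qed
  also have "\<dots> = (\<integral>\<^sup>+ k. (\<integral>\<^sup>+ w. f w * indicator Q w * indicator A (w + rvec k) \<partial>lborel) \<partial>lattice)"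
    using nn_integral_bij_count_space[of uminus UNIV UNIV
      "\<lambda>k. (\<integral>\<^sup>+ w. f w * indicator Q w * indicator A (w + rvec k) \<partial>lborel)"]
    by (simp add: bij_uminus)
  also have "\<dots> = (\<integral>\<^sup>+ w. (\<integral>\<^sup>+ k. f w * indicator Q w * indicator A (w + rvec k) \<partial>lattice) \<partial>lborel)"
    by (rule nn_integral_count_space_nn_integral[symmetric]) auto
  also have "\<dots> = (\<integral>\<^sup>+ w. f w * indicator Q w \<partial>lborel)"
    using one[OF tiles] by (simp add: nn_integral_cmult)
  finally show ?thesis by (simp add: nn_integral_torus Q_def)
qed

text \<open>The shifted cube is another fundamental domain of the lattice.\<close>

lemma nn_integral_torus_shift:
  fixes f :: "real ^ 'n \<Rightarrow> ennreal"
  assumes [measurable]: "f \<in> borel_measurable borel"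
    and periodic: "\<And>w k. f (w + rvec k) = f w"
  shows "(\<integral>\<^sup>+ w. f (w + a) \<partial>torus) = (\<integral>\<^sup>+ w. f w \<partial>torus)"
proof -
  have [measurable]: "{w. w - a \<in> unit_cube} \<in> sets borel" by measurable
  have "(\<integral>\<^sup>+ w. f (w + a) \<partial>torus)
      = (\<integral>\<^sup>+ w. f (a + w) * indicator {w. w - a \<in> unit_cube} (a + w) \<partial>lborel)"
    by (simp add: nn_integral_torus add.commute indicator_def)
  also have "\<dots> = (\<integral>\<^sup>+ w. f w * indicator {w. w - a \<in> unit_cube} w \<partial>lborel)"
    by (rule nn_integral_shift_lborel[symmetric]) measurable
  also have "\<dots> = (\<integral>\<^sup>+ w. f w \<partial>torus)"
  proof (rule nn_integral_fundamental_domain)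
    show "\<exists>!k. w + rvec k \<in> {w. w - a \<in> unit_cube}" for w :: "real ^ 'n"
      using unit_cube_tiles[of "w - a"] by (simp add: algebra_simps)
  qed (use periodic in auto)
  finally show ?thesis .
qed

text \<open>The reflected cube is again a fundamental domain: the lattice vector that moves w into
  it is the negative of the one that moves a - w into the unit cube.\<close>

lemma nn_integral_torus_reflect:
  fixes f :: "real ^ 'n \<Rightarrow> ennreal"
  assumes [measurable]: "f \<in> borel_measurable borel"
    and periodic: "\<And>w k. f (w + rvec k) = f w"
  shows "(\<integral>\<^sup>+ w. f (a - w) \<partial>torus) = (\<integral>\<^sup>+ w. f w \<partial>torus)"
proof -
  have [measurable]: "{w. a - w \<in> unit_cube} \<in> sets borel" by measurable
  have "(\<integral>\<^sup>+ w. f (a - w) \<partial>torus)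
      = (\<integral>\<^sup>+ w. f (a - w) * indicator {w. a - w \<in> unit_cube} (a - w) \<partial>lborel)"
    by (simp add: nn_integral_torus add.commute indicator_def)
  also have "\<dots> = (\<integral>\<^sup>+ w. f w * indicator {w. a - w \<in> unit_cube} w \<partial>lborel)"
    by (rule nn_integral_reflect_lborel[symmetric]) measurable
  also have "\<dots> = (\<integral>\<^sup>+ w. f w \<partial>torus)"
  proof (rule nn_integral_fundamental_domain)
    show "\<exists>!k. w + rvec k \<in> {w. a - w \<in> unit_cube}" for w :: "real ^ 'n"
    proof -
      obtain k where k: "a - w + rvec k \<in> unit_cube"
        "\<And>j. a - w + rvec j \<in> unit_cube \<Longrightarrow> j = k"
        using unit_cube_tiles[of "a - w"] by blast
      show ?thesis
      proof (rule ex1I[of _ "- k"])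
        show "w + rvec (- k) \<in> {w. a - w \<in> unit_cube}"
          using k(1) by (simp add: rvec_minus algebra_simps)
        show "j = - k" if "w + rvec j \<in> {w. a - w \<in> unit_cube}" for j
        proof -
          have "- j = k" using k(2)[of "- j"] that by (simp add: rvec_minus algebra_simps)
          then show ?thesis by (metis minus_equation_iff)
        qed
      qed
    qed
  qed (use periodic in auto)
  finally show ?thesis .
qed

text \<open>The representative of w in the fundamental domain. It turns a rotation of the torus into
  a self-map of the space of \<open>torus\<close>, so that its image measure can be formed.\<close>

definition wrap :: "real ^ 'n \<Rightarrow> real ^ 'n" where
  "wrap w = (\<chi> i. frac (w $ i))"

lemma wrap_eq: "\<exists>k. wrap w = w + rvec k"
  by (rule exI[of _ "\<chi> i. - \<lfloor>w $ i\<rfloor>"]) (simp add: wrap_def vec_eq_iff rvec_nth frac_def)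

lemma wrap_mem: "wrap w \<in> unit_cube"
  by (simp add: wrap_def frac_lt_1)

lemma wrap_measurable [measurable]: "wrap \<in> borel_measurable borel"
proof -
  have "(\<lambda>w::real ^ 'n. frac (w $ i)) \<in> borel_measurable borel" for i
    unfolding frac_def by (intro borel_measurable_diff borel_measurable_real_floor) measurable
  then show ?thesis unfolding wrap_def
    by (subst borel_measurable_euclidean_space) (auto simp: Basis_vec_def inner_axis)
qed

text \<open>Rotation invariance as an equality of measures, tested on indicators of Borel sets. In
  this form it also transports Bochner integrals of complex functions.\<close>

lemma torus_shift_distr:
  "distr torus torus (\<lambda>w. wrap (w + a)) = (torus :: (real ^ 'n) measure)"
proof (rule measure_eqI)
  have [measurable]: "(\<lambda>w. wrap (w + a)) \<in> measurable torus (torus :: (real ^ 'n) measure)"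
    using wrap_mem by (intro measurable_into_torus measurable_torus) (auto intro: measurable_compose)
  fix B assume "B \<in> sets (distr torus torus (\<lambda>w. wrap (w + a)))"
  then have B: "B \<in> sets torus" by simp
  then have [measurable]: "B \<in> sets borel" unfolding sets_torus
    by (subst (asm) sets_restrict_space_iff) auto
  have "wrap (w + rvec k) = wrap w" for w :: "real ^ 'n" and k
    by (simp add: wrap_def rvec_nth vec_eq_iff)
  then have sh: "(\<integral>\<^sup>+ w. indicator B (wrap (w + a)) \<partial>torus)
      = (\<integral>\<^sup>+ w. indicator B (wrap w) \<partial>(torus :: (real ^ 'n) measure))"
    by (intro nn_integral_torus_shift[where f = "\<lambda>w. indicator B (wrap w)"]) auto
  have "emeasure (distr torus torus (\<lambda>w. wrap (w + a))) B = (\<integral>\<^sup>+ w. indicator B w \<partial>distr torus torus (\<lambda>w. wrap (w + a)))"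
    using B by simp
  also have "\<dots> = (\<integral>\<^sup>+ w. indicator B (wrap (w + a)) \<partial>torus)"
    using B by (subst nn_integral_distr) auto
  also note sh
  also have "(\<integral>\<^sup>+ w. indicator B (wrap w) \<partial>(torus :: (real ^ 'n) measure)) = (\<integral>\<^sup>+ w. indicator B w \<partial>torus)"
  proof (intro nn_integral_cong)
    fix w :: "real ^ 'n" assume "w \<in> space torus"
    then have "wrap w = w" by (simp add: space_torus wrap_def vec_eq_iff frac_eq)
    then show "indicator B (wrap w) = (indicator B w :: ennreal)" by simp
  qed
  finally show "emeasure (distr torus torus (\<lambda>w. wrap (w + a))) B = emeasure torus B"
    using B by simp
qed simp

lemma integral_torus_shift:
  fixes f :: "real ^ 'n \<Rightarrow> complex"
  assumes [measurable]: "f \<in> borel_measurable borel"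
    and periodic: "\<And>w k. f (w + rvec k) = f w"
  shows "(LINT w|torus. f (w + a)) = (LINT w|torus. f w)"
proof -
  have m: "(\<lambda>w. wrap (w + a)) \<in> measurable torus (torus :: (real ^ 'n) measure)"
    using wrap_mem by (intro measurable_into_torus measurable_torus) (auto intro: measurable_compose)
  have "f (w + a) = f (wrap (w + a))" for w
    using wrap_eq[of "w + a"] periodic by metis
  then have "(LINT w|torus. f (w + a)) = (LINT w|torus. f (wrap (w + a)))" by simp
  also have "\<dots> = (LINT w|distr torus torus (\<lambda>w. wrap (w + a)). f w)"
    by (rule integral_distr[symmetric, OF m]) (simp add: measurable_torus)
  finally show ?thesis by (simp add: torus_shift_distr)
qed

section \<open>Fourier series\<close>

lemma unit_char_add: "unit_char (s + t) = unit_char s * unit_char t"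
  by (simp add: unit_char_def distrib_left flip: exp_add)

lemma norm_unit_char [simp]: "cmod (unit_char t) = 1"
  unfolding unit_char_def
  by (metis norm_exp_i_times mult.commute mult.left_commute of_real_mult of_real_numeral)

lemma cnj_unit_char: "cnj (unit_char t) = unit_char (- t)"
  by (simp add: unit_char_def exp_cnj)

lemma unit_char_0 [simp]: "unit_char 0 = 1"
  by (simp add: unit_char_def)

lemma unit_char_of_int [simp]: "unit_char (of_int k) = 1"
  using exp_integer_2pi[of "of_int k"] by (simp add: unit_char_def mult_ac)

lemma unit_char_continuous: "continuous_on UNIV unit_char"
  unfolding unit_char_def by (intro continuous_intros)

lemma unit_char_measurable [measurable]: "unit_char \<in> borel_measurable borel"
  by (rule borel_measurable_continuous_onI[OF unit_char_continuous])

lemma inner_rvec: "rvec j \<bullet> rvec k = of_int (\<Sum>i\<in>UNIV. j $ i * k $ i)"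
  by (simp add: inner_vec_def rvec_nth)

lemma unit_char_periodic: "unit_char ((w + rvec j) \<bullet> rvec k) = unit_char (w \<bullet> rvec k)"
  by (simp add: inner_add_left inner_rvec unit_char_add del: of_int_sum of_int_mult)

lemma character_measurable [measurable]:
  "(\<lambda>w. unit_char (w \<bullet> rvec k)) \<in> borel_measurable borel"
  "(\<lambda>w. unit_char (- (w \<bullet> rvec k))) \<in> borel_measurable borel"
  by measurable

lemma character_measurable_torus [measurable]:
  "(\<lambda>w. unit_char (w \<bullet> rvec k)) \<in> borel_measurable torus"
  "(\<lambda>w. unit_char (- (w \<bullet> rvec k))) \<in> borel_measurable torus"
  by (rule measurable_torus, measurable)+

lemma integrable_torus_bounded:
  fixes f :: "real ^ 'n \<Rightarrow> complex"
  assumes "f \<in> borel_measurable torus" "\<And>w. cmod (f w) \<le> B"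
  shows "integrable torus f"
  by (rule torus.integrable_const_bound[of _ B]) (use assms in auto)

text \<open>Shifting by \<open>1 / (2 k\<^sub>i)\<close> in a coordinate with \<open>k\<^sub>i \<noteq> 0\<close> changes the sign of the character.\<close>

lemma integral_character:
  fixes k :: "int ^ 'n"
  shows "(LINT w|torus. unit_char (w \<bullet> rvec k)) = (if k = 0 then 1 else 0)"
proof (cases "k = 0")
  case True
  have "measure torus (space (torus :: (real ^ 'n) measure)) = 1"
    by (simp add: measure_def prob_space_torus)
  then show ?thesis using True by (simp add: rvec_zero)
next
  case False
  then obtain i where i: "k $ i \<noteq> 0" by (auto simp: vec_eq_iff)
  define a :: "real ^ 'n" where "a = axis i (1 / (2 * of_int (k $ i)))"
  have a: "a \<bullet> rvec k = 1 / 2"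
    using i by (simp add: a_def inner_axis' rvec_nth)
  have half: "unit_char (1 / 2) = -1"
    by (simp add: unit_char_def)
  have "(LINT w|torus. unit_char (w \<bullet> rvec k)) = (LINT w|torus. unit_char ((w + a) \<bullet> rvec k))"
    by (rule integral_torus_shift[symmetric]) (auto simp: unit_char_periodic)
  also have "\<dots> = - (LINT w|torus. unit_char (w \<bullet> rvec k))"
    by (simp add: inner_add_left a unit_char_add half)
  finally show ?thesis using False by simp
qed

section \<open>Lattice sums as integrals, and absolutely convergent Fourier series\<close>

lemma borel_measurable_lattice_pair [measurable (raw)]:
  fixes f :: "int ^ 'n \<Rightarrow> 'b \<Rightarrow> 'c::topological_space"
  assumes "\<And>k. f k \<in> borel_measurable M"
  shows "(\<lambda>z. f (fst z) (snd z)) \<in> borel_measurable (lattice \<Otimes>\<^sub>M M)"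
  by (rule measurable_pair_measure_countable1) (use assms in auto)

text \<open>Fubini, with the hypothesis in the form in which it is checked later: the lattice sum
  outside, the integral of the modulus inside. Since the lattice is countable, measurability is
  asked for slice by slice.\<close>

lemma integral_lattice_swap:
  fixes f :: "int ^ 'n \<Rightarrow> 'b \<Rightarrow> complex"
  assumes "sigma_finite_measure M" and f: "\<And>k. f k \<in> borel_measurable M"
    and fin: "(\<integral>\<^sup>+ k. \<integral>\<^sup>+ x. cmod (f k x) \<partial>M \<partial>lattice) < \<infinity>"
  shows "integrable M (\<lambda>x. LINT k|lattice. f k x)"
    and "(LINT x|M. LINT k|lattice. f k x) = (LINT k|lattice. LINT x|M. f k x)"
proof -
  interpret M: sigma_finite_measure M by fact
  interpret P: pair_sigma_finite "lattice :: (int ^ 'n) measure" M ..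
  have [measurable]: "(\<lambda>z. f (fst z) (snd z)) \<in> borel_measurable (lattice \<Otimes>\<^sub>M M)"
    by (rule borel_measurable_lattice_pair[OF f])
  have "integrable (lattice \<Otimes>\<^sub>M M) (\<lambda>z. f (fst z) (snd z))"
    using fin by (intro integrableI_bounded) (auto simp flip: M.nn_integral_fst)
  then have int': "integrable (lattice \<Otimes>\<^sub>M M) (case_prod f)"
    by (simp add: case_prod_beta')
  show "integrable M (\<lambda>x. LINT k|lattice. f k x)"
    using P.integrable_snd[OF int'] .
  show "(LINT x|M. LINT k|lattice. f k x) = (LINT k|lattice. LINT x|M. f k x)"
    using P.Fubini_integral[OF int'] .
qed

lemma integral_lattice_single:
  fixes f :: "int ^ 'n \<Rightarrow> complex"
  shows "(LINT j|lattice. f j * indicator {k} j) = f k"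
proof -
  have "(\<lambda>j. f j * indicator {k} j) = (\<lambda>j. indicat_real {k} j *\<^sub>R f k)"
    by (auto simp: indicator_def)
  then have "(LINT j|lattice. f j * indicator {k} j) = measure lattice {k} *\<^sub>R f k"
    by simp
  then show ?thesis by (simp add: measure_count_space)
qed

lemma integrable_lattice_iff:
  fixes a :: "int ^ 'n \<Rightarrow> complex"
  shows "integrable lattice a \<longleftrightarrow> (\<integral>\<^sup>+ k. cmod (a k) \<partial>lattice) < \<infinity>"
  by (auto simp: integrable_iff_bounded)

text \<open>Stated as an integral for the counting measure, so that absolute convergence and
  interchange are facts of integration theory. The minus sign is that of the short-time Fourier
  transform; coefficients are therefore recovered with a plus sign.\<close>

definition fourier_series :: "(int ^ 'n \<Rightarrow> complex) \<Rightarrow> real ^ 'n \<Rightarrow> complex" where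
  "fourier_series a w = (LINT k|lattice. a k * unit_char (- (w \<bullet> rvec k)))"

lemma integrable_lattice_bounded:
  fixes a b :: "int ^ 'n \<Rightarrow> complex"
  assumes "integrable lattice a" "\<And>k. cmod (b k) \<le> B * cmod (a k)"
  shows "integrable lattice b"
  by (rule Bochner_Integration.integrable_bound[of _ "\<lambda>k. B * cmod (a k)"])
    (use assms in \<open>auto intro!: AE_I2 order_trans[OF _ abs_ge_self]\<close>)

lemma integrable_fourier_term:
  "integrable lattice a \<Longrightarrow> integrable lattice (\<lambda>k. a k * unit_char (t k))"
  by (erule integrable_lattice_bounded[where B = 1]) (simp add: norm_mult)

lemma fourier_series_bound:
  assumes "integrable lattice a"
  shows "cmod (fourier_series a w) \<le> (LINT k|lattice. cmod (a k))"
proof -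
  have "cmod (fourier_series a w) \<le> (LINT k|lattice. cmod (a k * unit_char (- (w \<bullet> rvec k))))"
    unfolding fourier_series_def by (rule integral_norm_bound)
  then show ?thesis by (simp add: norm_mult)
qed

lemma fourier_series_measurable [measurable]: "fourier_series a \<in> borel_measurable borel"
proof -
  have "(\<lambda>z. (\<lambda>k w. a k * unit_char (- (w \<bullet> rvec k))) (fst z) (snd z))
      \<in> borel_measurable (lattice \<Otimes>\<^sub>M borel)"
    by (rule borel_measurable_lattice_pair) measurable
  from measurable_compose[OF measurable_pair_swap' this]
  have "(\<lambda>(w, k). a k * unit_char (- (w \<bullet> rvec k))) \<in> borel_measurable (borel \<Otimes>\<^sub>M lattice)"
    by (simp add: case_prod_beta')
  from lattice.borel_measurable_lebesgue_integral[OF this] show ?thesis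
    by (simp add: fourier_series_def[abs_def])
qed

lemma fourier_series_measurable_torus [measurable]: "fourier_series a \<in> borel_measurable torus"
  by (rule measurable_torus) measurable

text \<open>Absolute summability allows termwise integration, and orthogonality of the characters
  leaves the term k.\<close>

lemma fourier_series_coefficient:
  assumes a: "integrable lattice a"
  shows "(LINT w|torus. fourier_series a w * unit_char (w \<bullet> rvec k)) = a k"
proof -
  have "(LINT w|torus. fourier_series a w * unit_char (w \<bullet> rvec k))
     = (LINT w|torus. LINT j|lattice. a j * unit_char (w \<bullet> rvec (k - j)))"
  proof (rule Bochner_Integration.integral_cong[OF refl])
    fix w :: "real ^ 'a"
    have "unit_char (- (w \<bullet> rvec j)) * unit_char (w \<bullet> rvec k) = unit_char (w \<bullet> rvec (k - j))" for j
      by (simp add: rvec_diff inner_diff_right flip: unit_char_add)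
    then show "fourier_series a w * unit_char (w \<bullet> rvec k) = (LINT j|lattice. a j * unit_char (w \<bullet> rvec (k - j)))"
      using integral_mult_left_zero[of lattice "\<lambda>j. a j * unit_char (- (w \<bullet> rvec j))" "unit_char (w \<bullet> rvec k)"]
      by (simp add: fourier_series_def mult.assoc)
  qed
  also have "\<dots> = (LINT j|lattice. LINT w|torus. a j * unit_char (w \<bullet> rvec (k - j)))"
  proof (rule integral_lattice_swap(2)[OF torus.sigma_finite_measure_axioms])
    show "(\<integral>\<^sup>+ j. \<integral>\<^sup>+ w. cmod (a j * unit_char (w \<bullet> rvec (k - j))) \<partial>torus \<partial>lattice) < \<infinity>"
      using a by (simp add: norm_mult prob_space_torus integrable_lattice_iff)
  qed measurable
  also have "\<dots> = (LINT j|lattice. a j * indicator {k} j)"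
    by (rule Bochner_Integration.integral_cong) (auto simp: integral_character indicator_def)
  also have "\<dots> = a k"
    by (rule integral_lattice_single)
  finally show ?thesis .
qed

lemma integrable_lattice_mult_bounded:
  fixes a b :: "int ^ 'n \<Rightarrow> complex"
  assumes "integrable lattice a" "\<And>k. cmod (b k) \<le> B"
  shows "integrable lattice (\<lambda>k. a k * b k)"
  by (rule integrable_lattice_bounded[OF assms(1), of _ B])
    (auto simp: norm_mult mult.commute[of B] intro!: mult_left_mono assms)

text \<open>Parseval for absolutely summable sequences requires no Hilbert space: only the second
  series is expanded, and each resulting term is a coefficient of the first, which is
  bounded.\<close>

lemma fourier_series_parseval:
  fixes a b :: "int ^ 'n \<Rightarrow> complex"
  assumes a: "integrable lattice a" and b: "integrable lattice b"
  shows "(LINT w|torus. fourier_series a w * cnj (fourier_series b w)) = (LINT k|lattice. a k * cnj (b k))"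
proof -
  have "(LINT w|torus. fourier_series a w * cnj (fourier_series b w))
     = (LINT w|torus. LINT k|lattice. cnj (b k) * (fourier_series a w * unit_char (w \<bullet> rvec k)))"
  proof (rule Bochner_Integration.integral_cong[OF refl])
    fix w :: "real ^ 'n"
    have "cnj (fourier_series b w) = (LINT k|lattice. cnj (b k * unit_char (- (w \<bullet> rvec k))))"
      unfolding fourier_series_def by (rule Bochner_Integration.integral_cnj[symmetric])
    also have "\<dots> = (LINT k|lattice. cnj (b k) * unit_char (w \<bullet> rvec k))"
      by (simp add: cnj_unit_char)
    finally have "fourier_series a w * cnj (fourier_series b w)
      = (LINT k|lattice. fourier_series a w * (cnj (b k) * unit_char (w \<bullet> rvec k)))"
      by (simp only: integral_mult_right_zero)
    then show "fourier_series a w * cnj (fourier_series b w)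
      = (LINT k|lattice. cnj (b k) * (fourier_series a w * unit_char (w \<bullet> rvec k)))"
      by (simp add: mult_ac)
  qed
  also have "\<dots> = (LINT k|lattice. LINT w|torus. cnj (b k) * (fourier_series a w * unit_char (w \<bullet> rvec k)))"
  proof (rule integral_lattice_swap(2)[OF torus.sigma_finite_measure_axioms])
    define S where "S = (LINT k|lattice. cmod (a k))"
    have "(\<integral>\<^sup>+ k. \<integral>\<^sup>+ w. cmod (cnj (b k) * (fourier_series a w * unit_char (w \<bullet> rvec k))) \<partial>torus \<partial>lattice)
      \<le> (\<integral>\<^sup>+ k. \<integral>\<^sup>+ w. ennreal (cmod (b k)) * ennreal S \<partial>(torus :: (real ^ 'n) measure) \<partial>lattice)"
    proof (intro nn_integral_mono)
      fix k and w
      have "cmod (b k) * cmod (fourier_series a w) \<le> cmod (b k) * S"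
        unfolding S_def by (intro mult_left_mono fourier_series_bound a) simp
      then show "ennreal (cmod (cnj (b k) * (fourier_series a w * unit_char (w \<bullet> rvec k))))
          \<le> ennreal (cmod (b k)) * ennreal S"
        by (simp add: norm_mult ennreal_leI S_def flip: ennreal_mult)
    qed
    also have "\<dots> = (\<integral>\<^sup>+ k. cmod (b k) \<partial>lattice) * ennreal S"
      by (simp add: prob_space_torus nn_integral_multc)
    also have "\<dots> < \<infinity>"
      using b by (auto simp: integrable_lattice_iff ennreal_mult_less_top)
    finally show "(\<integral>\<^sup>+ k. \<integral>\<^sup>+ w. cmod (cnj (b k) * (fourier_series a w * unit_char (w \<bullet> rvec k))) \<partial>torus \<partial>lattice) < \<infinity>" .
  qed measurable
  also have "\<dots> = (LINT k|lattice. a k * cnj (b k))"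
    by (simp add: fourier_series_coefficient[OF a] mult.commute)
  finally show ?thesis .
qed

section \<open>Uniqueness of Fourier coefficients\<close>

text \<open>Replaces the torus by a compact subset of a Euclidean space. Real polynomials restrict
  to trigonometric polynomials there, and the Stone-Weierstrass theorem applies.\<close>

definition torus_embed :: "real ^ 'n \<Rightarrow> complex ^ 'n" where
  "torus_embed w = (\<chi> i. unit_char (w $ i))"

lemma torus_embed_continuous: "continuous_on UNIV torus_embed"
proof -
  have "continuous_on UNIV (\<lambda>w::real ^ 'n. unit_char (w $ i))" for i
    by (rule continuous_on_compose2[OF unit_char_continuous]) (auto intro!: continuous_intros)
  then show ?thesis unfolding torus_embed_def[abs_def] by (rule continuous_on_vec_lambda)
qed

lemma unit_char_eq_imp: "unit_char s = unit_char t \<Longrightarrow> \<exists>k::int. s = t + k"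
proof -
  assume "unit_char s = unit_char t"
  then obtain n :: int where "2 * complex_of_real pi * \<i> * of_real s = 2 * complex_of_real pi * \<i> * of_real t + (of_int (2 * n) * pi) * \<i>"
    unfolding unit_char_def exp_eq by blast
  then have "(2 * complex_of_real pi * \<i>) * of_real s = (2 * complex_of_real pi * \<i>) * of_real (t + n)"
    by (simp add: algebra_simps)
  then have "complex_of_real s = of_real (t + n)" by (subst (asm) mult_left_cancel) auto
  then have "s = t + n" using of_real_eq_iff by blast
  then show ?thesis ..
qed

lemma torus_embed_inj: "inj_on torus_embed unit_cube"
proof (rule inj_onI)
  fix v w :: "real ^ 'n"
  assume v: "v \<in> unit_cube" and w: "w \<in> unit_cube" and eq: "torus_embed v = torus_embed w"
  have "v $ i = w $ i" for i
  proof -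
    have "unit_char (v $ i) = unit_char (w $ i)"
      using eq by (simp add: torus_embed_def vec_eq_iff)
    then obtain k :: int where k: "v $ i = w $ i + k" using unit_char_eq_imp by blast
    have "0 \<le> v $ i" "v $ i < 1" "0 \<le> w $ i" "w $ i < 1" using v w by auto
    with k have "k = 0" by linarith
    with k show ?thesis by simp
  qed
  then show "v = w" by (simp add: vec_eq_iff)
qed

text \<open>One character is added at a time, so that closure under products and vanishing of
  integrals are proved by induction.\<close>

inductive trig_poly :: "(real ^ 'n \<Rightarrow> complex) \<Rightarrow> bool" where
  zero: "trig_poly (\<lambda>w. 0)"
| char: "trig_poly f \<Longrightarrow> trig_poly (\<lambda>w. f w + c * unit_char (w \<bullet> rvec k))"

lemma trig_poly_char: "trig_poly (\<lambda>w. c * unit_char (w \<bullet> rvec k))"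
  using trig_poly.char[OF trig_poly.zero, of c k] by simp

lemma trig_poly_add: "trig_poly g \<Longrightarrow> trig_poly f \<Longrightarrow> trig_poly (\<lambda>w. f w + g w)"
  by (induction rule: trig_poly.induct) (auto simp flip: add.assoc intro: trig_poly.char)

lemma trig_poly_mult_char: "trig_poly f \<Longrightarrow> trig_poly (\<lambda>w. f w * (c * unit_char (w \<bullet> rvec k)))"
proof (induction rule: trig_poly.induct)
  case zero
  then show ?case by (simp add: trig_poly.zero)
next
  case (char f d j)
  have eq: "d * unit_char (w \<bullet> rvec j) * (c * unit_char (w \<bullet> rvec k)) = (d * c) * unit_char (w \<bullet> rvec (j + k))"
    for w :: "real ^ 'a"
    by (simp add: rvec_add inner_add_right unit_char_add mult_ac)
  then show ?case using trig_poly.char[OF char.IH, of "d * c" "j + k"]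
    by (simp only: distrib_right eq)
qed

lemma trig_poly_mult: "trig_poly g \<Longrightarrow> trig_poly f \<Longrightarrow> trig_poly (\<lambda>w. f w * g w)"
proof (induction rule: trig_poly.induct)
  case zero
  then show ?case by (simp add: trig_poly.zero)
next
  case (char g c k)
  then show ?case
    using trig_poly_add[OF trig_poly_mult_char[OF char.prems, of c k] char.IH[OF char.prems]]
    by (simp add: distrib_left)
qed

lemma trig_poly_const: "trig_poly (\<lambda>w. c)"
  using trig_poly_char[of c 0] by (simp add: rvec_zero)

lemma trig_poly_sum: "finite I \<Longrightarrow> (\<And>i. i \<in> I \<Longrightarrow> trig_poly (f i)) \<Longrightarrow> trig_poly (\<lambda>w. \<Sum>i\<in>I. f i w)"
  by (induction rule: finite_induct) (auto intro: trig_poly.zero trig_poly_add)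

lemma complex_vec_expansion:
  fixes z :: "complex ^ 'n"
  shows "z = (\<Sum>i\<in>UNIV. Re (z $ i) *\<^sub>R axis i 1 + Im (z $ i) *\<^sub>R axis i \<i>)"
proof -
  have "Re (z $ i) *\<^sub>R axis i 1 + Im (z $ i) *\<^sub>R axis i \<i> = (axis i (z $ i) :: complex ^ 'n)" for i
    by (auto simp: vec_eq_iff axis_def complex_eq_iff)
  moreover have "z = (\<Sum>i\<in>UNIV. axis i (z $ i))"
    by (simp add: vec_eq_iff axis_def)
  ultimately show ?thesis by simp
qed

lemma trig_poly_torus_embed:
  assumes "real_polynomial_function p"
  shows "trig_poly (\<lambda>w. complex_of_real (p (torus_embed w)))"
  using assms
proof (induction rule: real_polynomial_function.induct)
  case (linear p)
  then interpret p: bounded_linear p .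
  \<comment> \<open>With u = \<open>unit_char (w $ i)\<close>, the coefficients come from Re u = (u
    + cnj u) / 2 and Im u = \<i> (cnj u - u) / 2, weighted by the values of the real-linear p at the
    basis vectors \<open>axis i 1\<close> and \<open>axis i \<i>\<close>.\<close>
  define h where "h i w = (of_real (p (axis i 1)) / 2 - \<i> * of_real (p (axis i \<i>)) / 2) * unit_char (w \<bullet> rvec (axis i 1))
      + (of_real (p (axis i 1)) / 2 + \<i> * of_real (p (axis i \<i>)) / 2) * unit_char (w \<bullet> rvec (- axis i 1))"
    for i and w :: "real ^ 'a"
  have "complex_of_real (p (torus_embed w)) = (\<Sum>i\<in>UNIV. h i w)" for w
  proof -
    have r: "w \<bullet> rvec (axis i 1) = w $ i" "w \<bullet> rvec (- axis i 1) = - w $ i" for i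
    proof -
      have "rvec (axis i 1) = axis i 1" by (simp add: rvec_def axis_def vec_eq_iff)
      then show "w \<bullet> rvec (axis i 1) = w $ i" "w \<bullet> rvec (- axis i 1) = - w $ i"
        by (simp_all add: cart_eq_inner_axis[symmetric] rvec_minus)
    qed
    have re: "complex_of_real (Re (unit_char t)) = (unit_char t + unit_char (- t)) / 2"
      and im: "complex_of_real (Im (unit_char t)) = \<i> * (unit_char (- t) - unit_char t) / 2" for t
      by (simp_all add: complex_eq_iff flip: cnj_unit_char)
    have "p (torus_embed w)
      = (\<Sum>i\<in>UNIV. Re (unit_char (w $ i)) * p (axis i 1) + Im (unit_char (w $ i)) * p (axis i \<i>))"
      by (subst complex_vec_expansion) (simp add: p.sum p.add p.scaleR torus_embed_def)
    then have "complex_of_real (p (torus_embed w))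
      = (\<Sum>i\<in>UNIV. of_real (Re (unit_char (w $ i))) * of_real (p (axis i 1))
          + of_real (Im (unit_char (w $ i))) * of_real (p (axis i \<i>)))"
      by simp
    also have "\<dots> = (\<Sum>i\<in>UNIV. h i w)"
      by (intro sum.cong refl) (simp add: h_def re im r field_simps)
    finally show ?thesis .
  qed
  moreover have "trig_poly (\<lambda>w. \<Sum>i\<in>UNIV. h i w)"
    unfolding h_def[abs_def] by (intro trig_poly_sum trig_poly_add trig_poly_char) simp
  ultimately show ?case by simp
qed (auto intro: trig_poly_const trig_poly_add trig_poly_mult)

section \<open>An integrable function all of whose Fourier coefficients vanish\<close>

context
  fixes D :: "real ^ 'n \<Rightarrow> complex"
  assumes D: "integrable torus D"
    and coefficients: "\<And>k. (LINT w|torus. D w * unit_char (w \<bullet> rvec k)) = 0"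
begin

lemma null_coefficients_integrable_mult:
  assumes "f \<in> borel_measurable borel" "\<And>w. cmod (f w) \<le> B"
  shows "integrable torus (\<lambda>w. D w * f w)"
proof (rule Bochner_Integration.integrable_bound[of _ "\<lambda>w. B * cmod (D w)"])
  show "AE w in torus. norm (D w * f w) \<le> norm (B * cmod (D w))"
  proof (rule AE_I2)
    fix w
    have "norm (D w * f w) \<le> B * cmod (D w)"
      using mult_left_mono[OF assms(2)[of w], of "cmod (D w)"] by (simp add: norm_mult mult.commute)
    then show "norm (D w * f w) \<le> norm (B * cmod (D w))" by simp
  qed
qed (use D assms in \<open>auto intro!: borel_measurable_times[OF _ measurable_torus]\<close>)

lemma null_coefficients_trig_poly: "trig_poly f \<Longrightarrow> integrable torus (\<lambda>w. D w * f w) \<and> (LINT w|torus. D w * f w) = 0"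
proof (induction rule: trig_poly.induct)
  case (char f c k)
  have i: "integrable torus (\<lambda>w. D w * unit_char (w \<bullet> rvec k))"
    by (rule null_coefficients_integrable_mult[of _ 1]) auto
  have eq: "D w * (f w + c * unit_char (w \<bullet> rvec k)) = D w * f w + c * (D w * unit_char (w \<bullet> rvec k))" for w
    by (simp add: algebra_simps)
  show ?case using char i unfolding eq
    by (simp add: coefficients)
qed simp

text \<open>A polynomial close to g on the image of the torus integrates to 0 against D, so the
  integral is bounded by the approximation error times the L1 norm of D, which is arbitrarily
  small.\<close>

lemma null_coefficients_continuous:
  fixes g :: "complex ^ 'n \<Rightarrow> real"
  assumes g: "continuous_on UNIV g"
  shows "(LINT w|torus. D w * of_real (g (torus_embed w))) = 0"
proof (rule ccontr)
  let ?I = "LINT w|torus. D w * of_real (g (torus_embed w))"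
  assume "?I \<noteq> 0"
  \<comment> \<open>Stone-Weierstrass asks for a compact set. The image of the closed cube is one,
    and by periodicity it contains the image of every point.\<close>
  define S :: "(complex ^ 'n) set" where "S = torus_embed ` cbox 0 1"
  have S: "compact S" unfolding S_def
    using torus_embed_continuous by (intro compact_continuous_image) (auto intro: continuous_on_subset)
  have inS: "torus_embed w \<in> S" for w :: "real ^ 'n"
  proof -
    have "torus_embed w = torus_embed (wrap w)"
    proof -
      have "unit_char (w $ i) = unit_char (frac (w $ i))" for i
      proof -
        have "unit_char (w $ i) = unit_char (frac (w $ i) + of_int \<lfloor>w $ i\<rfloor>)" by (simp add: frac_def)
        also have "\<dots> = unit_char (frac (w $ i))" by (simp only: unit_char_add unit_char_of_int mult_1_right)
        finally show ?thesis .
      qed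
      then show ?thesis by (simp add: torus_embed_def wrap_def)
    qed
    moreover have "wrap w \<in> cbox 0 1" using wrap_mem[of w] by (auto simp: mem_box_cart less_imp_le)
    ultimately show ?thesis unfolding S_def by blast
  qed
  define B where "B = (LINT w|torus. cmod (D w))"
  have B: "0 \<le> B" unfolding B_def by simp
  \<comment> \<open>Chosen so that e (B + 1) is half of the modulus of the integral; the 1 guards
    against B = 0.\<close>
  define e where "e = cmod ?I / (2 * (B + 1))"
  have e: "e > 0" using \<open>?I \<noteq> 0\<close> B by (simp add: e_def)
  obtain p where p: "real_polynomial_function p" "\<And>x. x \<in> S \<Longrightarrow> \<bar>g x - p x\<bar> < e"
    using Stone_Weierstrass_real_polynomial_function[OF S continuous_on_subset[OF g] e] by blast
  have pc: "continuous_on UNIV p"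
    using p(1) by (simp add: real_polynomial_function_eq continuous_on_polymonial_function)
  have gm: "(\<lambda>w. g (torus_embed w)) \<in> borel_measurable borel"
    and pm: "(\<lambda>w. p (torus_embed w)) \<in> borel_measurable borel"
    by (intro borel_measurable_continuous_onI continuous_on_compose2[OF g torus_embed_continuous]
      continuous_on_compose2[OF pc torus_embed_continuous]; simp)+
  have ip: "integrable torus (\<lambda>w. D w * of_real (p (torus_embed w)))"
    and Ip: "(LINT w|torus. D w * of_real (p (torus_embed w))) = 0"
    using null_coefficients_trig_poly[OF trig_poly_torus_embed[OF p(1)]] by auto
  have bd: "cmod (of_real (g (torus_embed w)) - of_real (p (torus_embed w))) \<le> e" for w :: "real ^ 'n"
    using p(2)[OF inS[of w]] by (simp flip: of_real_diff)
  have idiff: "integrable torus (\<lambda>w. D w * (of_real (g (torus_embed w)) - of_real (p (torus_embed w))))"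
    by (rule null_coefficients_integrable_mult[of _ e]) (use gm pm bd in auto)
  have "?I = (LINT w|torus. D w * (of_real (g (torus_embed w)) - of_real (p (torus_embed w))) + D w * of_real (p (torus_embed w)))"
    by (simp add: algebra_simps)
  also have "\<dots> = (LINT w|torus. D w * (of_real (g (torus_embed w)) - of_real (p (torus_embed w))))"
    using idiff ip Ip by simp
  finally have I: "?I = \<dots>" .
  have "cmod ?I \<le> (LINT w|torus. cmod (D w * (of_real (g (torus_embed w)) - of_real (p (torus_embed w)))))"
    unfolding I by (rule integral_norm_bound)
  also have "\<dots> \<le> (LINT w|torus. e * cmod (D w))"
    using D bd by (intro integral_mono integrable_norm[OF idiff])
      (auto simp: norm_mult mult.commute[of e] intro!: mult_left_mono)
  also have "\<dots> = e * B" by (simp add: B_def)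
  also have "\<dots> \<le> e * (B + 1)" using e by simp
  also have "\<dots> = cmod ?I / 2" using B by (simp add: e_def add_nonneg_eq_0_iff divide_simps) 
  finally show False using \<open>?I \<noteq> 0\<close> by simp
qed

text \<open>The embedding is injective on the half-open cube, so points of the cube outside K have
  positive distance from the compact image of K. Hence the continuous functions \<open>g j\<close>
  of this distance converge to the indicator of K.\<close>

lemma null_coefficients_compact:
  assumes K: "compact K" "K \<subseteq> unit_cube"
  shows "(LINT w|torus. indicat_real K w *\<^sub>R D w) = 0"
\<comment> \<open>\<open>infdist\<close> to the empty set is 0 by convention, so the empty set is
  treated apart.\<close>
proof (cases "K = {}")
  case False
  define T where "T = torus_embed ` K"
  have T: "closed T" "T \<noteq> {}" unfolding T_def
    using K False torus_embed_continuous by (auto intro!: compact_imp_closed compact_continuous_image intro: continuous_on_subset)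
  define g where "g j z = max 0 (1 - real j * infdist z T)" for j z
  have gc: "continuous_on UNIV (g j)" for j
    unfolding g_def[abs_def] by (intro continuous_intros)
  have z: "(LINT w|torus. of_real (g j (torus_embed w)) * D w) = 0" for j
    using null_coefficients_continuous[OF gc[of j]] by (simp add: mult.commute)
  have Km: "K \<in> sets borel" using K by (simp add: compact_imp_closed)
  have "(\<lambda>j. LINT w|torus. of_real (g j (torus_embed w)) * D w) \<longlonglongrightarrow> (LINT w|torus. indicat_real K w *\<^sub>R D w)"
  proof (rule integral_dominated_convergence[where w = "\<lambda>w. cmod (D w)"])
    show "(\<lambda>w. indicat_real K w *\<^sub>R D w) \<in> borel_measurable torus"
      using D Km by (intro borel_measurable_scaleR[OF measurable_torus]) auto
    show "(\<lambda>w. of_real (g j (torus_embed w)) * D w) \<in> borel_measurable torus" for j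
    proof -
      have "(\<lambda>w::real ^ 'n. g j (torus_embed w)) \<in> borel_measurable borel"
        by (intro borel_measurable_continuous_onI continuous_on_compose2[OF gc torus_embed_continuous]) simp
      then have "(\<lambda>w::real ^ 'n. complex_of_real (g j (torus_embed w))) \<in> borel_measurable torus"
        by (intro measurable_torus) measurable
      then show ?thesis using D by (intro borel_measurable_times) auto
    qed
    show "integrable torus (\<lambda>w. cmod (D w))" using D by simp
    show "AE w in torus. cmod (of_real (g j (torus_embed w)) * D w) \<le> cmod (D w)" for j
    proof (rule AE_I2)
      fix w :: "real ^ 'n"
      have "\<bar>g j (torus_embed w)\<bar> \<le> 1" by (auto simp: g_def infdist_nonneg)
      then show "cmod (of_real (g j (torus_embed w)) * D w) \<le> cmod (D w)"
        by (simp add: norm_mult mult_left_le_one_le)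
    qed
    show "AE w in torus. (\<lambda>j. of_real (g j (torus_embed w)) * D w) \<longlonglongrightarrow> indicat_real K w *\<^sub>R D w"
    proof (rule AE_I2)
      fix w :: "real ^ 'n" assume "w \<in> space torus"
      then have w: "w \<in> unit_cube" by (simp add: space_torus)
      have "(\<lambda>j. g j (torus_embed w)) \<longlonglongrightarrow> indicat_real K w"
      proof (cases "w \<in> K")
        case True
        then have "infdist (torus_embed w) T = 0" by (auto simp: T_def)
        then show ?thesis using True by (simp add: g_def)
      next
        case False
        then have "torus_embed w \<notin> T"
          using inj_onD[OF torus_embed_inj _ w] K(2) by (auto simp: T_def)
        then have pos: "infdist (torus_embed w) T > 0"
          using infdist_pos_not_in_closed[OF T] by simp
        obtain N where N: "1 < real N * infdist (torus_embed w) T"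
          using reals_Archimedean3[OF pos] by blast
        have "eventually (\<lambda>j. g j (torus_embed w) = 0) sequentially"
          using eventually_ge_at_top[of N]
        proof eventually_elim
          case (elim j)
          then have "real N * infdist (torus_embed w) T \<le> real j * infdist (torus_embed w) T"
            using pos by simp
          then show ?case using N by (simp add: g_def)
        qed
        then show ?thesis using False by (simp add: tendsto_eventually)
      qed
      then show "(\<lambda>j. of_real (g j (torus_embed w)) * D w) \<longlonglongrightarrow> indicat_real K w *\<^sub>R D w"
        unfolding scaleR_conv_of_real by (intro tendsto_intros)
    qed
  qed
  then show ?thesis unfolding z by (simp add: LIMSEQ_const_iff)
qed simp

lemma null_coefficients_integrable_indicator:
  assumes [measurable]: "A \<in> sets borel"
  shows "integrable torus (\<lambda>w. indicat_real A w *\<^sub>R D w)"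
proof (rule Bochner_Integration.integrable_bound[OF D])
  show "(\<lambda>w. indicat_real A w *\<^sub>R D w) \<in> borel_measurable torus"
    using D by (intro borel_measurable_scaleR[OF measurable_torus]) auto
qed (auto simp: indicator_def)

lemma null_coefficients_closed:
  assumes C: "closed C"
  shows "(LINT w|torus. indicat_real C w *\<^sub>R D w) = 0"
proof -
  \<comment> \<open>C meets the half-open cube in a set that need not be compact; these compact
    pieces exhaust it.\<close>
  define K where "K j = C \<inter> cbox 0 (\<chi> i. 1 - 1 / (1 + real j))" for j
  have z: "(LINT w|torus. indicat_real (K j) w *\<^sub>R D w) = 0" for j
  proof (rule null_coefficients_compact)
    show "compact (K j)" unfolding K_def using C by (intro closed_Int_compact compact_cbox)
    have "1 - 1 / (1 + real j) < 1" by simp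
    then show "K j \<subseteq> unit_cube" unfolding K_def mem_box_cart subset_iff
      by (auto simp: mem_box_cart intro: le_less_trans)
  qed
  have Km: "K j \<in> sets borel" for j unfolding K_def using C by (intro sets.Int) auto
  have "(\<lambda>j. LINT w|torus. indicat_real (K j) w *\<^sub>R D w) \<longlonglongrightarrow> (LINT w|torus. indicat_real C w *\<^sub>R D w)"
  proof (rule integral_dominated_convergence[where w = "\<lambda>w. cmod (D w)"])
    show "(\<lambda>w. indicat_real C w *\<^sub>R D w) \<in> borel_measurable torus"
      using null_coefficients_integrable_indicator[of C] C by auto
    show "(\<lambda>w. indicat_real (K j) w *\<^sub>R D w) \<in> borel_measurable torus" for j
      using null_coefficients_integrable_indicator[OF Km] by auto
    show "integrable torus (\<lambda>w. cmod (D w))" using D by simp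
    show "AE w in torus. norm (indicat_real (K j) w *\<^sub>R D w) \<le> cmod (D w)" for j
      by (auto simp: indicator_def)
    show "AE w in torus. (\<lambda>j. indicat_real (K j) w *\<^sub>R D w) \<longlonglongrightarrow> indicat_real C w *\<^sub>R D w"
    proof (rule AE_I2)
      fix w :: "real ^ 'n" assume "w \<in> space torus"
      then have w: "w \<in> unit_cube" by (simp add: space_torus)
      have "(\<lambda>j. 1 / (1 + real j)) \<longlonglongrightarrow> 0"
        using LIMSEQ_inverse_real_of_nat by (simp add: inverse_eq_divide add.commute)
      then have lim: "(\<lambda>j. 1 - 1 / (1 + real j)) \<longlonglongrightarrow> 1"
        using tendsto_diff[OF tendsto_const, of "\<lambda>j. 1 / (1 + real j)" 0 sequentially 1] by simp
      have "eventually (\<lambda>j. \<forall>i. w $ i < 1 - 1 / (1 + real j)) sequentially"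
        using w by (intro eventually_all_finite order_tendstoD(1)[OF lim]) auto
      then have "eventually (\<lambda>j. indicat_real (K j) w *\<^sub>R D w = indicat_real C w *\<^sub>R D w) sequentially"
        by eventually_elim (use w in \<open>auto simp: K_def mem_box_cart indicator_def less_imp_le\<close>)
      then show "(\<lambda>j. indicat_real (K j) w *\<^sub>R D w) \<longlonglongrightarrow> indicat_real C w *\<^sub>R D w"
        by (rule tendsto_eventually)
    qed
  qed
  then show ?thesis unfolding z by (simp add: LIMSEQ_const_iff)
qed

text \<open>Dynkin's argument: the closed sets are stable under intersection and generate the Borel
  sets, complements use that D itself has integral 0, and disjoint unions pass to the limit by
  dominated convergence.\<close>

lemma null_coefficients_borel:
  assumes "A \<in> sets borel"
  shows "(LINT w|torus. indicat_real A w *\<^sub>R D w) = 0"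
proof -
  have A: "A \<in> sigma_sets UNIV (Collect closed)"
    using assms by (simp add: borel_eq_closed)
  have borel: "A \<in> sets borel" if "A \<in> sigma_sets UNIV (Collect closed)" for A :: "(real ^ 'n) set"
    using that by (simp add: borel_eq_closed)
  have "Int_stable (Collect closed :: (real ^ 'n) set set)" "(Collect closed :: (real ^ 'n) set set) \<subseteq> Pow UNIV"
    by (auto simp: Int_stable_def)
  from this A show ?thesis
  proof (induction rule: sigma_sets_induct_disjoint)
    case (compl A)
    have "(LINT w|torus. indicat_real (UNIV - A) w *\<^sub>R D w)
        = (LINT w|torus. indicat_real UNIV w *\<^sub>R D w - indicat_real A w *\<^sub>R D w)"
      by (intro Bochner_Integration.integral_cong) (auto simp: indicator_def)
    also have "\<dots> = 0"
      using compl null_coefficients_integrable_indicator[OF borel[OF compl(1)]] null_coefficients_closed[of UNIV] D by simp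
    finally show ?case .
  next
    case (union A)
    define U where "U j = (\<Union>i<j. A i)" for j :: nat
    have Am: "A i \<in> sets borel" for i by (rule borel) (use union(2) in blast)
    have Um: "U j \<in> sets borel" for j unfolding U_def by (rule sets.finite_UN) (simp_all add: Am)
    have z: "(LINT w|torus. indicat_real (U j) w *\<^sub>R D w) = 0" for j
    proof -
      have "disjoint_family_on A {..<j}"
        using union(1) by (rule disjoint_family_on_mono[rotated]) simp
      then have "indicat_real (U j) w *\<^sub>R D w = (\<Sum>i<j. indicat_real (A i) w *\<^sub>R D w)" for w
        unfolding U_def by (subst indicator_UN_disjoint) (simp_all add: scaleR_sum_left)
      then have "(LINT w|torus. indicat_real (U j) w *\<^sub>R D w)
          = (\<Sum>i<j. LINT w|torus. indicat_real (A i) w *\<^sub>R D w)"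
        by (simp only: Bochner_Integration.integral_sum[OF null_coefficients_integrable_indicator[OF Am]])
      also have "\<dots> = 0"
        by (rule sum.neutral) (use union(3) in blast)
      finally show ?thesis .
    qed
    have "(\<lambda>j. LINT w|torus. indicat_real (U j) w *\<^sub>R D w) \<longlonglongrightarrow> (LINT w|torus. indicat_real (\<Union>i. A i) w *\<^sub>R D w)"
    proof (rule integral_dominated_convergence[where w = "\<lambda>w. cmod (D w)"])
      show "(\<lambda>w. indicat_real (\<Union>i. A i) w *\<^sub>R D w) \<in> borel_measurable torus"
        using null_coefficients_integrable_indicator[of "\<Union>i. A i"] Am by auto
      show "(\<lambda>w. indicat_real (U j) w *\<^sub>R D w) \<in> borel_measurable torus" for j
        using null_coefficients_integrable_indicator[OF Um] by auto
      show "integrable torus (\<lambda>w. cmod (D w))" using D by simp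
      show "AE w in torus. norm (indicat_real (U j) w *\<^sub>R D w) \<le> cmod (D w)" for j
        by (auto simp: indicator_def)
      show "AE w in torus. (\<lambda>j. indicat_real (U j) w *\<^sub>R D w) \<longlonglongrightarrow> indicat_real (\<Union>i. A i) w *\<^sub>R D w"
        unfolding U_def by (intro AE_I2 tendsto_intros LIMSEQ_indicator_UN)
    qed
    then show ?case unfolding z by (simp add: LIMSEQ_const_iff)
  qed (use null_coefficients_closed in auto)
qed

lemma null_coefficients_AE_zero: "AE w in torus. D w = 0"
proof (rule torus.density_zero[OF D])
  fix A :: "(real ^ 'n) set" assume "A \<in> sets torus"
  then have "A \<in> sets borel" unfolding sets_torus by (subst (asm) sets_restrict_space_iff) auto
  then show "set_lebesgue_integral torus A D = 0"
    unfolding set_lebesgue_integral_def by (rule null_coefficients_borel)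
qed

end

lemma fourier_coefficients_unique:
  fixes D :: "real ^ 'n \<Rightarrow> complex"
  assumes "integrable torus D" "\<And>k. (LINT w|torus. D w * unit_char (w \<bullet> rvec k)) = 0"
  shows "AE w in torus. D w = 0"
  by (rule null_coefficients_AE_zero[OF assms])

text \<open>With summable coefficients the Fourier series converges absolutely and is bounded by
  their sum; by uniqueness it agrees with \<phi> almost everywhere.\<close>

lemma fourier_coefficients_bound:
  fixes \<phi> :: "real ^ 'n \<Rightarrow> complex" and H :: real
  assumes phi: "integrable torus \<phi>"
    and H: "(\<integral>\<^sup>+ l. cmod (LINT w|torus. \<phi> w * unit_char (- (w \<bullet> rvec l))) \<partial>lattice) \<le> ennreal H" "0 \<le> H"
  shows "AE w in torus. cmod (\<phi> w) \<le> H"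
proof -
  \<comment> \<open>The sign is opposite to that in the hypothesis, so that
    \<open>fourier_series c\<close>, with its minus sign, has the coefficients of \<phi>. Reflection
    of the lattice carries the summability over.\<close>
  define c where "c l = (LINT w|torus. \<phi> w * unit_char (w \<bullet> rvec l))" for l
  have "(\<integral>\<^sup>+ l. cmod (c l) \<partial>lattice) = (\<integral>\<^sup>+ l. cmod (c (- l)) \<partial>lattice)"
    using nn_integral_bij_count_space[of uminus UNIV UNIV "\<lambda>l. ennreal (cmod (c l))"] by (simp add: bij_uminus)
  also have "\<dots> \<le> ennreal H" using H by (simp add: c_def rvec_minus)
  finally have le: "(\<integral>\<^sup>+ l. cmod (c l) \<partial>lattice) \<le> ennreal H" .
  then have c: "integrable lattice c"
    by (simp add: integrable_lattice_iff le_less_trans[OF _ ennreal_less_top])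
  have "ennreal (LINT l|lattice. cmod (c l)) \<le> ennreal H"
    using le c by (subst nn_integral_eq_integral[symmetric]) auto
  then have cH: "(LINT l|lattice. cmod (c l)) \<le> H" using H by simp
  have fi: "integrable torus (fourier_series c)"
    by (rule integrable_torus_bounded[OF _ fourier_series_bound[OF c]]) simp
  have "AE w in torus. \<phi> w - fourier_series c w = 0"
  proof (rule fourier_coefficients_unique)
    show "integrable torus (\<lambda>w. \<phi> w - fourier_series c w)" using phi fi by simp
    fix k :: "int ^ 'n"
    have 1: "integrable torus (\<lambda>w. \<phi> w * unit_char (w \<bullet> rvec k))"
      by (rule Bochner_Integration.integrable_bound[OF phi]) (use phi in \<open>auto simp: norm_mult\<close>)
    have 2: "integrable torus (\<lambda>w. fourier_series c w * unit_char (w \<bullet> rvec k))"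
      by (rule Bochner_Integration.integrable_bound[OF fi]) (auto simp: norm_mult)
    show "(LINT w|torus. (\<phi> w - fourier_series c w) * unit_char (w \<bullet> rvec k)) = 0"
      using 1 2 by (simp add: left_diff_distrib fourier_series_coefficient[OF c]) (simp add: c_def)
  qed
  then show ?thesis
    by eventually_elim (use fourier_series_bound[OF c] cH in \<open>auto intro: order_trans\<close>)
qed

section \<open>Rapidly decreasing functions\<close>

abbreviation weight :: "int ^ 'n \<Rightarrow> real" where
  "weight k \<equiv> 1 + norm (rvec k)"

lemma weight_ge_1: "1 \<le> weight k"
  by simp

lemma weight_pos: "0 < weight k"
  using weight_ge_1[of k] by linarith

text \<open>The right-hand side is exact for N = 0 and grows by 4 / ((N + 1) (N + 2)), which exceeds
  the two new terms 2 / (1 + (N + 1)^2).\<close>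

lemma sum_inverse_squares_bound:
  "(\<Sum>j\<in>{- int N..int N}. 1 / (1 + (real_of_int j)\<^sup>2)) \<le> 5 - 4 / (1 + real N)"
proof (induction N)
  case (Suc N)
  have eq: "{- int (Suc N)..int (Suc N)} = insert (- int (Suc N)) (insert (int (Suc N)) {- int N..int N})"
    by auto
  have "(\<Sum>j\<in>{- int (Suc N)..int (Suc N)}. 1 / (1 + (real_of_int j)\<^sup>2))
     = 2 / (1 + (1 + real N)\<^sup>2) + (\<Sum>j\<in>{- int N..int N}. 1 / (1 + (real_of_int j)\<^sup>2))"
    unfolding eq by (simp add: power2_minus[of "1 + real N"] power2_eq_square algebra_simps)
  also have "2 / (1 + (1 + real N)\<^sup>2) \<le> 4 / (1 + real N) - 4 / (2 + real N)"
    by (simp add: divide_simps power2_eq_square) (simp add: algebra_simps)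
  finally show ?case using Suc by (simp add: algebra_simps)
qed simp

lemma finite_weight_le: "finite {k :: int ^ 'n. weight k \<le> R}"
proof (rule finite_subset)
  show "finite (vec_lambda ` (PiE UNIV (\<lambda>_. {- \<lceil>R\<rceil>..\<lceil>R\<rceil>})) :: (int ^ 'n) set)"
    by (intro finite_imageI finite_PiE) auto
  show "{k :: int ^ 'n. weight k \<le> R} \<subseteq> vec_lambda ` (PiE UNIV (\<lambda>_. {- \<lceil>R\<rceil>..\<lceil>R\<rceil>}))"
  proof
    fix k :: "int ^ 'n" assume "k \<in> {k. weight k \<le> R}"
    then have "\<bar>real_of_int (k $ i)\<bar> \<le> R" for i
      using component_le_norm_cart[of "rvec k" i] by (simp add: rvec_nth)
    then have "\<bar>real_of_int (k $ i)\<bar> \<le> of_int \<lceil>R\<rceil>" for i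
      using le_of_int_ceiling order_trans by blast
    then have "k $ i \<in> {- \<lceil>R\<rceil>..\<lceil>R\<rceil>}" for i
      by (metis abs_le_iff atLeastAtMost_iff minus_le_iff of_int_abs of_int_le_iff)
    then have "vec_nth k \<in> PiE UNIV (\<lambda>_. {- \<lceil>R\<rceil>..\<lceil>R\<rceil>})" by auto
    moreover have "k = vec_lambda (vec_nth k)" by simp
    ultimately show "k \<in> vec_lambda ` (PiE UNIV (\<lambda>_. {- \<lceil>R\<rceil>..\<lceil>R\<rceil>}))" by blast
  qed
qed

text \<open>Every coordinate satisfies 1 + k_i^2 \<le> (weight k)^2, and there are n coordinates.
  The product form makes sums over boxes factorize.\<close>

lemma inverse_weight_bound:
  fixes k :: "int ^ 'n"
  shows "1 / weight k ^ (2 * CARD('n)) \<le> (\<Prod>i\<in>UNIV. 1 / (1 + (real_of_int (k $ i))\<^sup>2))"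
proof -
  have "1 + (real_of_int (k $ i))\<^sup>2 \<le> (weight k)\<^sup>2" for i
  proof -
    have "\<bar>real_of_int (k $ i)\<bar> \<le> norm (rvec k)"
      using component_le_norm_cart[of "rvec k" i] by (simp add: rvec_nth)
    then have "(real_of_int (k $ i))\<^sup>2 \<le> (norm (rvec k))\<^sup>2"
      by (metis abs_norm_cancel abs_le_square_iff)
    moreover have "(weight k)\<^sup>2 = 1 + (norm (rvec k))\<^sup>2 + 2 * norm (rvec k)"
      by (simp add: power2_sum)
    moreover have "0 \<le> norm (rvec k)" by simp
    ultimately show ?thesis by linarith
  qed
  then have "(\<Prod>i\<in>(UNIV :: 'n set). 1 + (real_of_int (k $ i))\<^sup>2) \<le> (\<Prod>i\<in>(UNIV :: 'n set). (weight k)\<^sup>2)"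
    by (intro prod_mono) auto
  also have "\<dots> = weight k ^ (2 * CARD('n))" by (simp add: power_mult)
  finally have le: "(\<Prod>i\<in>(UNIV :: 'n set). 1 + (real_of_int (k $ i))\<^sup>2) \<le> weight k ^ (2 * CARD('n))" .
  have "0 < (\<Prod>i\<in>(UNIV :: 'n set). 1 + (real_of_int (k $ i))\<^sup>2)"
    by (intro prod_pos) (auto intro: add_pos_nonneg)
  then show ?thesis using le by (simp add: prod_dividef frac_le)
qed

text \<open>A finite set of lattice points lies in a box. There the sum of products is a product of
  one-dimensional sums, each at most 5.\<close>

lemma integrable_inverse_weight:
  "integrable lattice (\<lambda>k :: int ^ 'n. 1 / weight k ^ (2 * CARD('n)))"
proof -
  define u where "u j = 1 / (1 + (real_of_int j)\<^sup>2)" for j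
  have u: "0 \<le> u j" for j by (simp add: u_def)
  have "(\<lambda>k :: int ^ 'n. 1 / weight k ^ (2 * CARD('n))) summable_on UNIV"
  proof (rule nonneg_bdd_above_summable_on)
    show "bdd_above (sum (\<lambda>k :: int ^ 'n. 1 / weight k ^ (2 * CARD('n))) ` {F. F \<subseteq> UNIV \<and> finite F})"
    proof (rule bdd_aboveI2)
      fix F :: "(int ^ 'n) set" assume "F \<in> {F. F \<subseteq> UNIV \<and> finite F}"
      then have F: "finite F" by simp
      define N where "N = Max (insert 0 ((\<lambda>(k, i). nat \<bar>k $ i\<bar>) ` (F \<times> UNIV)))"
      have N: "\<bar>k $ i\<bar> \<le> int N" if "k \<in> F" for k i
      proof -
        have "nat \<bar>k $ i\<bar> \<le> N" unfolding N_def
          using F that by (intro Max_ge) (auto intro!: image_eqI[of _ _ "(k, i)"])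
        then show ?thesis by simp
      qed
      define S where "S = {- int N..int N}"
      have finB: "finite {k :: int ^ 'n. \<forall>i. k $ i \<in> S}"
      proof (rule finite_subset)
        show "finite (vec_lambda ` (PiE UNIV (\<lambda>_. S)) :: (int ^ 'n) set)"
          unfolding S_def by (intro finite_imageI finite_PiE) auto
        show "{k :: int ^ 'n. \<forall>i. k $ i \<in> S} \<subseteq> vec_lambda ` (PiE UNIV (\<lambda>_. S))"
          by (auto intro!: image_eqI[of _ _ "vec_nth k" for k])
      qed
      have "(\<Sum>k\<in>F. 1 / weight k ^ (2 * CARD('n))) \<le> (\<Sum>k\<in>F. \<Prod>i\<in>UNIV. u (k $ i))"
        unfolding u_def by (intro sum_mono inverse_weight_bound)
      also have "\<dots> \<le> (\<Sum>k\<in>{k :: int ^ 'n. \<forall>i. k $ i \<in> S}. \<Prod>i\<in>UNIV. u (k $ i))"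
      proof (rule sum_mono2[OF finB])
        have "k $ i \<in> S" if "k \<in> F" for k i
          using N[OF that, of i] by (auto simp: S_def)
        then show "F \<subseteq> {k :: int ^ 'n. \<forall>i. k $ i \<in> S}" by blast
      qed (simp add: u prod_nonneg)
      also have "\<dots> = (\<Sum>g\<in>PiE UNIV (\<lambda>_ :: 'n. S). \<Prod>i\<in>UNIV. u (g i))"
        by (rule sum.reindex_bij_witness[of _ vec_lambda vec_nth]) auto
      also have "\<dots> = (\<Prod>i\<in>(UNIV :: 'n set). \<Sum>j\<in>S. u j)"
        by (rule prod_sum_PiE[symmetric]) (auto simp: S_def)
      also have "\<dots> \<le> (\<Prod>i\<in>(UNIV :: 'n set). 5)"
      proof (intro prod_mono conjI sum_nonneg u)
        have "5 - 4 / (1 + real N) \<le> 5" by simp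
        then show "(\<Sum>j\<in>S. u j) \<le> 5"
          using sum_inverse_squares_bound[of N] unfolding S_def u_def by linarith
      qed
      finally show "(\<Sum>k\<in>F. 1 / weight k ^ (2 * CARD('n))) \<le> 5 ^ CARD('n)" by simp
    qed
  qed (use weight_pos in auto)
  then have "(\<lambda>k :: int ^ 'n. norm (1 / weight k ^ (2 * CARD('n)))) summable_on UNIV"
    by simp
  then show ?thesis
    unfolding abs_summable_equivalent by (simp add: abs_summable_on_def)
qed

text \<open>Connects the unconditional sum in the definition of \<open>stft_dist\<close> with the
  integral for the counting measure used everywhere else.\<close>

lemma infsum_lattice:
  fixes a :: "int ^ 'n \<Rightarrow> complex"
  assumes "integrable lattice a"
  shows "a summable_on UNIV" and "(\<Sum>\<^sub>\<infinity>k. a k) = (LINT k|lattice. a k)"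
proof -
  have a: "Infinite_Set_Sum.abs_summable_on a UNIV" using assms by (simp add: abs_summable_on_def)
  then show "a summable_on UNIV"
    using abs_summable_equivalent abs_summable_summable by blast
  show "(\<Sum>\<^sub>\<infinity>k. a k) = (LINT k|lattice. a k)"
    using infsetsum_infsum[OF a] by (simp add: infsetsum_def)
qed

lemma schwartzD:
  assumes "g \<in> schwartz"
  shows "\<exists>C\<ge>0. \<forall>k. cmod (g k) \<le> C / weight k ^ M"
proof -
  obtain C where C: "\<And>k. cmod (g k) \<le> C / weight k ^ M"
    using assms unfolding schwartz_def by blast
  have "0 \<le> C / weight (0 :: int ^ 'a) ^ M" by (rule order_trans[OF norm_ge_zero C])
  then have "0 \<le> C" by (simp add: rvec_zero)
  then show ?thesis using C by blast
qed

lemma schwartz_bounded: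
  assumes "g \<in> schwartz"
  obtains B where "0 \<le> B" "\<And>k. cmod (g k) \<le> B"
  using schwartzD[OF assms, of 0] by auto

lemma integrable_schwartz:
  fixes g :: "int ^ 'n \<Rightarrow> complex"
  assumes "g \<in> schwartz"
  shows "integrable lattice g"
proof -
  obtain C where C: "0 \<le> C" "\<And>k. cmod (g k) \<le> C / weight k ^ (2 * CARD('n))"
    using schwartzD[OF assms, of "(2 * CARD('n))"] by blast
  have "integrable lattice (\<lambda>k :: int ^ 'n. C * (1 / weight k ^ (2 * CARD('n))))"
    by (intro integrable_mult_right integrable_inverse_weight)
  then show ?thesis
    by (rule Bochner_Integration.integrable_bound) (use C in simp_all)
qed

section \<open>Multipliers, translates and sums of rapidly decreasing functions\<close>

definition poly_bounded :: "(int ^ 'n \<Rightarrow> complex) \<Rightarrow> bool" where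
  "poly_bounded F \<longleftrightarrow> (\<exists>C N. \<forall>k. cmod (F k) \<le> C * weight k ^ N)"

lemma bounded_imp_poly_bounded: "(\<And>k. cmod (F k) \<le> B) \<Longrightarrow> poly_bounded F"
  unfolding poly_bounded_def by (intro exI[of _ B] exI[of _ 0]) simp

lemma schwartz_mult_poly_bounded:
  assumes F: "poly_bounded F" and g: "g \<in> schwartz"
  shows "(\<lambda>k. F k * g k) \<in> schwartz"
  unfolding schwartz_def
proof (intro CollectI allI)
  fix M :: nat
  obtain C N where C: "\<And>k. cmod (F k) \<le> C * weight k ^ N" using F by (auto simp: poly_bounded_def)
  obtain E where E: "0 \<le> E" "\<And>k. cmod (g k) \<le> E / weight k ^ (N + M)"
    using schwartzD[OF g, of "(N + M)"] by blast
  have "cmod (F k * g k) \<le> (C * E) / weight k ^ M" for k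
  proof -
    have "cmod (F k * g k) \<le> (C * weight k ^ N) * (E / weight k ^ (N + M))"
      unfolding norm_mult using C[of k] E(2)[of k]
      by (intro mult_mono) (auto intro: order_trans[OF norm_ge_zero])
    also have "\<dots> = (C * E) / weight k ^ M"
      using weight_pos[of k] by (simp add: power_add field_simps)
    finally show ?thesis .
  qed
  then show "\<exists>C. \<forall>k. cmod (F k * g k) \<le> C / weight k ^ M" by blast
qed

text \<open>A Peetre-type inequality. It converts decay in k - m into decay in k, at the cost of a
  factor that depends on m only.\<close>

lemma weight_triangle: "weight k \<le> weight (k - m) * weight m"
proof -
  have "norm (rvec k) \<le> norm (rvec (k - m)) + norm (rvec m)"
    using norm_triangle_ineq[of "rvec k - rvec m" "rvec m"] by (simp add: rvec_diff)
  also have "1 + \<dots> \<le> weight (k - m) * weight m"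
    by (simp add: algebra_simps)
  finally show ?thesis by simp
qed

lemma schwartz_translation:
  assumes g: "g \<in> schwartz"
  shows "(\<lambda>k. g (k - m)) \<in> schwartz"
  unfolding schwartz_def
proof (intro CollectI allI)
  fix M :: nat
  obtain E where E: "0 \<le> E" "\<And>k. cmod (g k) \<le> E / weight k ^ M"
    using schwartzD[OF g, of "M"] by blast
  have "cmod (g (k - m)) \<le> (E * weight m ^ M) / weight k ^ M" for k
  proof -
    have "weight k ^ M \<le> (weight (k - m) * weight m) ^ M"
      by (intro power_mono weight_triangle) simp
    then have "E / weight (k - m) ^ M \<le> (E * weight m ^ M) / weight k ^ M"
      using weight_pos[of k] weight_pos[of "k - m"] E(1)
      by (simp add: divide_simps power_mult_distrib mult.assoc mult_left_mono mult.commute)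
    then show ?thesis using E(2)[of "k - m"] by linarith
  qed
  then show "\<exists>C. \<forall>k. cmod (g (k - m)) \<le> C / weight k ^ M" by blast
qed

lemma schwartz_norm_cong:
  "g \<in> schwartz \<Longrightarrow> (\<And>k. cmod (h k) = cmod (g k)) \<Longrightarrow> h \<in> schwartz"
  by (simp add: schwartz_def)

lemma schwartz_add:
  assumes "g \<in> schwartz" "h \<in> schwartz"
  shows "(\<lambda>k. g k + h k) \<in> schwartz"
  unfolding schwartz_def
proof (intro CollectI allI)
  fix M :: nat
  obtain C where C: "0 \<le> C" "\<And>k. cmod (g k) \<le> C / weight k ^ M"
    using schwartzD[OF assms(1), of "M"] by blast
  obtain E where E: "0 \<le> E" "\<And>k. cmod (h k) \<le> E / weight k ^ M"
    using schwartzD[OF assms(2), of "M"] by blast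
  have "cmod (g k + h k) \<le> (C + E) / weight k ^ M" for k
    using norm_triangle_ineq[of "g k" "h k"] C(2)[of k] E(2)[of k] by (simp add: add_divide_distrib)
  then show "\<exists>C. \<forall>k. cmod (g k + h k) \<le> C / weight k ^ M" by blast
qed

lemma schwartz_cmult: "g \<in> schwartz \<Longrightarrow> (\<lambda>k. c * g k) \<in> schwartz"
  by (rule schwartz_mult_poly_bounded[OF bounded_imp_poly_bounded[of _ "cmod c"]]) auto

lemma schwartz_finite_support:
  assumes "finite {k. g k \<noteq> 0}"
  shows "g \<in> schwartz"
  unfolding schwartz_def
proof (intro CollectI allI)
  fix M :: nat
  define C where "C = Max (insert 0 ((\<lambda>k. cmod (g k) * weight k ^ M) ` {k. g k \<noteq> 0}))"
  have "cmod (g k) * weight k ^ M \<le> C" for k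
  proof (cases "g k = 0")
    case True
    then show ?thesis unfolding C_def using assms by (simp add: Max_ge)
  next
    case False
    then show ?thesis unfolding C_def using assms by (intro Max_ge) auto
  qed
  then have "cmod (g k) \<le> C / weight k ^ M" for k
    using weight_pos[of k] by (simp add: pos_le_divide_eq)
  then show "\<exists>C. \<forall>k. cmod (g k) \<le> C / weight k ^ M" by blast
qed

abbreviation unit_vector :: "int ^ 'n \<Rightarrow> int ^ 'n \<Rightarrow> complex" where
  "unit_vector k \<equiv> (\<lambda>j. if j = k then 1 else 0)"

lemma schwartz_unit_vector: "unit_vector k \<in> schwartz"
  by (rule schwartz_finite_support) simp

section \<open>Distributions as sequences of polynomial growth\<close>

lemma distribution_linear:
  assumes "f \<in> distributions" "\<phi> \<in> schwartz" "\<psi> \<in> schwartz"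
  shows "f (\<lambda>k. a * \<phi> k + b * \<psi> k) = a * f \<phi> + b * f \<psi>"
  using assms unfolding distributions_def by blast

lemma schwartz_zero: "(\<lambda>k. 0) \<in> schwartz"
  by (rule schwartz_finite_support) simp

lemma distribution_cmult:
  assumes "f \<in> distributions" "\<phi> \<in> schwartz"
  shows "f (\<lambda>k. a * \<phi> k) = a * f \<phi>"
  using distribution_linear[OF assms(1,2,2), of a 0] by simp

lemma distribution_zero: "f \<in> distributions \<Longrightarrow> f (\<lambda>k. 0) = 0"
  using distribution_cmult[OF _ schwartz_zero, of f 0] by simp

lemma distribution_diff:
  assumes "f \<in> distributions" "\<phi> \<in> schwartz" "\<psi> \<in> schwartz"
  shows "f (\<lambda>k. \<phi> k - \<psi> k) = f \<phi> - f \<psi>"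
  using distribution_linear[OF assms, of 1 "-1"] by simp

text \<open>Continuity at 0, used once with tolerance 1, becomes a bound by scaling. For K = 0 the
  hypothesis forces \<psi> = 0.\<close>

lemma distribution_continuity:
  assumes f: "f \<in> distributions"
  shows "\<exists>N. \<exists>C\<ge>0. \<forall>\<psi>\<in>schwartz. \<forall>K\<ge>0. (\<forall>k. cmod (\<psi> k) \<le> K / weight k ^ N) \<longrightarrow> cmod (f \<psi>) \<le> C * K"
proof -
  have ex: "\<exists>N. \<exists>\<delta>>0. \<forall>\<psi>\<in>schwartz.
      (\<forall>j\<le>N. schwartz_seminorm j (\<lambda>k. \<psi> k - 0) < \<delta>) \<longrightarrow> cmod (f \<psi> - f (\<lambda>k. 0)) < \<epsilon>" if "\<epsilon> > 0" for \<epsilon>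
    by (rule f[unfolded distributions_def, THEN CollectD, THEN conjunct2, THEN conjunct1,
      THEN bspec, OF schwartz_zero, THEN spec, THEN mp, OF that])
  from ex[OF zero_less_one] have "\<exists>N. \<exists>\<delta>>0. \<forall>\<psi>\<in>schwartz. (\<forall>j\<le>N. schwartz_seminorm j \<psi> < \<delta>) \<longrightarrow> cmod (f \<psi>) < 1"
    by (simp only: diff_zero distribution_zero[OF f] zero_less_one)
  then obtain N \<delta> where \<delta>: "\<delta> > 0"
    and bound: "\<And>\<psi>. \<psi> \<in> schwartz \<Longrightarrow> (\<And>j. j \<le> N \<Longrightarrow> schwartz_seminorm j \<psi> < \<delta>) \<Longrightarrow> cmod (f \<psi>) < 1"
    by blast
  have "cmod (f \<psi>) \<le> 2 / \<delta> * K"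
    if \<psi>: "\<psi> \<in> schwartz" and K: "0 \<le> K" and le: "\<And>k. cmod (\<psi> k) \<le> K / weight k ^ N" for \<psi> K
  proof (cases "K = 0")
    case True
    then have "\<psi> = (\<lambda>k. 0)" using le by auto
    then show ?thesis using True distribution_zero[OF f] by simp
  next
    case False
    then have K: "K > 0" using K by simp
    \<comment> \<open>This factor brings all seminorms up to order N down to at most \<delta> / 2,
      strictly below the threshold \<delta>.\<close>
    define c where "c = complex_of_real (\<delta> / (2 * K))"
    have c: "cmod c = \<delta> / (2 * K)" using K \<delta> by (simp add: c_def norm_divide)
    have "cmod (f (\<lambda>k. c * \<psi> k)) < 1"
    proof (rule bound)
      show "(\<lambda>k. c * \<psi> k) \<in> schwartz" by (rule schwartz_cmult[OF \<psi>])
      fix j assume "j \<le> N"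
      have "weight k ^ j * cmod (c * \<psi> k) \<le> \<delta> / 2" for k
      proof -
        have "weight k ^ j * cmod (c * \<psi> k) \<le> weight k ^ N * (\<delta> / (2 * K) * (K / weight k ^ N))"
          unfolding norm_mult c using K \<delta> le[of k] \<open>j \<le> N\<close>
          by (intro mult_mono mult_left_mono power_increasing) auto
        also have "\<dots> = \<delta> / 2" using K weight_pos[of k] by (simp add: field_simps)
        finally show ?thesis .
      qed
      then have "schwartz_seminorm j (\<lambda>k. c * \<psi> k) \<le> \<delta> / 2"
        unfolding schwartz_seminorm_def by (intro cSUP_least) auto
      then show "schwartz_seminorm j (\<lambda>k. c * \<psi> k) < \<delta>" using \<delta> by simp
    qed
    then have "\<delta> / (2 * K) * cmod (f \<psi>) < 1"
      by (simp add: distribution_cmult[OF f \<psi>] norm_mult c)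
    then show ?thesis using K \<delta> by (simp add: field_simps)
  qed
  then show ?thesis using \<delta> by (intro exI[of _ N] exI[of _ "2 / \<delta>"]) auto
qed

lemma value_at_poly_bounded:
  assumes f: "f \<in> distributions"
  shows "poly_bounded (value_at f)"
proof -
  obtain N C where C: "0 \<le> C" and bound: "\<And>\<psi> K. \<psi> \<in> schwartz \<Longrightarrow> 0 \<le> K \<Longrightarrow>
      (\<And>k. cmod (\<psi> k) \<le> K / weight k ^ N) \<Longrightarrow> cmod (f \<psi>) \<le> C * K"
    using distribution_continuity[OF f] by blast
  have "cmod (value_at f k) \<le> C * weight k ^ N" for k
    unfolding value_at_def
  proof (rule bound[OF schwartz_unit_vector])
    show "0 \<le> weight k ^ N" by simp
    show "cmod (unit_vector k j) \<le> weight k ^ N / weight j ^ N" for j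
      using weight_pos[of j] weight_pos[of k] by (cases "j = k") (simp_all add: less_imp_le)
  qed
  then show ?thesis unfolding poly_bounded_def by blast
qed

lemma distribution_finite_sum:
  assumes f: "f \<in> distributions" and A: "finite A"
  shows "f (\<lambda>j. if j \<in> A then \<phi> j else 0) = (\<Sum>k\<in>A. value_at f k * \<phi> k)"
  using A
proof (induction rule: finite_induct)
  case empty
  then show ?case by (simp add: distribution_zero[OF f])
next
  case (insert k A)
  have s: "(\<lambda>j. if j \<in> A then \<phi> j else 0) \<in> schwartz"
    by (rule schwartz_finite_support[OF finite_subset[OF _ insert(1)]]) auto
  have "(\<lambda>j. if j \<in> insert k A then \<phi> j else 0)
      = (\<lambda>j. \<phi> k * unit_vector k j + 1 * (if j \<in> A then \<phi> j else 0))"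
    using insert(2) by (auto simp: fun_eq_iff)
  then have "f (\<lambda>j. if j \<in> insert k A then \<phi> j else 0)
      = \<phi> k * f (unit_vector k) + 1 * f (\<lambda>j. if j \<in> A then \<phi> j else 0)"
    using distribution_linear[OF f schwartz_unit_vector[of k] s, of "\<phi> k" 1] by simp
  then show ?case using insert by (simp add: value_at_def mult.commute)
qed

lemma integral_lattice_finite:
  fixes h :: "int ^ 'n \<Rightarrow> complex"
  assumes "finite A"
  shows "(LINT k|lattice. (if k \<in> A then h k else 0)) = (\<Sum>k\<in>A. h k)"
proof -
  have "(LINT k|lattice. (if k \<in> A then h k else 0)) = (\<Sum>k | k \<in> UNIV \<and> (if k \<in> A then h k else 0) \<noteq> 0. (if k \<in> A then h k else 0))"
    by (rule lebesgue_integral_count_space_finite_support, rule finite_subset[OF _ assms]) auto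
  also have "\<dots> = (\<Sum>k\<in>A. h k)"
    using assms by (intro sum.mono_neutral_cong_left) auto
  finally show ?thesis .
qed

text \<open>For truncations of \<phi> to the finite sets \<open>A r\<close> the formula is
  linearity. The truncated sums converge to the integral by dominated convergence, and to f \<phi>
  by continuity of f.\<close>

lemma distribution_eq_integral:
  fixes f :: "(int ^ 'n \<Rightarrow> complex) \<Rightarrow> complex"
  assumes f: "f \<in> distributions" and \<phi>: "\<phi> \<in> schwartz"
  shows "integrable lattice (\<lambda>k. value_at f k * \<phi> k)"
    and "f \<phi> = (LINT k|lattice. value_at f k * \<phi> k)"
proof -
  show int: "integrable lattice (\<lambda>k. value_at f k * \<phi> k)"
    by (rule integrable_schwartz[OF schwartz_mult_poly_bounded[OF value_at_poly_bounded[OF f] \<phi>]])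
  obtain N C where C: "0 \<le> C" and bound: "\<And>\<psi> K. \<psi> \<in> schwartz \<Longrightarrow> 0 \<le> K \<Longrightarrow>
      (\<And>k. cmod (\<psi> k) \<le> K / weight k ^ N) \<Longrightarrow> cmod (f \<psi>) \<le> C * K"
    using distribution_continuity[OF f] by blast
  \<comment> \<open>One power of the weight more than the continuity bound requires: outside
    \<open>A r\<close> it supplies the factor 1 / r.\<close>
  obtain E where E: "0 \<le> E" "\<And>k. cmod (\<phi> k) \<le> E / weight k ^ Suc N"
    using schwartzD[OF \<phi>, of "Suc N"] by blast
  define A where "A r = {k :: int ^ 'n. weight k \<le> real r}" for r :: nat
  have A: "finite (A r)" for r unfolding A_def by (rule finite_weight_le)
  have "(\<lambda>r. LINT k|lattice. (if k \<in> A r then value_at f k * \<phi> k else 0))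
      \<longlonglongrightarrow> (LINT k|lattice. value_at f k * \<phi> k)"
  proof (rule integral_dominated_convergence[where w = "\<lambda>k. cmod (value_at f k * \<phi> k)"])
    show "AE k in lattice. (\<lambda>r. if k \<in> A r then value_at f k * \<phi> k else 0) \<longlonglongrightarrow> value_at f k * \<phi> k"
    proof (rule AE_I2)
      fix k :: "int ^ 'n"
      obtain r0 where "weight k \<le> real r0" using real_arch_simple by blast
      then have "eventually (\<lambda>r. (if k \<in> A r then value_at f k * \<phi> k else 0) = value_at f k * \<phi> k) sequentially"
        by (intro eventually_sequentiallyI[of r0]) (auto simp: A_def)
      then show "(\<lambda>r. if k \<in> A r then value_at f k * \<phi> k else 0) \<longlonglongrightarrow> value_at f k * \<phi> k"
        by (rule tendsto_eventually)
    qed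
  qed (use int integrable_norm[OF int] in auto)
  then have lim1: "(\<lambda>r. f (\<lambda>j. if j \<in> A r then \<phi> j else 0)) \<longlonglongrightarrow> (LINT k|lattice. value_at f k * \<phi> k)"
    by (simp add: integral_lattice_finite[OF A] distribution_finite_sum[OF f A])
  have le: "cmod (f \<phi> - f (\<lambda>j. if j \<in> A r then \<phi> j else 0)) \<le> C * (E / real r)" if "r > 0" for r
  proof -
    have s: "(\<lambda>j. if j \<in> A r then \<phi> j else 0) \<in> schwartz"
      by (rule schwartz_finite_support[OF finite_subset[OF _ A[of r]]]) auto
    have eq: "(\<lambda>j. \<phi> j - (if j \<in> A r then \<phi> j else 0)) = (\<lambda>j. if j \<in> A r then 0 else \<phi> j)"
      by auto
    have s': "(\<lambda>j. \<phi> j - (if j \<in> A r then \<phi> j else 0)) \<in> schwartz"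
      using schwartz_add[OF \<phi> schwartz_cmult[OF s, of "-1"]] by simp
    have "cmod (f (\<lambda>j. \<phi> j - (if j \<in> A r then \<phi> j else 0))) \<le> C * (E / real r)"
    proof (rule bound[OF s'])
      show "0 \<le> E / real r" using E by simp
      fix k
      show "cmod (\<phi> k - (if k \<in> A r then \<phi> k else 0)) \<le> E / real r / weight k ^ N"
      proof (cases "k \<in> A r")
        case False
        then have "real r \<le> weight k" by (simp add: A_def)
        then have "E / (weight k * weight k ^ N) \<le> E / (real r * weight k ^ N)"
          using that E weight_pos[of k] by (intro divide_left_mono mult_right_mono) auto
        then show ?thesis using False E(2)[of k] by simp
      qed (use E weight_pos[of k] in auto)
    qed
    then show ?thesis by (simp add: distribution_diff[OF f \<phi> s])
  qed
  have lim0: "(\<lambda>r. C * (E / real r)) \<longlonglongrightarrow> 0"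
    by (rule tendsto_mult_right_zero[OF lim_const_over_n])
  have "(\<lambda>r. f \<phi> - f (\<lambda>j. if j \<in> A r then \<phi> j else 0)) \<longlonglongrightarrow> 0"
  proof (rule Lim_null_comparison[OF _ lim0])
    show "\<forall>\<^sub>F r in sequentially. cmod (f \<phi> - f (\<lambda>j. if j \<in> A r then \<phi> j else 0)) \<le> C * (E / real r)"
      by (rule eventually_sequentiallyI[of 1]) (rule le, simp)
  qed
  from tendsto_diff[OF tendsto_const[of "f \<phi>"] this]
  have "(\<lambda>r. f (\<lambda>j. if j \<in> A r then \<phi> j else 0)) \<longlonglongrightarrow> f \<phi>" by simp
  then show "f \<phi> = (LINT k|lattice. value_at f k * \<phi> k)"
    by (rule LIMSEQ_unique[OF _ lim1])
qed

lemma distribution_eqI: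
  assumes f: "f \<in> distributions" and g: "g \<in> distributions" and eq: "\<And>k. value_at f k = value_at g k"
  shows "f = g"
proof
  fix \<phi>
  show "f \<phi> = g \<phi>"
  proof (cases "\<phi> \<in> schwartz")
    case True
    then show ?thesis by (simp add: distribution_eq_integral(2)[OF f] distribution_eq_integral(2)[OF g] eq)
  next
    case False
    then show ?thesis using f g by (simp add: distributions_def)
  qed
qed

text \<open>Inverse to \<open>value_at\<close>. The value 0 off \<open>schwartz\<close> follows the
  extension convention in \<open>distributions\<close>.\<close>

definition distribution_of :: "(int ^ 'n \<Rightarrow> complex) \<Rightarrow> (int ^ 'n \<Rightarrow> complex) \<Rightarrow> complex" where
  "distribution_of F \<phi> = (if \<phi> \<in> schwartz then LINT k|lattice. F k * \<phi> k else 0)"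

lemma value_at_distribution_of: "value_at (distribution_of F) k = F k"
proof -
  have "value_at (distribution_of F) k = (LINT j|lattice. F j * indicator {k} j)"
    unfolding value_at_def distribution_of_def
    by (auto simp: schwartz_unit_vector indicator_def intro!: Bochner_Integration.integral_cong)
  then show ?thesis by (simp add: integral_lattice_single)
qed

lemma schwartz_le_seminorm:
  assumes "\<psi> \<in> schwartz"
  shows "weight k ^ j * cmod (\<psi> k) \<le> schwartz_seminorm j \<psi>"
  unfolding schwartz_seminorm_def
proof (rule cSUP_upper)
  obtain C where C: "0 \<le> C" "\<And>k. cmod (\<psi> k) \<le> C / weight k ^ j"
    using schwartzD[OF assms, of j] by blast
  have "weight k ^ j * cmod (\<psi> k) \<le> C" for k
    using C(2)[of k] weight_pos[of k] by (simp add: pos_le_divide_eq mult.commute)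
  then show "bdd_above (range (\<lambda>k. weight k ^ j * cmod (\<psi> k)))" by (intro bdd_aboveI2)
qed simp

text \<open>A single seminorm suffices: the one of order 2 n, whose inverse weight is summable,
  controls the pairing with a bounded sequence.\<close>

lemma distribution_of_bounded:
  fixes F :: "int ^ 'n \<Rightarrow> complex"
  assumes F: "\<And>k. cmod (F k) \<le> B"
  shows "distribution_of F \<in> distributions"
proof -
  have pb: "poly_bounded F" by (rule bounded_imp_poly_bounded[OF F])
  have B: "0 \<le> B" using F[of 0] norm_ge_zero order_trans by blast
  have int: "integrable lattice (\<lambda>k. F k * \<phi> k)" if "\<phi> \<in> schwartz" for \<phi>
    by (rule integrable_schwartz[OF schwartz_mult_poly_bounded[OF pb that]])
  have lin: "distribution_of F (\<lambda>k. a * \<phi> k + b * \<psi> k) = a * distribution_of F \<phi> + b * distribution_of F \<psi>"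
    if p: "\<phi> \<in> schwartz" "\<psi> \<in> schwartz" for \<phi> \<psi> :: "int ^ 'n \<Rightarrow> complex" and a b
  proof -
    have s: "(\<lambda>k. a * \<phi> k + b * \<psi> k) \<in> schwartz" by (intro schwartz_add schwartz_cmult p)
    have "(LINT k|lattice. F k * (a * \<phi> k + b * \<psi> k)) = (LINT k|lattice. a * (F k * \<phi> k) + b * (F k * \<psi> k))"
      by (simp add: algebra_simps)
    also have "\<dots> = a * (LINT k|lattice. F k * \<phi> k) + b * (LINT k|lattice. F k * \<psi> k)"
      using int[OF p(1)] int[OF p(2)] by simp
    finally show ?thesis using s p by (simp add: distribution_of_def)
  qed
  define M where "M = 2 * CARD('n)"
  define S where "S = (LINT k|(lattice :: (int ^ 'n) measure). 1 / weight k ^ M)"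
  have S: "0 \<le> S" unfolding S_def by (rule integral_nonneg_AE) (use weight_pos in auto)
  have bound: "cmod (distribution_of F \<psi>) \<le> B * schwartz_seminorm M \<psi> * S" if p: "\<psi> \<in> schwartz" for \<psi>
  proof -
    have "cmod (distribution_of F \<psi>) \<le> (LINT k|lattice. cmod (F k * \<psi> k))"
      using p by (simp add: distribution_of_def integral_norm_bound)
    also have "\<dots> \<le> (LINT k|(lattice :: (int ^ 'n) measure). (B * schwartz_seminorm M \<psi>) * (1 / weight k ^ M))"
    proof (rule integral_mono)
      show "integrable lattice (\<lambda>k. cmod (F k * \<psi> k))" using int[OF p] by (rule integrable_norm)
      show "integrable lattice (\<lambda>k :: int ^ 'n. (B * schwartz_seminorm M \<psi>) * (1 / weight k ^ M))"
        unfolding M_def by (intro integrable_mult_right integrable_inverse_weight)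
      fix k
      have *: "cmod (\<psi> k) \<le> schwartz_seminorm M \<psi> / weight k ^ M"
        using schwartz_le_seminorm[OF p, of k M] weight_pos[of k]
        by (simp add: pos_le_divide_eq mult.commute)
      show "cmod (F k * \<psi> k) \<le> (B * schwartz_seminorm M \<psi>) * (1 / weight k ^ M)"
        using mult_mono[OF F[of k] * B norm_ge_zero] by (simp add: norm_mult)
    qed
    also have "\<dots> = B * schwartz_seminorm M \<psi> * S"
      unfolding S_def by (rule integral_mult_right_zero)
    finally show ?thesis .
  qed
  have cont: "\<exists>N. \<exists>\<delta>>0. \<forall>\<psi>\<in>schwartz. (\<forall>j\<le>N. schwartz_seminorm j (\<lambda>k. \<psi> k - \<phi> k) < \<delta>)
      \<longrightarrow> cmod (distribution_of F \<psi> - distribution_of F \<phi>) < \<epsilon>"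
    if p: "\<phi> \<in> schwartz" and \<epsilon>: "\<epsilon> > 0" for \<phi> :: "int ^ 'n \<Rightarrow> complex" and \<epsilon>
  proof (intro exI[of _ M] exI[of _ "\<epsilon> / (B * S + 1)"] conjI ballI impI)
    have BS: "0 \<le> B * S" using B S by simp
    then show "0 < \<epsilon> / (B * S + 1)" using \<epsilon> by simp
    fix \<psi> :: "int ^ 'n \<Rightarrow> complex"
    assume q: "\<psi> \<in> schwartz" and "\<forall>j\<le>M. schwartz_seminorm j (\<lambda>k. \<psi> k - \<phi> k) < \<epsilon> / (B * S + 1)"
    then have lt: "schwartz_seminorm M (\<lambda>k. \<psi> k - \<phi> k) < \<epsilon> / (B * S + 1)" by simp
    have s: "(\<lambda>k. \<psi> k - \<phi> k) \<in> schwartz"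
      using schwartz_add[OF q schwartz_cmult[OF p, of "-1"]] by simp
    have "0 \<le> schwartz_seminorm M (\<lambda>k. \<psi> k - \<phi> k)"
      by (rule order_trans[OF _ schwartz_le_seminorm[OF s, of 0]]) simp
    have "distribution_of F \<psi> - distribution_of F \<phi> = distribution_of F (\<lambda>k. \<psi> k - \<phi> k)"
      using lin[OF q p, of 1 "-1"] by simp
    then have "cmod (distribution_of F \<psi> - distribution_of F \<phi>) \<le> (B * S) * schwartz_seminorm M (\<lambda>k. \<psi> k - \<phi> k)"
      using bound[OF s] by (simp add: mult_ac)
    also have "\<dots> \<le> (B * S) * (\<epsilon> / (B * S + 1))"
      using lt BS by (intro mult_left_mono) auto
    also have "\<dots> < \<epsilon>" using \<epsilon> BS by (simp add: field_simps add_pos_nonneg)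
    finally show "cmod (distribution_of F \<psi> - distribution_of F \<phi>) < \<epsilon>" .
  qed
  show ?thesis unfolding distributions_def
  proof (intro CollectI conjI ballI allI impI)
    show "distribution_of F \<phi> = 0" if "\<phi> \<notin> schwartz" for \<phi>
      using that by (simp add: distribution_of_def)
  qed (fact lin cont)+
qed

section \<open>Short-time Fourier transforms as Fourier series\<close>

lemma stft_window_schwartz:
  assumes "g \<in> schwartz"
  shows "(\<lambda>k. cnj (modulation w (translation m g) k)) \<in> schwartz"
  by (rule schwartz_norm_cong[OF schwartz_translation[OF assms, of m]])
    (simp add: modulation_def translation_def norm_mult)

lemma integrable_translated_window:
  assumes "poly_bounded F" "g \<in> schwartz"
  shows "integrable lattice (\<lambda>k. F k * cnj (g (k - m)))"
proof -
  have "(\<lambda>k. cnj (g (k - m))) \<in> schwartz"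
    by (rule schwartz_norm_cong[OF schwartz_translation[OF assms(2), of m]]) simp
  then show ?thesis by (intro integrable_schwartz schwartz_mult_poly_bounded assms)
qed

lemma stft_eq_fourier_series:
  assumes f: "f \<in> distributions" and g: "g \<in> schwartz"
  shows "stft g f m w = fourier_series (\<lambda>k. value_at f k * cnj (g (k - m))) w"
  unfolding stft_def distribution_eq_integral(2)[OF f stft_window_schwartz[OF g]] fourier_series_def
  by (simp add: modulation_def translation_def cnj_unit_char mult_ac)

lemma stft_measurable:
  assumes "f \<in> distributions" "g \<in> schwartz"
  shows "(\<lambda>(m, w). stft g f m w) \<in> borel_measurable ZT"
proof -
  have "(\<lambda>z. stft g f (fst z) (snd z)) \<in> borel_measurable (lattice \<Otimes>\<^sub>M torus)"
    by (rule borel_measurable_lattice_pair) (simp add: stft_eq_fourier_series[OF assms])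
  then show ?thesis by (simp add: ZT_def case_prod_beta')
qed

lemma stft_dist_eq_fourier_series:
  fixes g f :: "(int ^ 'n \<Rightarrow> complex) \<Rightarrow> complex"
  assumes "integrable lattice (\<lambda>k. value_at f k * cnj (value_at g (k - m)))"
  shows "stft_term g f m w summable_on UNIV"
    and "stft_dist g f m w = fourier_series (\<lambda>k. value_at f k * cnj (value_at g (k - m))) w"
proof -
  have int: "integrable lattice (stft_term g f m w)"
    unfolding stft_term_def[abs_def] by (rule integrable_fourier_term[OF assms])
  show "stft_term g f m w summable_on UNIV" by (rule infsum_lattice(1)[OF int])
  show "stft_dist g f m w = fourier_series (\<lambda>k. value_at f k * cnj (value_at g (k - m))) w"
    unfolding stft_dist_def infsum_lattice(2)[OF int] fourier_series_def by (simp add: stft_term_def[abs_def])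
qed

section \<open>Orlicz modulars\<close>

text \<open>The properties shared by \<Phi> and its complementary function on which all modular
  estimates rest. The last clause is convexity along segments issuing from 0.\<close>

definition gauge :: "(ennreal \<Rightarrow> ennreal) \<Rightarrow> bool" where
  "gauge Y \<longleftrightarrow> Y 0 = 0 \<and> mono Y \<and> (\<forall>u x. u \<le> 1 \<longrightarrow> Y (u * x) \<le> u * Y x)"

lemma gauge_zero: "gauge Y \<Longrightarrow> Y 0 = 0"
  and gauge_mono: "gauge Y \<Longrightarrow> x \<le> y \<Longrightarrow> Y x \<le> Y y"
  and gauge_scale: "gauge Y \<Longrightarrow> u \<le> 1 \<Longrightarrow> Y (u * x) \<le> u * Y x"
  by (auto simp: gauge_def mono_def)

lemma ennreal_ratio:
  fixes x y :: ennreal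
  assumes "x \<le> y" "y < \<infinity>"
  obtains u where "u \<le> 1" "x = u * y"
proof (cases "y = 0")
  case True
  then show ?thesis using that[of 0] assms by simp
next
  case False
  have "x = x / y * y"
    using False assms by (simp add: ennreal_divide_times less_top)
  moreover have "x / y \<le> 1"
    using assms False by (metis divide_right_mono_ennreal ennreal_divide_self infinity_ennreal_def)
  ultimately show ?thesis using that by blast
qed

text \<open>Convexity with second point 0 gives the scaling property. Monotonicity follows from it,
  because below a finite y every x is u y with u \<le> 1; for infinite y it is \<Phi> \<infinity> =
  \<infinity>.\<close>

lemma young_gauge:
  assumes "young_function \<Phi>"
  shows "gauge \<Phi>"
proof -
  have zero: "\<Phi> 0 = 0" and inf: "\<Phi> \<infinity> = \<infinity>"
    and conv: "\<And>x y u v. u + v = 1 \<Longrightarrow> \<Phi> (u * x + v * y) \<le> u * \<Phi> x + v * \<Phi> y"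
    using assms by (auto simp: young_function_def)
  have scale: "\<Phi> (u * x) \<le> u * \<Phi> x" if "u \<le> 1" for u x
  proof -
    have "u + (1 - u) = 1" using that by (simp add: add_diff_inverse_ennreal)
    from conv[OF this, of x 0] show ?thesis by (simp add: zero)
  qed
  have "\<Phi> x \<le> \<Phi> y" if le: "x \<le> y" for x y
  proof (cases "y = \<infinity>")
    case False
    then obtain u where u: "u \<le> 1" "x = u * y" using ennreal_ratio[OF le] by (auto simp: less_top)
    then show ?thesis using scale[OF u(1), of y] mult_right_mono[OF u(1), of "\<Phi> y"]
      by (auto intro: order_trans)
  next
    case True
    then show ?thesis using inf by simp
  qed
  then show ?thesis using zero scale by (auto simp: gauge_def mono_def)
qed

text \<open>Since u \<Phi> x \<le> \<Phi> x for u \<le> 1, each term x (u y) - \<Phi> x is at most u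
  (x y - \<Phi> x), and the supremum inherits this.\<close>

lemma complementary_gauge: "gauge (complementary \<Phi>)"
  unfolding gauge_def
proof (intro conjI allI impI monoI)
  show "complementary \<Phi> 0 = 0"
    by (auto simp: complementary_def intro!: antisym SUP_least)
  show "complementary \<Phi> x \<le> complementary \<Phi> y" if "x \<le> y" for x y
    unfolding complementary_def using that
    by (intro SUP_subset_mono ennreal_minus_mono mult_left_mono) auto
  fix u y :: ennreal
  assume u: "u \<le> 1"
  show "complementary \<Phi> (u * y) \<le> u * complementary \<Phi> y"
    unfolding complementary_def
  proof (rule SUP_least)
    fix x :: ennreal assume x: "x \<in> {x. x < \<infinity>}"
    have "x * (u * y) - \<Phi> x \<le> u * (x * y) - u * \<Phi> x"
      using mult_right_mono[OF u, of "\<Phi> x"] by (intro ennreal_minus_mono) (auto simp: mult_ac)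
    also have "\<dots> \<le> u * (x * y - \<Phi> x)"
    proof -
      have "u \<noteq> top" using u by (auto simp: top_unique)
      then show ?thesis by (simp add: ennreal_right_diff_distrib)
    qed
    also have "\<dots> \<le> u * (SUP x\<in>{x. x < \<infinity>}. x * y - \<Phi> x)"
      by (intro mult_left_mono SUP_upper x) auto
    finally show "x * (u * y) - \<Phi> x \<le> u * (SUP x\<in>{x. x < \<infinity>}. x * y - \<Phi> x)" .
  qed
qed

lemma young_inequality:
  assumes "x < \<infinity>"
  shows "x * y \<le> \<Phi> x + complementary \<Phi> y"
proof -
  have "x * y - \<Phi> x \<le> complementary \<Phi> y"
    unfolding complementary_def by (rule SUP_upper) (use assms in simp)
  then show ?thesis by (simp add: ennreal_minus_le_iff)
qed

text \<open>Superlevel sets of a monotone function are upward closed, hence rays starting at their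
  infimum, closed or open.\<close>

lemma gauge_measurable [measurable]:
  assumes "gauge Y"
  shows "Y \<in> borel_measurable borel"
proof (rule borel_measurableI_greater)
  fix c
  have up: "x \<in> {x. c < Y x} \<Longrightarrow> x \<le> y \<Longrightarrow> y \<in> {x. c < Y x}" for x y
    using gauge_mono[OF assms, of x y] by (auto intro: less_le_trans)
  define i where "i = Inf {x. c < Y x}"
  have "{x. c < Y x} = {i..} \<or> {x. c < Y x} = {i<..}"
  proof (cases "i \<in> {x. c < Y x}")
    case True
    then have "{x. c < Y x} = {i..}"
    proof safe
      fix x assume "c < Y x"
      then show "i \<le> x" unfolding i_def by (intro Inf_lower) simp
    next
      fix x assume "i \<le> x"
      then show "c < Y x" using up[OF True] by simp
    qed
    then show ?thesis by simp
  next
    case False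
    have "{x. c < Y x} = {i<..}"
    proof safe
      fix x assume x: "c < Y x"
      then have "i \<le> x" unfolding i_def by (intro Inf_lower) simp
      moreover have "i \<noteq> x" using x False by auto
      ultimately show "i < x" by simp
    next
      fix x assume "i < x"
      then obtain z where "c < Y z" "z < x" unfolding i_def Inf_less_iff by auto
      then show "c < Y x" using up[of z x] by simp
    qed
    then show ?thesis by simp
  qed
  then show "{x \<in> space borel. c < Y x} \<in> sets borel"
    by (elim disjE) simp_all
qed

text \<open>
  Jensen's inequality with the constant \<open>2\<close>, which needs only \<open>Y (u x) \<le> u Y x\<close>: the chord slope
  \<open>Y t / t\<close> at \<open>t = (\<integral> X) / 2\<close> gives the pointwise bound \<open>Y X \<ge> (Y t / t) (X - t)\<close>.
\<close>

lemma weak_jensen: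
  assumes Y: "gauge Y" and X [measurable]: "X \<in> borel_measurable M"
    and X_fin: "\<And>x. x \<in> space M \<Longrightarrow> X x < \<infinity>"
    and prob: "emeasure M (space M) \<le> 1" and fin: "(\<integral>\<^sup>+ x. X x \<partial>M) < \<infinity>"
  shows "Y ((\<integral>\<^sup>+ x. X x \<partial>M) / 2) \<le> (\<integral>\<^sup>+ x. Y (X x) \<partial>M)"
proof -
  note [measurable] = gauge_measurable[OF Y]
  define t where "t = (\<integral>\<^sup>+ x. X x \<partial>M) / 2"
  have two: "(\<integral>\<^sup>+ x. X x \<partial>M) = t + t"
    unfolding t_def mult_2_right[symmetric] ennreal_divide_times
    by (simp add: mult_divide_eq_ennreal)
  then have t_fin: "t < \<infinity>" using fin by (simp add: less_top)
  show ?thesis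
  proof (cases "t = 0")
    case True
    then show ?thesis using gauge_zero[OF Y] by (simp add: t_def)
  next
    case False
    have ct: "Y t / t * t = Y t"
      using False t_fin by (simp add: ennreal_divide_times less_top)
    have pointwise: "Y t / t * (X x - t) \<le> Y (X x)" if x: "x \<in> space M" for x
    proof (cases "X x \<le> t")
      case True
      then have "X x - t = 0" using X_fin[OF x] by (simp add: diff_eq_0_iff_ennreal)
      then show ?thesis by simp
    next
      case False
      then have tX: "t \<le> X x" by simp
      have X0: "X x \<noteq> 0" "X x < \<infinity>" using False X_fin[OF x] by auto
      have tr: "t / X x \<le> 1" "t / X x * X x = t"
        using X0 tX by (auto simp: ennreal_divide_times less_top zero_less_iff_neq_zero
          intro!: divide_le_posI_ennreal)
      have "Y t \<le> t / X x * Y (X x)"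
        using gauge_scale[OF Y tr(1), of "X x"] tr(2) by simp
      then have "Y t / t \<le> Y (X x) / X x"
        using \<open>t \<noteq> 0\<close> by (intro divide_le_posI_ennreal) (simp_all add: ennreal_divide_times zero_less_iff_neq_zero)
      then have "Y t / t * (X x - t) \<le> Y (X x) / X x * X x"
        by (intro mult_mono) (auto simp: diff_le_self_ennreal)
      also have "\<dots> = Y (X x)" using X0 by (simp add: ennreal_divide_times less_top)
      finally show ?thesis .
    qed
    \<comment> \<open>The total mass is at most 1, so lowering X by t costs at most t: of the
      integral 2 t at least t remains in the truncated difference.\<close>
    have "t + t \<le> (\<integral>\<^sup>+ x. (X x - t) + t \<partial>M)"
      unfolding two[symmetric]
    proof (rule nn_integral_mono)
      fix x
      have "X x \<le> t + (X x - t)" using t_fin ennreal_minus_le_iff[of "X x" t "X x - t"] by simp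
      then show "X x \<le> (X x - t) + t" by (simp only: add.commute)
    qed
    also have "\<dots> = (\<integral>\<^sup>+ x. (X x - t) \<partial>M) + t * emeasure M (space M)"
      by (subst nn_integral_add) auto
    also have "\<dots> \<le> (\<integral>\<^sup>+ x. (X x - t) \<partial>M) + t"
      using mult_left_mono[OF prob, of t] by (intro add_left_mono) simp
    finally have tle: "t \<le> (\<integral>\<^sup>+ x. (X x - t) \<partial>M)"
      using t_fin by auto
    have "Y t = Y t / t * t" by (rule ct[symmetric])
    also have "\<dots> \<le> Y t / t * (\<integral>\<^sup>+ x. (X x - t) \<partial>M)" by (rule mult_left_mono[OF tle]) simp
    also have "\<dots> = (\<integral>\<^sup>+ x. Y t / t * (X x - t) \<partial>M)" by (rule nn_integral_cmult[symmetric]) measurable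
    also have "\<dots> \<le> (\<integral>\<^sup>+ x. Y (X x) \<partial>M)" by (rule nn_integral_mono) (rule pointwise)
    finally show ?thesis by (simp add: t_def)
  qed
qed

lemma luxemburg_le:
  assumes "b > 0" "(\<integral>\<^sup>+ z. Y (ennreal (cmod (F z) / b)) \<partial>M) \<le> 1"
  shows "luxemburg M Y F \<le> ennreal b"
  unfolding luxemburg_def by (rule Inf_lower) (use assms in blast)

lemma luxemburg_lessD:
  assumes "luxemburg M Y F < c"
  obtains b where "b > 0" "ennreal b < c" "(\<integral>\<^sup>+ z. Y (ennreal (cmod (F z) / b)) \<partial>M) \<le> 1"
  using assms unfolding luxemburg_def Inf_less_iff by blast

lemma nn_integral_ZT:
  fixes f :: "(int ^ 'n) \<times> (real ^ 'n) \<Rightarrow> ennreal"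
  assumes "f \<in> borel_measurable ZT"
  shows "(\<integral>\<^sup>+ z. f z \<partial>ZT) = (\<integral>\<^sup>+ m. \<integral>\<^sup>+ w. f (m, w) \<partial>torus \<partial>lattice)"
  using torus.nn_integral_fst[OF assms[unfolded ZT_def]] by (simp add: ZT_def)

lemma nn_integral_lattice_shift:
  "(\<integral>\<^sup>+ k. f (k - m) \<partial>lattice) = (\<integral>\<^sup>+ k. f k \<partial>lattice)"
  "(\<integral>\<^sup>+ k. f (m - k) \<partial>lattice) = (\<integral>\<^sup>+ k. f k \<partial>lattice)"
proof -
  have "bij (\<lambda>k. k - m)" by (rule bij_diff_right)
  then show "(\<integral>\<^sup>+ k. f (k - m) \<partial>lattice) = (\<integral>\<^sup>+ k. f k \<partial>lattice)"
    by (rule nn_integral_bij_count_space)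
  have "bij (\<lambda>k. m - k)" by (rule bij_diff)
  then show "(\<integral>\<^sup>+ k. f (m - k) \<partial>lattice) = (\<integral>\<^sup>+ k. f k \<partial>lattice)"
    by (rule nn_integral_bij_count_space)
qed

text \<open>The 2 in \<open>2 * b\<close> is the loss in \<open>weak_jensen\<close>. As k varies
  with k0 fixed, each slice k - k0 is used exactly once, so the modulars of the slices add up to the
  full modular.\<close>

lemma coefficient_modular:
  fixes f :: "(int ^ 'n \<Rightarrow> complex) \<Rightarrow> complex" and k0 :: "int ^ 'n"
  assumes Y: "gauge Y" and f: "f \<in> distributions" and g: "g \<in> schwartz" and b: "b > 0"
    and le: "(\<integral>\<^sup>+ z. Y (ennreal (cmod (case z of (m, w) \<Rightarrow> stft g f m w) / b)) \<partial>ZT) \<le> 1"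
  shows "(\<integral>\<^sup>+ k. Y (ennreal (cmod (g k0) / (2 * b) * cmod (value_at f k))) \<partial>lattice) \<le> 1"
proof -
  note [measurable] = gauge_measurable[OF Y]
  define a where "a m k = value_at f k * cnj (g (k - m))" for m k
  have a: "integrable lattice (a m)" for m
    unfolding a_def by (rule integrable_translated_window[OF value_at_poly_bounded[OF f] g])
  have V: "stft g f m = fourier_series (a m)" for m
    unfolding a_def by (rule ext) (rule stft_eq_fourier_series[OF f g])
  have coef: "Y (ennreal (cmod (g k0) / (2 * b) * cmod (value_at f k)))
      \<le> (\<integral>\<^sup>+ w. Y (ennreal (cmod (stft g f (k - k0) w) / b)) \<partial>torus)" for k
  proof -
    let ?X = "\<lambda>w. ennreal (cmod (fourier_series (a (k - k0)) w) / b)"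
    define B where "B = (LINT j|lattice. cmod (a (k - k0) j))"
    have intV: "integrable torus (fourier_series (a (k - k0)))"
      by (rule integrable_torus_bounded[OF _ fourier_series_bound[OF a]]) measurable
    have "cmod (g k0) * cmod (value_at f k) = cmod (a (k - k0) k)"
      by (simp add: a_def norm_mult)
    also have "\<dots> = cmod (LINT w|torus. fourier_series (a (k - k0)) w * unit_char (w \<bullet> rvec k))"
      by (simp add: fourier_series_coefficient[OF a])
    also have "\<dots> \<le> (LINT w|torus. cmod (fourier_series (a (k - k0)) w * unit_char (w \<bullet> rvec k)))"
      by (rule integral_norm_bound)
    also have "\<dots> = (LINT w|torus. cmod (fourier_series (a (k - k0)) w))"
      by (simp add: norm_mult)
    finally have "cmod (g k0) * cmod (value_at f k) / b \<le> (LINT w|torus. cmod (fourier_series (a (k - k0)) w) / b)"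
      using b by (simp add: divide_right_mono)
    then have "ennreal (cmod (g k0) * cmod (value_at f k) / b)
        \<le> ennreal (LINT w|torus. cmod (fourier_series (a (k - k0)) w) / b)"
      by (rule ennreal_leI)
    also have "\<dots> = (\<integral>\<^sup>+ w. ?X w \<partial>torus)"
      using intV b by (intro nn_integral_eq_integral[symmetric]) auto
    finally have "ennreal (cmod (g k0) * cmod (value_at f k) / b) / 2 \<le> (\<integral>\<^sup>+ w. ?X w \<partial>torus) / 2"
      by (rule divide_right_mono_ennreal)
    moreover have "ennreal (cmod (g k0) * cmod (value_at f k) / b) / 2
       = ennreal (cmod (g k0) / (2 * b) * cmod (value_at f k))"
      using b divide_ennreal[of "cmod (g k0) * cmod (value_at f k) / b" 2]
      by (simp add: field_simps del: divide_ennreal)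
    ultimately have "Y (ennreal (cmod (g k0) / (2 * b) * cmod (value_at f k))) \<le> Y ((\<integral>\<^sup>+ w. ?X w \<partial>torus) / 2)"
      by (auto intro: gauge_mono[OF Y])
    also have "\<dots> \<le> (\<integral>\<^sup>+ w. Y (?X w) \<partial>torus)"
    proof (rule weak_jensen[OF Y])
      have "(\<integral>\<^sup>+ w. ?X w \<partial>torus) = ennreal (LINT w|torus. cmod (fourier_series (a (k - k0)) w) / b)"
        using intV b by (intro nn_integral_eq_integral) auto
      then show "(\<integral>\<^sup>+ w. ?X w \<partial>torus) < \<infinity>" by simp
    qed (auto simp: prob_space_torus)
    finally show ?thesis by (simp add: V)
  qed
  have [measurable]: "(\<lambda>(m, w). stft g f m w) \<in> borel_measurable ZT" by (rule stft_measurable[OF f g])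
  have "(\<integral>\<^sup>+ k. Y (ennreal (cmod (g k0) / (2 * b) * cmod (value_at f k))) \<partial>lattice)
      \<le> (\<integral>\<^sup>+ k. \<integral>\<^sup>+ w. Y (ennreal (cmod (stft g f (k - k0) w) / b)) \<partial>torus \<partial>lattice)"
    by (rule nn_integral_mono) (rule coef)
  also have "\<dots> = (\<integral>\<^sup>+ m. \<integral>\<^sup>+ w. Y (ennreal (cmod (stft g f m w) / b)) \<partial>torus \<partial>lattice)"
    by (rule nn_integral_lattice_shift)
  also have "\<dots> = (\<integral>\<^sup>+ z. Y (ennreal (cmod (case z of (m, w) \<Rightarrow> stft g f m w) / b)) \<partial>ZT)"
    by (subst nn_integral_ZT) auto
  finally show ?thesis using le by (rule order_trans)
qed

text \<open>Young's inequality for the normalized sequences: the two modulars contribute 1 + 1 = 2,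
  and undoing the normalization divides by \<alpha> \<beta>.\<close>

lemma young_sum:
  fixes A B :: "int ^ 'n \<Rightarrow> complex"
  assumes \<alpha>: "\<alpha> > 0" and \<beta>: "\<beta> > 0"
    and A: "(\<integral>\<^sup>+ k. \<Phi> (ennreal (\<alpha> * cmod (A k))) \<partial>lattice) \<le> 1"
    and B: "(\<integral>\<^sup>+ k. complementary \<Phi> (ennreal (\<beta> * cmod (B k))) \<partial>lattice) \<le> 1"
  shows "(\<integral>\<^sup>+ k. ennreal (cmod (A k * B k)) \<partial>lattice) \<le> ennreal (2 / (\<alpha> * \<beta>))"
proof -
  have "ennreal (\<alpha> * \<beta>) * (\<integral>\<^sup>+ k. ennreal (cmod (A k * B k)) \<partial>lattice)
     = (\<integral>\<^sup>+ k. ennreal (\<alpha> * cmod (A k)) * ennreal (\<beta> * cmod (B k)) \<partial>lattice)"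
    using \<alpha> \<beta> by (subst nn_integral_cmult[symmetric])
      (auto simp: norm_mult mult_ac simp flip: ennreal_mult intro!: nn_integral_cong)
  also have "\<dots> \<le> (\<integral>\<^sup>+ k. \<Phi> (ennreal (\<alpha> * cmod (A k))) + complementary \<Phi> (ennreal (\<beta> * cmod (B k))) \<partial>lattice)"
    by (intro nn_integral_mono young_inequality) simp
  also have "\<dots> = (\<integral>\<^sup>+ k. \<Phi> (ennreal (\<alpha> * cmod (A k))) \<partial>lattice)
      + (\<integral>\<^sup>+ k. complementary \<Phi> (ennreal (\<beta> * cmod (B k))) \<partial>lattice)"
    by (rule nn_integral_add) auto
  also have "\<dots> \<le> 1 + 1" by (rule add_mono[OF A B])
  finally have "ennreal (\<alpha> * \<beta>) * (\<integral>\<^sup>+ k. ennreal (cmod (A k * B k)) \<partial>lattice) \<le> ennreal 2" by simp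
  then have "ennreal (1 / (\<alpha> * \<beta>)) * (ennreal (\<alpha> * \<beta>) * (\<integral>\<^sup>+ k. ennreal (cmod (A k * B k)) \<partial>lattice))
    \<le> ennreal (1 / (\<alpha> * \<beta>)) * ennreal 2" by (rule mult_left_mono) simp
  moreover have "ennreal (1 / (\<alpha> * \<beta>)) * ennreal (\<alpha> * \<beta>) = 1"
    using \<alpha> \<beta> by (simp flip: ennreal_mult)
  moreover have "ennreal (1 / (\<alpha> * \<beta>)) * ennreal 2 = ennreal (2 / (\<alpha> * \<beta>))"
    using \<alpha> \<beta> by (subst ennreal_mult[symmetric]) auto
  ultimately show ?thesis by (simp only: mult.assoc[symmetric] mult_1_left)
qed

text \<open>On [0, a] the logarithm gives \<Phi> x \<ge> L x^2; beyond a the chord from 0 through a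
  gives \<Phi> x \<ge> L a x. For y \<le> L a the term x y - \<Phi> x can thus be positive only
  where L x < y, and there x y \<le> y^2 / L. Positivity of L is a < 1.\<close>

lemma log_young_quadratic:
  fixes \<Phi> :: "ennreal \<Rightarrow> ennreal" and a :: real
  assumes \<Phi>: "gauge \<Phi>" and a: "0 < a" "a \<le> exp (- 2 / 3)"
    and log: "\<And>x. x \<in> {0..a} \<Longrightarrow> \<Phi> (ennreal x) = ennreal (- (x ^ 2) * ln x)"
  defines "L \<equiv> - ln a"
  shows "L > 0"
    and "\<And>y. 0 \<le> y \<Longrightarrow> y \<le> L * a \<Longrightarrow> complementary \<Phi> (ennreal y) \<le> ennreal (y ^ 2 / L)"
proof -
  have "exp (- 2 / 3) < (1 :: real)" by simp
  then have "a < 1" using a(2) by linarith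
  then show L: "L > 0" using a(1) by (simp add: L_def)
  fix y assume y: "0 \<le> y" "y \<le> L * a"
  have le: "ennreal x * ennreal y - \<Phi> (ennreal x) \<le> ennreal (y ^ 2 / L)" if x: "0 \<le> x" for x :: real
  proof (cases "x \<le> a")
    case True
    show ?thesis
    proof (cases "y \<le> L * x")
      case True
      have "x * y \<le> - (x ^ 2) * ln x"
      proof (cases "x = 0")
        case False
        then have "L \<le> - ln x" using x \<open>x \<le> a\<close> a(1) by (simp add: L_def)
        then have "x * (L * x) \<le> x * (- ln x * x)" using x by (intro mult_left_mono mult_right_mono) auto
        moreover have "x * y \<le> x * (L * x)" using x True by (intro mult_left_mono)
        ultimately show ?thesis by (simp add: power2_eq_square mult_ac)
      qed simp
      then have "ennreal x * ennreal y \<le> \<Phi> (ennreal x)"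
        using x y \<open>x \<le> a\<close> by (simp add: log ennreal_leI flip: ennreal_mult)
      then have "ennreal x * ennreal y - \<Phi> (ennreal x) = 0"
        by (simp add: diff_eq_0_iff_ennreal ennreal_mult_less_top)
      then show ?thesis by simp
    next
      case False
      have "x \<le> y / L" using L False by (simp add: pos_le_divide_eq mult.commute)
      then have "x * y \<le> y / L * y" using y by (intro mult_right_mono)
      then have "ennreal x * ennreal y \<le> ennreal (y ^ 2 / L)"
        using x y by (simp add: power2_eq_square ennreal_leI flip: ennreal_mult)
      then show ?thesis by (rule order_trans[OF diff_le_self_ennreal])
    qed
  next
    case False
    have "\<Phi> (ennreal (a / x) * ennreal x) \<le> ennreal (a / x) * \<Phi> (ennreal x)"
      using False a by (intro gauge_scale[OF \<Phi>]) (simp add: divide_le_eq)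
    moreover have "ennreal (a / x) * ennreal x = ennreal a"
      using False a x by (simp flip: ennreal_mult)
    ultimately have "ennreal (x / a) * \<Phi> (ennreal a) \<le> ennreal (x / a) * (ennreal (a / x) * \<Phi> (ennreal x))"
      by (intro mult_left_mono) auto
    also have "\<dots> = \<Phi> (ennreal x)"
      using False a x by (simp add: mult.assoc[symmetric] flip: ennreal_mult)
    also have "\<Phi> (ennreal a) = ennreal (a ^ 2 * L)" using a log[of a] by (simp add: L_def)
    finally have "ennreal (x * (L * a)) \<le> \<Phi> (ennreal x)"
      using a x L by (simp add: power2_eq_square mult_ac flip: ennreal_mult)
    moreover have "ennreal x * ennreal y \<le> ennreal (x * (L * a))"
      using x y by (auto simp: ennreal_leI mult_left_mono simp flip: ennreal_mult)
    ultimately have "ennreal x * ennreal y \<le> \<Phi> (ennreal x)" by (rule order_trans[rotated])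
    then have "ennreal x * ennreal y - \<Phi> (ennreal x) = 0"
      by (simp add: diff_eq_0_iff_ennreal ennreal_mult_less_top)
    then show ?thesis by simp
  qed
  show "complementary \<Phi> (ennreal y) \<le> ennreal (y ^ 2 / L)"
    unfolding complementary_def
  proof (rule SUP_least)
    fix x :: ennreal assume "x \<in> {x. x < \<infinity>}"
    then obtain r where "x = ennreal r" "0 \<le> r" by (cases x) auto
    then show "x * ennreal y - \<Phi> x \<le> ennreal (y\<^sup>2 / L)"
      using le[of r] by simp
  qed
qed

section \<open>The norm of \<open>M\<^sup>1\<close> dominates that of \<open>L\<^sup>1\<close>\<close>

lemma sigma_finite_ZT: "sigma_finite_measure (ZT :: ((int ^ 'n) \<times> (real ^ 'n)) measure)"
  unfolding ZT_def by (rule ZT.P.sigma_finite_measure_axioms)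

interpretation TZ: pair_sigma_finite "torus :: (real ^ 'n) measure" "lattice :: (int ^ 'n) measure" ..

lemma sigma_finite_TZ: "sigma_finite_measure (TZ :: ((real ^ 'n) \<times> (int ^ 'n)) measure)"
  unfolding TZ_def by (rule TZ.P.sigma_finite_measure_axioms)

lemma measurable_torus_ident:
  assumes "f \<in> measurable M torus"
  shows "f \<in> borel_measurable M"
  using measurable_compose[OF assms measurable_torus[of "\<lambda>x. x" borel]] by simp

lemma measurable_ZT_projections [measurable]:
  "fst \<in> measurable ZT lattice" "snd \<in> borel_measurable ZT"
  "snd \<in> measurable TZ lattice" "fst \<in> borel_measurable TZ"
  unfolding ZT_def TZ_def by (auto intro: measurable_torus_ident)

lemma measurable_lattice_diff:
  fixes a b :: "'b \<Rightarrow> int ^ 'n"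
  assumes [measurable]: "a \<in> measurable M lattice" "b \<in> measurable M lattice"
  shows "(\<lambda>z. a z - b z) \<in> measurable M lattice"
  by measurable

lemma measurable_lattice_compose:
  fixes f :: "int ^ 'n \<Rightarrow> 'c \<Rightarrow> 'd"
  assumes "\<And>k. f k \<in> measurable N K" "a \<in> measurable M lattice" "b \<in> measurable M N"
  shows "(\<lambda>z. f (a z) (b z)) \<in> measurable M K"
proof -
  have "(\<lambda>z. f (fst z) (snd z)) \<in> measurable (lattice \<Otimes>\<^sub>M N) K"
    by (rule measurable_pair_measure_countable1) (use assms in auto)
  from measurable_compose[OF measurable_Pair[OF assms(2,3)] this] show ?thesis by simp
qed

lemma schwartz_ZT_D:
  assumes "G \<in> schwartz_ZT"
  shows "G k (y + rvec j) = G k y" "continuous_on UNIV (G k)"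
    "\<exists>C\<ge>0. \<forall>k y. cmod (G k y) \<le> C / weight k ^ M"
proof -
  show "G k (y + rvec j) = G k y" using assms by (simp add: schwartz_ZT_def torus_periodic_def)
  have "\<forall>k is. foldr partial_deriv is (G k) differentiable_on UNIV"
    using assms unfolding schwartz_ZT_def by blast
  from this[rule_format, of "[]" k] show "continuous_on UNIV (G k)"
    by (simp add: differentiable_imp_continuous_on)
  have "\<forall>is. \<forall>M::nat. \<exists>C. \<forall>k y. cmod (foldr partial_deriv is (G k) y) \<le> C / weight k ^ M"
    using assms unfolding schwartz_ZT_def by blast
  from this[rule_format, of "[]" M] obtain C where C: "\<And>k y. cmod (G k y) \<le> C / weight k ^ M"
    by auto
  have "0 \<le> C / weight (0 :: int ^ 'a) ^ M" by (rule order_trans[OF norm_ge_zero C])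
  then have "0 \<le> C" by (simp add: rvec_zero)
  then show "\<exists>C\<ge>0. \<forall>k y. cmod (G k y) \<le> C / weight k ^ M" using C by blast
qed

lemma schwartz_ZT_measurable:
  "G \<in> schwartz_ZT \<Longrightarrow> G k \<in> borel_measurable borel"
  by (intro borel_measurable_continuous_onI schwartz_ZT_D)

lemma window_measurable:
  assumes G: "G \<in> schwartz_ZT"
    and a: "a \<in> measurable M lattice" and b: "b \<in> borel_measurable M"
  shows "(\<lambda>z. G (a z) (b z)) \<in> borel_measurable M"
  by (rule measurable_lattice_compose[OF schwartz_ZT_measurable[OF G] a b])

lemma window_cnj_measurable:
  assumes G: "G \<in> schwartz_ZT"
    and a: "a \<in> measurable M lattice" and b: "b \<in> borel_measurable M"
  shows "(\<lambda>z. cnj (G (a z) (b z))) \<in> borel_measurable M"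
proof (rule measurable_lattice_compose[OF _ a b, where f = "\<lambda>k y. cnj (G k y)"])
  show "(\<lambda>y. cnj (G k y)) \<in> borel_measurable borel" for k
    using schwartz_ZT_D(2)[OF G]
    by (intro borel_measurable_continuous_onI continuous_on_cnj) auto
qed

lemma tempered_functions_section:
  assumes "\<sigma> \<in> tempered_functions"
  shows "\<sigma> k \<in> borel_measurable torus"
proof -
  have "(\<lambda>(k, y). \<sigma> k y) \<in> borel_measurable (lattice \<Otimes>\<^sub>M torus)"
    using assms by (simp add: tempered_functions_def ZT_def)
  from measurable_Pair2[OF this, of k] show ?thesis by simp
qed

text \<open>The translated window is integrated both over its argument and over the position of the
  translation; the latter is a reflection. The exponents 1 and 2 both occur in
  \<open>M1_controls_L1\<close>.\<close>

lemma nn_integral_window_power: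
  fixes G :: "int ^ 'n \<Rightarrow> real ^ 'n \<Rightarrow> complex"
  assumes G: "G \<in> schwartz_ZT"
  shows "(\<integral>\<^sup>+ z. ennreal (cmod (G (fst z - m) (snd z - w)) ^ p) \<partial>ZT) = (\<integral>\<^sup>+ z. ennreal (cmod (G (fst z) (snd z)) ^ p) \<partial>ZT)"
    and "(\<integral>\<^sup>+ z. ennreal (cmod (G (m - fst z) (w - snd z)) ^ p) \<partial>ZT) = (\<integral>\<^sup>+ z. ennreal (cmod (G (fst z) (snd z)) ^ p) \<partial>ZT)"
proof -
  have [measurable]: "(\<lambda>z. G (fst z) (snd z)) \<in> borel_measurable ZT"
    "(\<lambda>z. G (fst z - m) (snd z - w)) \<in> borel_measurable ZT"
    "(\<lambda>z. G (m - fst z) (w - snd z)) \<in> borel_measurable ZT"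
    by (rule window_measurable[OF G], measurable)+
  have [measurable]: "G k \<in> borel_measurable borel" for k by (rule schwartz_ZT_measurable[OF G])
  have per: "ennreal (cmod (G k (y + rvec j)) ^ p) = ennreal (cmod (G k y) ^ p)" for k y j
    by (simp add: schwartz_ZT_D(1)[OF G])
  have 0: "(\<integral>\<^sup>+ z. ennreal (cmod (G (fst z) (snd z)) ^ p) \<partial>ZT) = (\<integral>\<^sup>+ k. \<integral>\<^sup>+ y. ennreal (cmod (G k y) ^ p) \<partial>torus \<partial>lattice)"
    by (subst nn_integral_ZT) auto
  have "(\<integral>\<^sup>+ z. ennreal (cmod (G (fst z - m) (snd z - w)) ^ p) \<partial>ZT)
     = (\<integral>\<^sup>+ k. \<integral>\<^sup>+ y. ennreal (cmod (G (k - m) (y + (- w))) ^ p) \<partial>torus \<partial>lattice)"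
    by (subst nn_integral_ZT) auto
  also have "\<dots> = (\<integral>\<^sup>+ k. \<integral>\<^sup>+ y. ennreal (cmod (G (k - m) y) ^ p) \<partial>torus \<partial>lattice)"
    by (intro nn_integral_cong nn_integral_torus_shift per) measurable
  also have "\<dots> = (\<integral>\<^sup>+ k. \<integral>\<^sup>+ y. ennreal (cmod (G k y) ^ p) \<partial>torus \<partial>lattice)"
    by (rule nn_integral_lattice_shift)
  finally show "(\<integral>\<^sup>+ z. ennreal (cmod (G (fst z - m) (snd z - w)) ^ p) \<partial>ZT) = (\<integral>\<^sup>+ z. ennreal (cmod (G (fst z) (snd z)) ^ p) \<partial>ZT)"
    by (simp only: 0)
  have "(\<integral>\<^sup>+ z. ennreal (cmod (G (m - fst z) (w - snd z)) ^ p) \<partial>ZT)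
     = (\<integral>\<^sup>+ k. \<integral>\<^sup>+ y. ennreal (cmod (G (m - k) (w - y)) ^ p) \<partial>torus \<partial>lattice)"
    by (subst nn_integral_ZT) auto
  also have "\<dots> = (\<integral>\<^sup>+ k. \<integral>\<^sup>+ y. ennreal (cmod (G (m - k) y) ^ p) \<partial>torus \<partial>lattice)"
    by (intro nn_integral_cong nn_integral_torus_reflect per) measurable
  also have "\<dots> = (\<integral>\<^sup>+ k. \<integral>\<^sup>+ y. ennreal (cmod (G k y) ^ p) \<partial>torus \<partial>lattice)"
    by (rule nn_integral_lattice_shift)
  finally show "(\<integral>\<^sup>+ z. ennreal (cmod (G (m - fst z) (w - snd z)) ^ p) \<partial>ZT) = (\<integral>\<^sup>+ z. ennreal (cmod (G (fst z) (snd z)) ^ p) \<partial>ZT)"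
    by (simp only: 0)
qed

text \<open>Finiteness is decay of the window, since powers of an inverse weight do not exceed the
  inverse weight. For positivity a rotation moves \<open>y0\<close> to the origin; by continuity the
  window is non-zero on a small box there, which lies in the unit cube and has positive
  measure.\<close>

lemma window_norms:
  fixes G :: "int ^ 'n \<Rightarrow> real ^ 'n \<Rightarrow> complex"
  assumes G: "G \<in> schwartz_ZT" and nz: "G k0 y0 \<noteq> 0" and p: "p > 0"
  shows "0 < (\<integral>\<^sup>+ z. ennreal (cmod (G (fst z) (snd z)) ^ p) \<partial>ZT)"
    and "(\<integral>\<^sup>+ z. ennreal (cmod (G (fst z) (snd z)) ^ p) \<partial>ZT) < \<infinity>"
proof -
  have [measurable]: "(\<lambda>z. G (fst z) (snd z)) \<in> borel_measurable ZT"
    by (rule window_measurable[OF G]) measurable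
  have [measurable]: "G k \<in> borel_measurable borel" for k by (rule schwartz_ZT_measurable[OF G])
  let ?I = "\<integral>\<^sup>+ z. ennreal (cmod (G (fst z) (snd z)) ^ p) \<partial>ZT"
  have I: "?I = (\<integral>\<^sup>+ k. \<integral>\<^sup>+ y. ennreal (cmod (G k y) ^ p) \<partial>torus \<partial>lattice)"
    by (subst nn_integral_ZT) auto
  obtain C where C: "0 \<le> C" "\<And>k y. cmod (G k y) \<le> C / weight k ^ (2 * CARD('n))"
    using schwartz_ZT_D(3)[OF G] by blast
  have "?I \<le> (\<integral>\<^sup>+ k. \<integral>\<^sup>+ y. ennreal (C ^ p) * ennreal (1 / weight k ^ (2 * CARD('n))) \<partial>(torus :: (real ^ 'n) measure) \<partial>(lattice :: (int ^ 'n) measure))"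
    unfolding I
  proof (intro nn_integral_mono)
    fix k :: "int ^ 'n" and y :: "real ^ 'n"
    have w: "1 \<le> weight k ^ (2 * CARD('n))" by (rule one_le_power) simp
    have "cmod (G k y) ^ p \<le> (C / weight k ^ (2 * CARD('n))) ^ p"
      by (intro power_mono C) simp
    also have "\<dots> = C ^ p * (1 / weight k ^ (2 * CARD('n))) ^ p"
      by (simp add: power_divide)
    also have "\<dots> \<le> C ^ p * (1 / weight k ^ (2 * CARD('n)))"
    proof (intro mult_left_mono)
      have "(1 / weight k ^ (2 * CARD('n))) ^ p \<le> (1 / weight k ^ (2 * CARD('n))) ^ 1"
      proof (rule power_decreasing)
        show "1 / weight k ^ (2 * CARD('n)) \<le> 1"
          using w weight_pos[of k] by (simp only: divide_le_eq_1 zero_less_power) simp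
        show "0 \<le> 1 / weight k ^ (2 * CARD('n))"
          using weight_pos[of k] by (simp only: zero_le_divide_1_iff zero_le_power less_imp_le)
      qed (use p in simp)
      then show "(1 / weight k ^ (2 * CARD('n))) ^ p \<le> 1 / weight k ^ (2 * CARD('n))" by simp
    qed (use C in simp)
    finally show "ennreal (cmod (G k y) ^ p) \<le> ennreal (C ^ p) * ennreal (1 / weight k ^ (2 * CARD('n)))"
      using C(1) weight_pos[of k] by (simp add: ennreal_leI flip: ennreal_mult)
  qed
  also have "\<dots> = ennreal (C ^ p) * (\<integral>\<^sup>+ k. ennreal (1 / weight (k :: int ^ 'n) ^ (2 * CARD('n))) \<partial>lattice)"
    by (simp add: prob_space_torus nn_integral_cmult)
  also have "\<dots> < \<infinity>"
    using integrable_inverse_weight[where 'n = 'n] weight_pos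
    by (auto simp: integrable_iff_bounded ennreal_mult_less_top less_imp_le)
  finally show "?I < \<infinity>" .
  show "0 < ?I"
  proof (rule ccontr)
    assume "\<not> 0 < ?I"
    then have "(\<integral>\<^sup>+ k. \<integral>\<^sup>+ y. ennreal (cmod (G k y) ^ p) \<partial>torus \<partial>lattice) = 0" by (simp add: I)
    then have "(\<integral>\<^sup>+ y. ennreal (cmod (G k0 y) ^ p) \<partial>torus) = 0"
      by (subst (asm) nn_integral_0_iff_AE) (auto simp: AE_count_space)
    then have "(\<integral>\<^sup>+ y. ennreal (cmod (G k0 (y + y0)) ^ p) \<partial>torus) = 0"
      by (subst nn_integral_torus_shift) (auto simp: schwartz_ZT_D(1)[OF G])
    then have AE0: "AE y in torus. G k0 (y + y0) = 0"
      by (subst (asm) nn_integral_0_iff_AE) (auto simp: measurable_torus)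
    have "continuous_on UNIV (\<lambda>y. G k0 (y + y0))"
      by (rule continuous_on_compose2[OF schwartz_ZT_D(2)[OF G]]) (auto intro!: continuous_intros)
    then have "isCont (\<lambda>y. G k0 (y + y0)) 0"
      by (simp add: continuous_on_eq_continuous_at)
    then obtain d where d: "d > 0" "\<And>y. dist y 0 < d \<Longrightarrow> dist (G k0 (y + y0)) (G k0 (0 + y0)) < cmod (G k0 y0)"
      using nz unfolding continuous_at_eps_delta by (metis zero_less_norm_iff)
    \<comment> \<open>The sum norm bounds the Euclidean norm, so points of the box have norm at most
      d / 2; the 1 / 2 keeps the box inside the unit cube.\<close>
    define e where "e = min (1 / 2) (d / (2 * CARD('n)))"
    have e: "e > 0" "e < 1" using d by (auto simp: e_def)
    have nzb: "box 0 (\<chi> i. e) \<subseteq> {y :: real ^ 'n. G k0 (y + y0) \<noteq> 0}"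
    proof
      fix y :: "real ^ 'n" assume y: "y \<in> box 0 (\<chi> i. e)"
      have "norm y \<le> (\<Sum>i\<in>UNIV. \<bar>y $ i\<bar>)" by (rule norm_le_l1_cart)
      also have "\<dots> \<le> (\<Sum>i\<in>(UNIV :: 'n set). e)"
        using y by (intro sum_mono) (auto simp: mem_box_cart less_imp_le)
      also have "\<dots> = CARD('n) * e" by simp
      also have "\<dots> \<le> CARD('n) * (d / (2 * CARD('n)))"
        by (intro mult_left_mono) (auto simp: e_def)
      also have "\<dots> < d" using d by simp
      finally have "dist (G k0 (y + y0)) (G k0 (0 + y0)) < cmod (G k0 y0)" by (intro d) simp
      then show "y \<in> {y. G k0 (y + y0) \<noteq> 0}" by (auto simp: dist_norm)
    qed
    have sub: "box 0 (\<chi> i. e) \<subseteq> (unit_cube :: (real ^ 'n) set)"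
    proof
      fix y :: "real ^ 'n" assume "y \<in> box 0 (\<chi> i. e)"
      then have "0 < y $ i" "y $ i < e" for i by (auto simp: mem_box_cart)
      then show "y \<in> unit_cube" using e(2) by (auto intro: less_imp_le less_trans)
    qed
    have "AE y in (torus :: (real ^ 'n) measure). y \<notin> box 0 (\<chi> i. e)"
      using AE0 by eventually_elim (use nzb in blast)
    moreover have "box 0 (\<chi> i. e) \<in> sets (torus :: (real ^ 'n) measure)"
      unfolding sets_torus using sub by (subst sets_restrict_space_iff) auto
    ultimately have "emeasure torus (box 0 (\<chi> i. e) :: (real ^ 'n) set) = 0"
      by (subst (asm) AE_iff_measurable[where N = "box 0 (\<chi> i. e)"]) (use sub in \<open>auto simp: space_torus\<close>)
    moreover have "emeasure torus (box 0 (\<chi> i. e) :: (real ^ 'n) set) = emeasure lborel (box 0 (\<chi> i. e) :: (real ^ 'n) set)"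
      unfolding torus_def using sub by (intro emeasure_restrict_space) auto
    moreover have "emeasure lborel (box 0 (\<chi> i. e) :: (real ^ 'n) set) > 0"
    proof -
      have b: "(\<chi> i. e) \<bullet> b = e" if "b \<in> Basis" for b :: "real ^ 'n"
        using that by (auto simp: Basis_vec_def cart_eq_inner_axis[symmetric])
      show ?thesis using e by (simp add: emeasure_lborel_box_eq b)
    qed
    ultimately show False by simp
  qed
qed

section \<open>The symbol seen through translated windows\<close>

context
  fixes G \<sigma> :: "int ^ 'n \<Rightarrow> real ^ 'n \<Rightarrow> complex"
  assumes G: "G \<in> schwartz_ZT" and \<sigma>: "\<sigma> \<in> tempered_functions"
begin

text \<open>The integrand of \<open>stft_ZT\<close> is split: this factor depends on the position p
  only and \<open>phase\<close> on the frequency q only. For fixed p the transform is the Fourier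
  transform of this factor.\<close>

definition windowed :: "(int ^ 'n) \<times> (real ^ 'n) \<Rightarrow> (int ^ 'n) \<times> (real ^ 'n) \<Rightarrow> complex" where
  "windowed p z = \<sigma> (fst z) (snd z) * cnj (G (fst z - fst p) (snd z - snd p))"

definition phase :: "(real ^ 'n) \<times> (int ^ 'n) \<Rightarrow> (int ^ 'n) \<times> (real ^ 'n) \<Rightarrow> complex" where
  "phase q z = unit_char (- (fst q \<bullet> rvec (fst z) + rvec (snd q) \<bullet> snd z))"

lemma stft_ZT_eq: "stft_ZT G \<sigma> p q = (LINT z|ZT. windowed p z * phase q z)"
  by (simp add: stft_ZT_def windowed_def phase_def case_prod_beta')

lemma symbol_measurable [measurable]: "(\<lambda>z. \<sigma> (fst z) (snd z)) \<in> borel_measurable ZT"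
  using \<sigma> by (simp add: tempered_functions_def case_prod_beta')

lemma windowed_measurable_pair:
  "(\<lambda>x. windowed (fst x) (snd x)) \<in> borel_measurable (ZT \<Otimes>\<^sub>M ZT)"
proof -
  have "(\<lambda>x. cnj (G (fst (snd x) - fst (fst x)) (snd (snd x) - snd (fst x))))
      \<in> borel_measurable (ZT \<Otimes>\<^sub>M ZT)"
    by (rule window_cnj_measurable[OF G measurable_lattice_diff]) measurable
  moreover have "(\<lambda>x. \<sigma> (fst (snd x)) (snd (snd x))) \<in> borel_measurable (ZT \<Otimes>\<^sub>M ZT)"
    by (rule measurable_compose[OF measurable_snd symbol_measurable])
  ultimately show ?thesis unfolding windowed_def by (intro borel_measurable_times)
qed

lemma phase_measurable_pair:
  "(\<lambda>x. phase (fst x) (snd x)) \<in> borel_measurable (TZ \<Otimes>\<^sub>M ZT)"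
proof -
  have [measurable]: "(\<lambda>x. fst (fst x) \<bullet> rvec (fst (snd x))) \<in> borel_measurable (TZ \<Otimes>\<^sub>M (ZT :: ((int ^ 'n) \<times> (real ^ 'n)) measure))"
    by (rule measurable_lattice_compose[where f = "\<lambda>k x. x \<bullet> rvec k" and N = borel]) measurable
  have [measurable]: "(\<lambda>x. rvec (snd (fst x)) \<bullet> snd (snd x)) \<in> borel_measurable (TZ \<Otimes>\<^sub>M (ZT :: ((int ^ 'n) \<times> (real ^ 'n)) measure))"
    by (rule measurable_lattice_compose[where f = "\<lambda>k x. rvec k \<bullet> x" and N = borel]) measurable
  show ?thesis unfolding phase_def by measurable
qed

lemma windowed_measurable [measurable]: "windowed p \<in> borel_measurable ZT"
proof -
  have "(\<lambda>z. cnj (G (fst z - fst p) (snd z - snd p))) \<in> borel_measurable ZT"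
    by (rule window_cnj_measurable[OF G measurable_lattice_diff]) measurable
  then show ?thesis unfolding windowed_def by (intro borel_measurable_times symbol_measurable)
qed

lemma phase_measurable [measurable]: "phase q \<in> borel_measurable ZT"
proof -
  have [measurable]: "(\<lambda>z. fst q \<bullet> rvec (fst z)) \<in> borel_measurable (ZT :: ((int ^ 'n) \<times> (real ^ 'n)) measure)"
    by (rule measurable_lattice_compose[where f = "\<lambda>k x. fst q \<bullet> rvec k" and N = borel and b = snd]) measurable
  show ?thesis unfolding phase_def by measurable
qed

lemma stft_ZT_measurable:
  "(\<lambda>x. stft_ZT G \<sigma> (fst x) (snd x)) \<in> borel_measurable (ZT \<Otimes>\<^sub>M TZ)"
proof -
  interpret ZT: sigma_finite_measure "ZT :: ((int ^ 'n) \<times> (real ^ 'n)) measure" by (rule sigma_finite_ZT)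
  have [measurable]: "(\<lambda>x. windowed (fst (fst x)) (snd x)) \<in> borel_measurable ((ZT \<Otimes>\<^sub>M TZ) \<Otimes>\<^sub>M ZT)"
  proof -
    have "(\<lambda>x. (fst (fst x), snd x)) \<in> measurable ((ZT \<Otimes>\<^sub>M TZ) \<Otimes>\<^sub>M ZT)
        ((ZT :: ((int ^ 'n) \<times> (real ^ 'n)) measure) \<Otimes>\<^sub>M (ZT :: ((int ^ 'n) \<times> (real ^ 'n)) measure))"
      by measurable
    from measurable_compose[OF this windowed_measurable_pair] show ?thesis by simp
  qed
  have [measurable]: "(\<lambda>x. phase (snd (fst x)) (snd x)) \<in> borel_measurable ((ZT \<Otimes>\<^sub>M TZ) \<Otimes>\<^sub>M ZT)"
  proof -
    have "(\<lambda>x. (snd (fst x), snd x)) \<in> measurable ((ZT \<Otimes>\<^sub>M TZ) \<Otimes>\<^sub>M ZT)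
        ((TZ :: ((real ^ 'n) \<times> (int ^ 'n)) measure) \<Otimes>\<^sub>M (ZT :: ((int ^ 'n) \<times> (real ^ 'n)) measure))"
      by measurable
    from measurable_compose[OF this phase_measurable_pair] show ?thesis by simp
  qed
  have "(\<lambda>(x, z). windowed (fst x) z * phase (snd x) z) \<in> borel_measurable ((ZT \<Otimes>\<^sub>M TZ) \<Otimes>\<^sub>M ZT)"
    unfolding case_prod_beta' by measurable
  from ZT.borel_measurable_lebesgue_integral[OF this] show ?thesis by (simp add: stft_ZT_eq)
qed

lemma stft_ZT_measurable_section:
  "stft_ZT G \<sigma> p \<in> borel_measurable TZ"
proof -
  interpret ZT: sigma_finite_measure "ZT :: ((int ^ 'n) \<times> (real ^ 'n)) measure" by (rule sigma_finite_ZT)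
  have [measurable]: "(\<lambda>x. windowed p (snd x)) \<in> borel_measurable (TZ \<Otimes>\<^sub>M ZT)" by measurable
  note [measurable] = phase_measurable_pair
  have "(\<lambda>(x, z). windowed p z * phase x z) \<in> borel_measurable (TZ \<Otimes>\<^sub>M ZT)"
    unfolding case_prod_beta' by measurable
  from ZT.borel_measurable_lebesgue_integral[OF this] show ?thesis by (simp add: stft_ZT_eq[abs_def])
qed

text \<open>The slices of a tempered \<sigma> have L1 norms of growth order N, so decay of the
  window of order N + 2 n leaves a summable weight. \<open>weight_triangle\<close> transfers the
  decay from k - m to k.\<close>

lemma windowed_integrable: "integrable ZT (windowed p)"
proof (rule integrableI_bounded)
  show "windowed p \<in> borel_measurable ZT" by measurable
  obtain E N where "\<And>k. (\<integral>\<^sup>+ y. ennreal (cmod (\<sigma> k y)) \<partial>torus) \<le> ennreal (E * weight k ^ N)"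
    using \<sigma> unfolding tempered_functions_def by blast
  moreover have "E * weight k ^ N \<le> max E 0 * weight k ^ N" for k :: "int ^ 'n"
    using weight_pos[of k] by (intro mult_right_mono) auto
  ultimately have E: "(\<integral>\<^sup>+ y. ennreal (cmod (\<sigma> k y)) \<partial>torus) \<le> ennreal (max E 0 * weight k ^ N)" for k
    using ennreal_leI order_trans by blast
  define D where "D = 2 * CARD('n)"
  obtain C where C: "0 \<le> C" "\<And>k y. cmod (G k y) \<le> C / weight k ^ (N + D)"
    using schwartz_ZT_D(3)[OF G] by blast
  define m where "m = fst p"
  define B where "B = max E 0 * C * weight m ^ (N + D)"
  have B: "0 \<le> B" using C weight_pos[of m] by (simp add: B_def)
  note [measurable] = tempered_functions_section[OF \<sigma>]
  have "(\<integral>\<^sup>+ z. ennreal (norm (windowed p z)) \<partial>ZT)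
      = (\<integral>\<^sup>+ k. \<integral>\<^sup>+ y. ennreal (norm (windowed p (k, y))) \<partial>torus \<partial>lattice)"
    by (rule nn_integral_ZT) measurable
  also have "\<dots> \<le> (\<integral>\<^sup>+ k. ennreal B * ennreal (1 / weight k ^ D) \<partial>(lattice :: (int ^ 'n) measure))"
  proof (rule nn_integral_mono)
    fix k :: "int ^ 'n"
    have "(\<integral>\<^sup>+ y. ennreal (norm (windowed p (k, y))) \<partial>torus)
       \<le> (\<integral>\<^sup>+ y. ennreal (cmod (\<sigma> k y)) * ennreal (C / weight (k - m) ^ (N + D)) \<partial>torus)"
      unfolding windowed_def m_def
      by (intro nn_integral_mono) (simp add: norm_mult ennreal_mult mult_left_mono ennreal_leI C(2))
    also have "\<dots> = (\<integral>\<^sup>+ y. ennreal (cmod (\<sigma> k y)) \<partial>torus) * ennreal (C / weight (k - m) ^ (N + D))"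
      by (rule nn_integral_multc) measurable
    also have "\<dots> \<le> ennreal (max E 0 * weight k ^ N) * ennreal (C / weight (k - m) ^ (N + D))"
      by (rule mult_right_mono[OF E]) simp
    also have "\<dots> = ennreal (max E 0 * weight k ^ N * (C / weight (k - m) ^ (N + D)))"
      using C weight_pos[of k] weight_pos[of "k - m"] by (intro ennreal_mult[symmetric]) auto
    also have "\<dots> \<le> ennreal (B * (1 / weight k ^ D))"
    proof (rule ennreal_leI)
      have "weight k ^ (N + D) \<le> (weight (k - m) * weight m) ^ (N + D)"
        by (intro power_mono weight_triangle) simp
      then have "1 / weight (k - m) ^ (N + D) \<le> weight m ^ (N + D) / weight k ^ (N + D)"
        using zero_less_power[OF weight_pos[of k], of "N + D"] zero_less_power[OF weight_pos[of "k - m"], of "N + D"]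
        by (simp only: power_mult_distrib pos_le_divide_eq times_divide_eq_left times_divide_eq_right
            pos_divide_le_eq mult_1_left mult_1_right mult.commute)
      then have "max E 0 * weight k ^ N * C * (1 / weight (k - m) ^ (N + D))
          \<le> max E 0 * weight k ^ N * C * (weight m ^ (N + D) / weight k ^ (N + D))"
        using C weight_pos[of k] by (intro mult_left_mono) auto
      also have "\<dots> = B * (1 / weight k ^ D)"
        using weight_pos[of k] by (simp add: B_def power_add)
      finally show "max E 0 * weight k ^ N * (C / weight (k - m) ^ (N + D)) \<le> B * (1 / weight k ^ D)" by simp
    qed
    also have "\<dots> = ennreal B * ennreal (1 / weight k ^ D)"
      using B weight_pos[of k] by (intro ennreal_mult) auto
    finally show "(\<integral>\<^sup>+ y. ennreal (norm (windowed p (k, y))) \<partial>torus) \<le> ennreal B * ennreal (1 / weight k ^ D)" .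
  qed
  also have "\<dots> = ennreal B * (\<integral>\<^sup>+ k. ennreal (1 / weight (k :: int ^ 'n) ^ D) \<partial>lattice)"
    by (rule nn_integral_cmult) measurable
  also have "\<dots> < \<infinity>"
    using integrable_inverse_weight[where 'n = 'n] weight_pos
    by (auto simp: integrable_iff_bounded ennreal_mult_less_top less_imp_le D_def)
  finally show "(\<integral>\<^sup>+ z. ennreal (norm (windowed p z)) \<partial>ZT) < \<infinity>" .
qed

definition M1_section :: "(int ^ 'n) \<times> (real ^ 'n) \<Rightarrow> ennreal" where
  "M1_section p = (\<integral>\<^sup>+ q. ennreal (cmod (stft_ZT G \<sigma> p q)) \<partial>TZ)"

lemma integral_M1_section: "(\<integral>\<^sup>+ p. M1_section p \<partial>ZT) = M1_norm G \<sigma>"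
proof -
  interpret TZ: sigma_finite_measure "TZ :: ((real ^ 'n) \<times> (int ^ 'n)) measure" by (rule sigma_finite_TZ)
  have "(\<lambda>x. ennreal (cmod (stft_ZT G \<sigma> (fst x) (snd x)))) \<in> borel_measurable (ZT \<Otimes>\<^sub>M TZ)"
    using stft_ZT_measurable by measurable
  from TZ.nn_integral_fst[OF this] show ?thesis
    by (simp add: M1_section_def M1_norm_def case_prod_beta')
qed

text \<open>
  For fixed \<open>p\<close> the transform is integrated over \<open>x\<close> first: the coefficients in \<open>x\<close> give the
  Fourier coefficients in \<open>y\<close> of \<open>\<sigma> \<cdot> cnj (G(\<cdot> - p))\<close> on each slice \<open>k\<close>, and these are summable.
\<close>

lemma windowed_bound:
  assumes fin: "M1_section p < \<infinity>"
  shows "AE y in torus. ennreal (cmod (windowed p (k, y))) \<le> M1_section p"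
proof -
  define H where "H = enn2real (M1_section p)"
  have H: "M1_section p = ennreal H" "0 \<le> H" using fin by (auto simp: H_def)
  have int: "integrable (lattice \<Otimes>\<^sub>M torus) (case_prod (\<lambda>k y. windowed p (k, y)))"
    using windowed_integrable[of p] by (simp add: ZT_def case_prod_beta')
  have int_k: "integrable torus (\<lambda>y. windowed p (k, y))" for k
  proof -
    have "AE k in lattice. integrable torus (\<lambda>y. windowed p (k, y))"
      using ZT.AE_integrable_fst[OF int] .
    then show ?thesis by (simp add: AE_count_space)
  qed
  \<comment> \<open>Read in two ways: for fixed k these are the Fourier coefficients in l of the
    slice at k; for fixed l they are the coefficients in k of the transform as a function of
    x.\<close>
  define c where "c l k = (LINT y|torus. windowed p (k, y) * unit_char (- (rvec l \<bullet> y)))" for l k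
  have int_phase: "integrable ZT (\<lambda>z. windowed p z * phase q z)" for q
    by (rule Bochner_Integration.integrable_bound[OF windowed_integrable[of p]])
      (auto simp: norm_mult phase_def)
  have "stft_ZT G \<sigma> p (x, l) = fourier_series (c l) x \<and> integrable lattice (c l)" for x l
  proof -
    have i: "integrable (lattice \<Otimes>\<^sub>M torus) (case_prod (\<lambda>k y. windowed p (k, y) * phase (x, l) (k, y)))" for x
      using int_phase[of "(x, l)"] by (simp add: ZT_def case_prod_beta')
    have slice: "(LINT y|torus. windowed p (k, y) * phase (x, l) (k, y)) = c l k * unit_char (- (x \<bullet> rvec k))" for k x
    proof -
      have "windowed p (k, y) * phase (x, l) (k, y)
          = (windowed p (k, y) * unit_char (- (rvec l \<bullet> y))) * unit_char (- (x \<bullet> rvec k))" for y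
        by (simp add: phase_def mult_ac flip: unit_char_add)
      then show ?thesis unfolding c_def by (simp only: integral_mult_left_zero)
    qed
    have "stft_ZT G \<sigma> p (x, l) = (LINT k|lattice. LINT y|torus. windowed p (k, y) * phase (x, l) (k, y))"
      using ZT.integral_fst[OF i, of x] by (simp add: stft_ZT_eq ZT_def case_prod_beta')
    also have "\<dots> = fourier_series (c l) x" by (simp add: slice fourier_series_def)
    finally have 1: "stft_ZT G \<sigma> p (x, l) = fourier_series (c l) x" .
    \<comment> \<open>At x = 0 the slice integrals are the coefficients themselves, so their
      summability comes from Fubini.\<close>
    have "integrable lattice (\<lambda>k. LINT y|torus. windowed p (k, y) * phase (0, l) (k, y))"
      using ZT.integrable_fst[OF i] .
    then show ?thesis using 1 by (simp add: slice)
  qed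
  then have V: "\<And>x l. stft_ZT G \<sigma> p (x, l) = fourier_series (c l) x" and ic: "\<And>l. integrable lattice (c l)"
    by auto
  have c_le: "ennreal (cmod (c l k)) \<le> (\<integral>\<^sup>+ x. ennreal (cmod (stft_ZT G \<sigma> p (x, l))) \<partial>torus)" for l
  proof -
    have intV: "integrable torus (fourier_series (c l))"
      by (rule integrable_torus_bounded[OF _ fourier_series_bound[OF ic]]) measurable
    have "cmod (c l k) \<le> (LINT x|torus. cmod (fourier_series (c l) x * unit_char (x \<bullet> rvec k)))"
      unfolding fourier_series_coefficient[OF ic, of l k, symmetric] by (rule integral_norm_bound)
    also have "\<dots> = (LINT x|torus. cmod (fourier_series (c l) x))" by (simp add: norm_mult)
    finally have "ennreal (cmod (c l k)) \<le> ennreal (LINT x|torus. cmod (fourier_series (c l) x))"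
      by (rule ennreal_leI)
    also have "\<dots> = (\<integral>\<^sup>+ x. ennreal (cmod (fourier_series (c l) x)) \<partial>torus)"
      using intV by (intro nn_integral_eq_integral[symmetric]) auto
    finally show ?thesis by (simp add: V)
  qed
  have "(\<integral>\<^sup>+ l. cmod (LINT y|torus. windowed p (k, y) * unit_char (- (y \<bullet> rvec l))) \<partial>lattice)
      = (\<integral>\<^sup>+ l. cmod (c l k) \<partial>lattice)"
    by (simp add: c_def inner_commute)
  also have "\<dots> \<le> (\<integral>\<^sup>+ l. \<integral>\<^sup>+ x. ennreal (cmod (stft_ZT G \<sigma> p (x, l))) \<partial>torus \<partial>lattice)"
    by (rule nn_integral_mono) (rule c_le)
  also have "\<dots> = M1_section p"
  proof -
    have "(\<lambda>q. ennreal (cmod (stft_ZT G \<sigma> p q))) \<in> borel_measurable TZ"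
      using stft_ZT_measurable_section[of p] by measurable
    from TZ.nn_integral_snd[of "\<lambda>q. ennreal (cmod (stft_ZT G \<sigma> p q))"] this show ?thesis
      by (simp add: M1_section_def TZ_def case_prod_beta')
  qed
  finally have "AE y in torus. cmod (windowed p (k, y)) \<le> H"
    using H by (intro fourier_coefficients_bound[OF int_k]) auto
  then show ?thesis by eventually_elim (simp add: H ennreal_leI)
qed

text \<open>Of the two factors in the squared window, one joins \<sigma> and is bounded by
  \<open>M1_section p\<close>, the other stays and is integrable. Integrating over the position p
  produces the M1 norm on the right; on the left, after interchange, it removes the square.\<close>

lemma M1_controls_L1:
  assumes nz: "G k0 y0 \<noteq> 0"
  shows "(\<integral>\<^sup>+ z. ennreal (cmod (G (fst z) (snd z)) ^ 2) \<partial>ZT) * (\<integral>\<^sup>+ z. ennreal (cmod (\<sigma> (fst z) (snd z))) \<partial>ZT)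
     \<le> (\<integral>\<^sup>+ z. ennreal (cmod (G (fst z) (snd z)) ^ 1) \<partial>ZT) * M1_norm G \<sigma>"
proof -
  interpret ZTm: sigma_finite_measure "ZT :: ((int ^ 'n) \<times> (real ^ 'n)) measure" by (rule sigma_finite_ZT)
  interpret PP: pair_sigma_finite "ZT :: ((int ^ 'n) \<times> (real ^ 'n)) measure" "ZT :: ((int ^ 'n) \<times> (real ^ 'n)) measure" ..
  interpret TZm: sigma_finite_measure "TZ :: ((real ^ 'n) \<times> (int ^ 'n)) measure" by (rule sigma_finite_TZ)
  define N1 where "N1 = (\<integral>\<^sup>+ z. ennreal (cmod (G (fst z) (snd z)) ^ 1) \<partial>ZT)"
  define N2 where "N2 = (\<integral>\<^sup>+ z. ennreal (cmod (G (fst z) (snd z)) ^ 2) \<partial>ZT)"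
  \<comment> \<open>Positivity matters where \<open>M1_section p\<close> is infinite, because 0
    times \<infinity> is 0 in \<open>ennreal\<close>.\<close>
  have N1: "N1 > 0" unfolding N1_def by (rule window_norms[OF G nz]) simp
  have [measurable]: "(\<lambda>x. G (fst (snd x) - fst (fst x)) (snd (snd x) - snd (fst x)))
      \<in> borel_measurable (ZT \<Otimes>\<^sub>M ZT)"
    by (rule window_measurable[OF G measurable_lattice_diff]) measurable
  have [measurable]: "(\<lambda>z. G (fst z - fst p) (snd z - snd p)) \<in> borel_measurable ZT"
    "(\<lambda>z. G (fst p - fst z) (snd p - snd z)) \<in> borel_measurable ZT" for p
    by (rule window_measurable[OF G measurable_lattice_diff]; measurable)+
  have [measurable]: "(\<lambda>x. \<sigma> (fst (snd x)) (snd (snd x))) \<in> borel_measurable (ZT \<Otimes>\<^sub>M ZT)"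
    by (rule measurable_compose[OF measurable_snd symbol_measurable])
  have M1m [measurable]: "M1_section \<in> borel_measurable ZT"
  proof -
    have "(\<lambda>(p, q). ennreal (cmod (stft_ZT G \<sigma> p q))) \<in> borel_measurable (ZT \<Otimes>\<^sub>M TZ)"
      unfolding case_prod_beta' using stft_ZT_measurable by measurable
    from TZm.borel_measurable_nn_integral[OF this] show ?thesis by (simp add: M1_section_def[abs_def])
  qed
  let ?f = "\<lambda>p z. ennreal (cmod (\<sigma> (fst z) (snd z)) * cmod (G (fst z - fst p) (snd z - snd p)) ^ 2)"
  have inner: "(\<integral>\<^sup>+ z. ?f p z \<partial>ZT) \<le> N1 * M1_section p" for p
  proof (cases "M1_section p = \<infinity>")
    case True
    then show ?thesis using N1 by (simp add: ennreal_mult_top)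
  next
    case False
    then have fin: "M1_section p < \<infinity>" by (simp add: less_top)
    have "(\<integral>\<^sup>+ z. ?f p z \<partial>ZT) = (\<integral>\<^sup>+ k. \<integral>\<^sup>+ y. ?f p (k, y) \<partial>torus \<partial>lattice)"
      by (rule nn_integral_ZT) measurable
    also have "\<dots> \<le> (\<integral>\<^sup>+ k. \<integral>\<^sup>+ y. M1_section p * ennreal (cmod (G (k - fst p) (y - snd p)) ^ 1) \<partial>torus \<partial>lattice)"
    proof (rule nn_integral_mono, rule nn_integral_mono_AE)
      fix k
      show "AE y in torus. ?f p (k, y) \<le> M1_section p * ennreal (cmod (G (k - fst p) (y - snd p)) ^ 1)"
        using windowed_bound[OF fin, of k]
      proof eventually_elim
        case (elim y)
        have "?f p (k, y) = ennreal (cmod (windowed p (k, y))) * ennreal (cmod (G (k - fst p) (y - snd p)))"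
          by (simp add: windowed_def norm_mult power2_eq_square mult.assoc flip: ennreal_mult)
        also have "\<dots> \<le> M1_section p * ennreal (cmod (G (k - fst p) (y - snd p)))"
          by (rule mult_right_mono[OF elim]) simp
        finally show ?case by simp
      qed
    qed
    also have "\<dots> = (\<integral>\<^sup>+ z. M1_section p * ennreal (cmod (G (fst z - fst p) (snd z - snd p)) ^ 1) \<partial>ZT)"
      by (subst nn_integral_ZT) auto
    also have "\<dots> = M1_section p * (\<integral>\<^sup>+ z. ennreal (cmod (G (fst z - fst p) (snd z - snd p)) ^ 1) \<partial>ZT)"
      by (rule nn_integral_cmult) measurable
    also have "\<dots> = M1_section p * N1"
      unfolding N1_def by (subst nn_integral_window_power[OF G]) simp
    finally show ?thesis by (simp add: mult.commute)
  qed
  have "N2 * (\<integral>\<^sup>+ z. ennreal (cmod (\<sigma> (fst z) (snd z))) \<partial>ZT)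
      = (\<integral>\<^sup>+ z. N2 * ennreal (cmod (\<sigma> (fst z) (snd z))) \<partial>ZT)"
    by (rule nn_integral_cmult[symmetric]) measurable
  also have "\<dots> = (\<integral>\<^sup>+ z. \<integral>\<^sup>+ p. ?f p z \<partial>ZT \<partial>ZT)"
  proof (rule nn_integral_cong)
    fix z :: "(int ^ 'n) \<times> (real ^ 'n)"
    have "(\<integral>\<^sup>+ p. ?f p z \<partial>ZT)
      = (\<integral>\<^sup>+ p. ennreal (cmod (\<sigma> (fst z) (snd z))) * ennreal (cmod (G (fst z - fst p) (snd z - snd p)) ^ 2) \<partial>ZT)"
      by (simp add: ennreal_mult)
    also have "\<dots> = ennreal (cmod (\<sigma> (fst z) (snd z))) * (\<integral>\<^sup>+ p. ennreal (cmod (G (fst z - fst p) (snd z - snd p)) ^ 2) \<partial>ZT)"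
      by (rule nn_integral_cmult) measurable
    also have "\<dots> = ennreal (cmod (\<sigma> (fst z) (snd z))) * N2"
      unfolding N2_def by (subst nn_integral_window_power(2)[OF G]) simp
    finally show "N2 * ennreal (cmod (\<sigma> (fst z) (snd z))) = (\<integral>\<^sup>+ p. ?f p z \<partial>ZT)"
      by (simp add: mult.commute)
  qed
  also have "\<dots> = (\<integral>\<^sup>+ p. \<integral>\<^sup>+ z. ?f p z \<partial>ZT \<partial>ZT)"
    using PP.Fubini'[of "\<lambda>p z. ?f p z"] by (simp add: case_prod_beta')
  also have "\<dots> \<le> (\<integral>\<^sup>+ p. N1 * M1_section p \<partial>ZT)"
    by (rule nn_integral_mono) (rule inner)
  also have "\<dots> = N1 * M1_norm G \<sigma>"
    by (subst nn_integral_cmult) (auto simp: integral_M1_section)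
  finally show ?thesis unfolding N1_def N2_def .
qed

end

text \<open>This homogeneity in the window is what lets a rescaled window absorb the constants of
  the operator estimate.\<close>

lemma M1_norm_cmult:
  assumes G: "G \<in> schwartz_ZT" and \<sigma>: "\<sigma> \<in> tempered_functions" and c: "c > 0"
  shows "M1_norm (\<lambda>k y. complex_of_real c * G k y) \<sigma> = ennreal c * M1_norm G \<sigma>"
proof -
  have "stft_ZT (\<lambda>k y. complex_of_real c * G k y) \<sigma> p q = of_real c * stft_ZT G \<sigma> p q" for p q
    by (cases p; cases q) (simp add: stft_ZT_def case_prod_beta' mult_ac flip: integral_mult_right_zero)
  then have "M1_norm (\<lambda>k y. complex_of_real c * G k y) \<sigma>
      = (\<integral>\<^sup>+ x. ennreal c * ennreal (cmod (stft_ZT G \<sigma> (fst x) (snd x))) \<partial>(ZT \<Otimes>\<^sub>M TZ))"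
    using c by (simp add: M1_norm_def norm_mult ennreal_mult case_prod_beta')
  also have "\<dots> = ennreal c * (\<integral>\<^sup>+ x. ennreal (cmod (stft_ZT G \<sigma> (fst x) (snd x))) \<partial>(ZT \<Otimes>\<^sub>M TZ))"
    using stft_ZT_measurable[OF G \<sigma>] by (intro nn_integral_cmult) measurable
  finally show ?thesis by (simp add: M1_norm_def case_prod_beta')
qed

section \<open>Duality of the modulation spaces\<close>

text \<open>States that b is an admissible competitor in the infimum of the Luxemburg norm. Arguing
  with such b bypasses the question whether the infimum is attained.\<close>

definition modular_le ::
  "(ennreal \<Rightarrow> ennreal) \<Rightarrow> (int ^ 'n \<Rightarrow> complex) \<Rightarrow> ((int ^ 'n \<Rightarrow> complex) \<Rightarrow> complex) \<Rightarrow> real \<Rightarrow> bool" where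
  "modular_le Y g f b \<longleftrightarrow> b > 0 \<and> (\<integral>\<^sup>+ z. Y (ennreal (cmod (case z of (m, w) \<Rightarrow> stft g f m w) / b)) \<partial>ZT) \<le> 1"

lemma mod_norm_le: "modular_le Y g f b \<Longrightarrow> mod_norm g Y f \<le> ennreal b"
  unfolding mod_norm_def modular_le_def by (rule luxemburg_le) auto

lemma mod_norm_lessD:
  assumes "mod_norm g Y f < c"
  shows "\<exists>b. modular_le Y g f b \<and> ennreal b < c"
  using luxemburg_lessD[OF assms[unfolded mod_norm_def]] by (metis modular_le_def)

lemma mod_spaceD:
  assumes "f \<in> mod_space g Y"
  shows "f \<in> distributions" "\<exists>b. modular_le Y g f b"
  using assms mod_norm_lessD[of g Y f \<infinity>] by (auto simp: mod_space_def)

lemma mod_spaceI: "f \<in> distributions \<Longrightarrow> modular_le Y g f b \<Longrightarrow> f \<in> mod_space g Y"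
  using mod_norm_le[of Y g f b] by (auto simp: mod_space_def intro: le_less_trans)

lemma value_at_linear: "value_at (\<lambda>\<phi>. a * f \<phi> + b * h \<phi>) k = a * value_at f k + b * value_at h k"
  by (simp add: value_at_def)

lemma distributions_linear:
  assumes f: "f \<in> distributions" and h: "h \<in> distributions"
  shows "(\<lambda>\<phi>. a * f \<phi> + b * h \<phi>) \<in> distributions"
  unfolding distributions_def
proof (intro CollectI conjI ballI allI impI)
  show "a * f (\<lambda>k. c * \<phi> k + d * \<psi> k) + b * h (\<lambda>k. c * \<phi> k + d * \<psi> k)
      = c * (a * f \<phi> + b * h \<phi>) + d * (a * f \<psi> + b * h \<psi>)"
    if "\<phi> \<in> schwartz" "\<psi> \<in> schwartz" for \<phi> \<psi> c d
    using distribution_linear[OF f that] distribution_linear[OF h that] by (simp add: algebra_simps)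
  show "a * f \<phi> + b * h \<phi> = 0" if "\<phi> \<notin> schwartz" for \<phi>
    using that f h by (simp add: distributions_def)
  fix \<phi> :: "int ^ 'a \<Rightarrow> complex" and \<epsilon> :: real
  assume p: "\<phi> \<in> schwartz" and \<epsilon>: "\<epsilon> > 0"
  define e where "e = \<epsilon> / (cmod a + cmod b + 1)"
  have den: "cmod a + cmod b + 1 > 0" using norm_ge_zero[of a] norm_ge_zero[of b] by linarith
  have e: "e > 0" using \<epsilon> den by (simp add: e_def)
  note D = distributions_def[THEN eqset_imp_iff, THEN iffD1, THEN CollectD, THEN conjunct2, THEN conjunct1, THEN bspec,
      THEN spec, THEN mp]
  obtain N1 d1 where 1: "d1 > 0" "\<And>\<psi>. \<psi> \<in> schwartz \<Longrightarrow>
      (\<forall>j\<le>N1. schwartz_seminorm j (\<lambda>k. \<psi> k - \<phi> k) < d1) \<Longrightarrow> cmod (f \<psi> - f \<phi>) < e"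
    using D[OF f p e] by blast
  obtain N2 d2 where 2: "d2 > 0" "\<And>\<psi>. \<psi> \<in> schwartz \<Longrightarrow>
      (\<forall>j\<le>N2. schwartz_seminorm j (\<lambda>k. \<psi> k - \<phi> k) < d2) \<Longrightarrow> cmod (h \<psi> - h \<phi>) < e"
    using D[OF h p e] by blast
  show "\<exists>N. \<exists>\<delta>>0. \<forall>\<psi>\<in>schwartz. (\<forall>j\<le>N. schwartz_seminorm j (\<lambda>k. \<psi> k - \<phi> k) < \<delta>)
      \<longrightarrow> cmod (a * f \<psi> + b * h \<psi> - (a * f \<phi> + b * h \<phi>)) < \<epsilon>"
  proof (intro exI[of _ "max N1 N2"] exI[of _ "min d1 d2"] conjI ballI impI)
    show "0 < min d1 d2" using 1(1) 2(1) by simp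
    fix \<psi> assume q: "\<psi> \<in> schwartz"
      and s: "\<forall>j\<le>max N1 N2. schwartz_seminorm j (\<lambda>k. \<psi> k - \<phi> k) < min d1 d2"
    have "cmod (f \<psi> - f \<phi>) < e" using s by (intro 1(2)[OF q]) auto
    moreover have "cmod (h \<psi> - h \<phi>) < e" using s by (intro 2(2)[OF q]) auto
    ultimately have "cmod a * cmod (f \<psi> - f \<phi>) + cmod b * cmod (h \<psi> - h \<phi>) \<le> cmod a * e + cmod b * e"
      by (intro add_mono mult_left_mono) auto
    also have "\<dots> < (cmod a + cmod b + 1) * e" using e by (simp add: algebra_simps)
    also have "\<dots> = \<epsilon>" using den by (simp add: e_def)
    finally have "cmod a * cmod (f \<psi> - f \<phi>) + cmod b * cmod (h \<psi> - h \<phi>) < \<epsilon>" .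
    moreover have "a * f \<psi> + b * h \<psi> - (a * f \<phi> + b * h \<phi>) = a * (f \<psi> - f \<phi>) + b * (h \<psi> - h \<phi>)"
      by (simp add: algebra_simps)
    then have "cmod (a * f \<psi> + b * h \<psi> - (a * f \<phi> + b * h \<phi>))
        \<le> cmod a * cmod (f \<psi> - f \<phi>) + cmod b * cmod (h \<psi> - h \<phi>)"
      using norm_triangle_ineq[of "a * (f \<psi> - f \<phi>)" "b * (h \<psi> - h \<phi>)"] by (simp add: norm_mult)
    ultimately show "cmod (a * f \<psi> + b * h \<psi> - (a * f \<phi> + b * h \<phi>)) < \<epsilon>" by linarith
  qed
qed

text \<open>Serves the closure of \<open>mod_space\<close> under linear combinations, so the
  constant is crude. Divided by it, the combination is at most half of the larger normalized
  transform; the scaling property then gives the factor 1/2 that brings the sum of two modulars down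
  to 1. The summand 1 covers \<alpha> = \<beta> = 0.\<close>

lemma modular_le_linear:
  assumes Y: "gauge Y" and g: "g \<in> schwartz"
    and f: "f \<in> distributions" "modular_le Y g f b" and h: "h \<in> distributions" "modular_le Y g h c"
  shows "modular_le Y g (\<lambda>\<phi>. \<alpha> * f \<phi> + \<beta> * h \<phi>) (4 * (cmod \<alpha> * b + cmod \<beta> * c + 1))"
proof -
  note [measurable] = gauge_measurable[OF Y]
  have [measurable]: "(\<lambda>(m, w). stft g f m w) \<in> borel_measurable ZT" "(\<lambda>(m, w). stft g h m w) \<in> borel_measurable ZT"
    by (rule stft_measurable[OF f(1) g] stft_measurable[OF h(1) g])+
  define B where "B = 4 * (cmod \<alpha> * b + cmod \<beta> * c + 1)"
  have b: "b > 0" and c: "c > 0" using f(2) h(2) by (auto simp: modular_le_def)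
  have B: "B > 0" using b c by (simp add: B_def add_nonneg_pos)
  define V where "V z = cmod (case z of (m, w) \<Rightarrow> stft g f m w) / b" for z
  define W where "W z = cmod (case z of (m, w) \<Rightarrow> stft g h m w) / c" for z
  have [measurable]: "V \<in> borel_measurable ZT" "W \<in> borel_measurable ZT" unfolding V_def W_def by measurable
  have VW: "(\<integral>\<^sup>+ z. Y (ennreal (V z)) \<partial>ZT) \<le> 1" "(\<integral>\<^sup>+ z. Y (ennreal (W z)) \<partial>ZT) \<le> 1"
    using f(2) h(2) by (auto simp: modular_le_def V_def W_def)
  have "Y (ennreal (cmod (case z of (m, w) \<Rightarrow> stft g (\<lambda>\<phi>. \<alpha> * f \<phi> + \<beta> * h \<phi>) m w) / B))
      \<le> ennreal (1 / 2) * (Y (ennreal (V z)) + Y (ennreal (W z)))" for z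
  proof -
    obtain m w where z: "z = (m, w)" by (cases z)
    define X where "X = max (V z) (W z)"
    have X: "0 \<le> X" using b by (simp add: X_def V_def le_max_iff_disj)
    have "cmod (stft g (\<lambda>\<phi>. \<alpha> * f \<phi> + \<beta> * h \<phi>) m w) \<le> cmod \<alpha> * cmod (stft g f m w) + cmod \<beta> * cmod (stft g h m w)"
      using norm_triangle_ineq[of "\<alpha> * stft g f m w" "\<beta> * stft g h m w"] by (simp add: stft_def norm_mult)
    also have "\<dots> = cmod \<alpha> * b * V z + cmod \<beta> * c * W z" using b c by (simp add: V_def W_def z)
    also have "\<dots> \<le> cmod \<alpha> * b * X + cmod \<beta> * c * X"
      using b c by (intro add_mono mult_left_mono) (auto simp: X_def)
    also have "\<dots> \<le> B / 2 * X"
    proof -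
      have "cmod \<alpha> * b + cmod \<beta> * c \<le> B / 2"
        using b c by (simp add: B_def mult_nonneg_nonneg add_nonneg_nonneg)
      from mult_right_mono[OF this X] show ?thesis by (simp add: algebra_simps)
    qed
    finally have "cmod (stft g (\<lambda>\<phi>. \<alpha> * f \<phi> + \<beta> * h \<phi>) m w) / B \<le> 1 / 2 * X"
      using B by (simp add: divide_le_eq mult_ac)
    then have "Y (ennreal (cmod (stft g (\<lambda>\<phi>. \<alpha> * f \<phi> + \<beta> * h \<phi>) m w) / B)) \<le> Y (ennreal (1 / 2) * ennreal X)"
      using X by (intro gauge_mono[OF Y]) (simp only: ennreal_mult[of "1 / 2" X, symmetric] ennreal_leI)
    also have "\<dots> \<le> ennreal (1 / 2) * Y (ennreal X)"
      by (rule gauge_scale[OF Y], subst ennreal_1[symmetric], rule ennreal_leI) simp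
    also have "\<dots> \<le> ennreal (1 / 2) * (Y (ennreal (V z)) + Y (ennreal (W z)))"
      by (intro mult_left_mono) (auto simp: X_def max_def)
    finally show ?thesis by (simp add: z)
  qed
  then have "(\<integral>\<^sup>+ z. Y (ennreal (cmod (case z of (m, w) \<Rightarrow> stft g (\<lambda>\<phi>. \<alpha> * f \<phi> + \<beta> * h \<phi>) m w) / B)) \<partial>ZT)
      \<le> (\<integral>\<^sup>+ z. ennreal (1 / 2) * (Y (ennreal (V z)) + Y (ennreal (W z))) \<partial>ZT)"
    by (intro nn_integral_mono)
  also have "\<dots> = ennreal (1 / 2) * ((\<integral>\<^sup>+ z. Y (ennreal (V z)) \<partial>ZT) + (\<integral>\<^sup>+ z. Y (ennreal (W z)) \<partial>ZT))"
    by (simp add: nn_integral_cmult nn_integral_add)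
  also have "\<dots> \<le> ennreal (1 / 2) * (1 + 1)" by (intro mult_left_mono add_mono VW) simp
  also have "\<dots> = 1"
    using ennreal_mult[of "1 / 2" 2] by simp
  finally show ?thesis using B unfolding modular_le_def B_def[symmetric] by blast
qed

lemma mod_space_linear:
  assumes "gauge Y" "g \<in> schwartz" "f \<in> mod_space g Y" "h \<in> mod_space g Y"
  shows "(\<lambda>\<phi>. a * f \<phi> + b * h \<phi>) \<in> mod_space g Y"
  using assms mod_spaceD[OF assms(3)] mod_spaceD[OF assms(4)]
  by (blast intro: mod_spaceI distributions_linear modular_le_linear)

lemma integral_lattice_reflect:
  fixes f :: "int ^ 'n \<Rightarrow> complex"
  shows "(LINT k|lattice. f (m - k)) = (LINT k|lattice. f k)"
    and "(LINT k|lattice. f (k + m)) = (LINT k|lattice. f k)"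
proof -
  have "bij (\<lambda>k. m - k)" by (rule bij_diff)
  then show "(LINT k|lattice. f (m - k)) = (LINT k|lattice. f k)"
    by (rule integral_bij_count_space)
  have "bij (\<lambda>k. k + m)" by (rule bij_plus_right)
  then show "(LINT k|lattice. f (k + m)) = (LINT k|lattice. f k)"
    by (rule integral_bij_count_space)
qed

definition window_energy :: "(int ^ 'n \<Rightarrow> complex) \<Rightarrow> real" where
  "window_energy g = (LINT k|lattice. (cmod (g k))\<^sup>2)"

lemma integrable_schwartz_square:
  assumes "g \<in> schwartz"
  shows "integrable lattice (\<lambda>k. g k * cnj (g k))"
proof -
  obtain B where "\<And>k. cmod (g k) \<le> B" using schwartz_bounded[OF assms] by blast
  then show ?thesis
    by (intro integrable_lattice_mult_bounded[OF integrable_schwartz[OF assms]]) simp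
qed

lemma window_energy_eq:
  fixes g :: "int ^ 'n \<Rightarrow> complex"
  assumes "g \<in> schwartz"
  shows "(LINT k|lattice. g k * cnj (g k)) = of_real (window_energy g)"
    and "(\<integral>\<^sup>+ k. ennreal ((cmod (g k))\<^sup>2) \<partial>lattice) = ennreal (window_energy g)"
proof -
  have eq: "g k * cnj (g k) = of_real ((cmod (g k))\<^sup>2)" for k
    by (simp only: complex_norm_square)
  show "(LINT k|lattice. g k * cnj (g k)) = of_real (window_energy g)"
    unfolding eq window_energy_def by (rule integral_complex_of_real)
  have "integrable lattice (\<lambda>k. (cmod (g k))\<^sup>2)"
    using integrable_norm[OF integrable_schwartz_square[OF assms]] by (simp add: norm_mult power2_eq_square)
  then show "(\<integral>\<^sup>+ k. ennreal ((cmod (g k))\<^sup>2) \<partial>lattice) = ennreal (window_energy g)"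
    unfolding window_energy_def by (rule nn_integral_eq_integral) simp
qed

lemma window_energy_pos:
  fixes g :: "int ^ 'n \<Rightarrow> complex"
  assumes g: "g \<in> schwartz" and nz: "g k0 \<noteq> 0"
  shows "window_energy g > 0"
proof -
  have "ennreal ((cmod (g k0))\<^sup>2) = (\<integral>\<^sup>+ k. ennreal ((cmod (g k0))\<^sup>2) * indicator {k0} k \<partial>(lattice :: (int ^ 'n) measure))"
    by (simp add: nn_integral_cmult)
  also have "\<dots> \<le> (\<integral>\<^sup>+ k. ennreal ((cmod (g k))\<^sup>2) \<partial>lattice)"
    by (intro nn_integral_mono) (auto simp: indicator_def)
  finally have "ennreal ((cmod (g k0))\<^sup>2) \<le> ennreal (window_energy g)"
    by (simp add: window_energy_eq[OF g])
  moreover have "0 < ennreal ((cmod (g k0))\<^sup>2)" using nz by (simp add: ennreal_less_zero_iff)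
  ultimately show ?thesis by (metis ennreal_less_zero_iff less_le_trans)
qed

text \<open>Parseval on each slice \<open>m\<close>, followed by summation over \<open>m\<close>.\<close>

lemma duality_formula:
  fixes g :: "int ^ 'n \<Rightarrow> complex"
  assumes \<Phi>: "gauge \<Phi>" and g: "g \<in> schwartz" and nz: "g k0 \<noteq> 0"
    and u: "u \<in> distributions" "modular_le \<Phi> g u b"
    and h: "h \<in> distributions" "modular_le (complementary \<Phi>) g h c"
  shows "integrable ZT (duality_integrand g u h)"
    and "(LINT z|ZT. duality_integrand g u h z) = of_real (window_energy g) * (LINT k|lattice. value_at u k * cnj (value_at h k))"
proof -
  note \<Psi> = complementary_gauge[of \<Phi>]
  note [measurable] = gauge_measurable[OF \<Phi>] gauge_measurable[OF \<Psi>]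
  have b: "b > 0" and c: "c > 0" using u(2) h(2) by (auto simp: modular_le_def)
  have um [measurable]: "(\<lambda>(m, w). stft g u m w) \<in> borel_measurable ZT"
    and hm [measurable]: "(\<lambda>(m, w). stft g h m w) \<in> borel_measurable ZT"
    by (rule stft_measurable[OF u(1) g] stft_measurable[OF h(1) g])+
  have hm' [measurable]: "(\<lambda>z. cnj (case z of (m, w) \<Rightarrow> stft g h m w)) \<in> borel_measurable ZT"
    by (rule measurable_compose[OF hm]) (intro borel_measurable_continuous_onI continuous_intros)
  define V where "V z = cmod (case z of (m, w) \<Rightarrow> stft g u m w)" for z
  define W where "W z = cmod (case z of (m, w) \<Rightarrow> stft g h m w)" for z
  have [measurable]: "V \<in> borel_measurable ZT" "W \<in> borel_measurable ZT" unfolding V_def W_def by measurable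
  have VW: "0 \<le> V z" "0 \<le> W z" for z by (simp_all add: V_def W_def)
  have d: "duality_integrand g u h z = (case z of (m, w) \<Rightarrow> stft g u m w) * cnj (case z of (m, w) \<Rightarrow> stft g h m w)" for z
    by (cases z) (simp add: duality_integrand_def)
  have dm [measurable]: "duality_integrand g u h \<in> borel_measurable ZT"
    unfolding d[abs_def] by (rule borel_measurable_times[OF um hm'])
  show int: "integrable ZT (duality_integrand g u h)"
  proof (rule integrableI_bounded[OF dm])
    have "(\<integral>\<^sup>+ z. ennreal (norm (duality_integrand g u h z)) \<partial>ZT)
        \<le> (\<integral>\<^sup>+ z. ennreal (b * c) * (\<Phi> (ennreal (V z / b)) + complementary \<Phi> (ennreal (W z / c))) \<partial>ZT)"
    proof (rule nn_integral_mono)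
      fix z :: "(int ^ 'n) \<times> (real ^ 'n)"
      have "ennreal (norm (duality_integrand g u h z)) = ennreal (b * c) * (ennreal (V z / b) * ennreal (W z / c))"
        using b c VW[of z] by (simp add: d norm_mult V_def W_def flip: ennreal_mult)
      also have "\<dots> \<le> ennreal (b * c) * (\<Phi> (ennreal (V z / b)) + complementary \<Phi> (ennreal (W z / c)))"
        by (intro mult_left_mono young_inequality) auto
      finally show "ennreal (norm (duality_integrand g u h z))
          \<le> ennreal (b * c) * (\<Phi> (ennreal (V z / b)) + complementary \<Phi> (ennreal (W z / c)))" .
    qed
    also have "\<dots> = ennreal (b * c) * ((\<integral>\<^sup>+ z. \<Phi> (ennreal (V z / b)) \<partial>ZT) + (\<integral>\<^sup>+ z. complementary \<Phi> (ennreal (W z / c)) \<partial>ZT))"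
      by (simp add: nn_integral_cmult nn_integral_add)
    also have "\<dots> \<le> ennreal (b * c) * (1 + 1)"
      using u(2) h(2) unfolding modular_le_def V_def W_def by (intro mult_left_mono add_mono) auto
    also have "\<dots> < \<infinity>" by (simp add: ennreal_mult_less_top)
    finally show "(\<integral>\<^sup>+ z. ennreal (norm (duality_integrand g u h z)) \<partial>ZT) < \<infinity>" .
  qed
  define \<gamma> where "\<gamma> = cmod (g k0)"
  have \<gamma>: "\<gamma> > 0" using nz by (simp add: \<gamma>_def)
  have cu: "(\<integral>\<^sup>+ k. \<Phi> (ennreal (\<gamma> / (2 * b) * cmod (value_at u k))) \<partial>lattice) \<le> 1"
    using u(2) unfolding \<gamma>_def modular_le_def by (intro coefficient_modular[OF \<Phi> u(1) g]) auto
  have ch: "(\<integral>\<^sup>+ k. complementary \<Phi> (ennreal (\<gamma> / (2 * c) * cmod (cnj (value_at h k)))) \<partial>lattice) \<le> 1"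
    using h(2) unfolding \<gamma>_def modular_le_def complex_mod_cnj by (intro coefficient_modular[OF \<Psi> h(1) g]) auto
  \<comment> \<open>Young's inequality makes p absolutely summable, which permits the interchange of
    the sums over m and k below. After it, the sum over m is the window energy, whatever k
    is.\<close>
  define p where "p k = value_at u k * cnj (value_at h k)" for k
  have "(\<integral>\<^sup>+ k. ennreal (cmod (p k)) \<partial>lattice) \<le> ennreal (2 / (\<gamma> / (2 * b) * (\<gamma> / (2 * c))))"
    unfolding p_def by (rule young_sum[OF _ _ cu ch]) (use b c \<gamma> in auto)
  then have p: "integrable lattice p"
    by (simp add: integrable_lattice_iff le_less_trans[OF _ ennreal_less_top])
  have slice: "(LINT w|torus. duality_integrand g u h (m, w)) = (LINT k|lattice. p k * (g (k - m) * cnj (g (k - m))))" for m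
  proof -
    have "(LINT w|torus. duality_integrand g u h (m, w))
      = (LINT w|torus. fourier_series (\<lambda>k. value_at u k * cnj (g (k - m))) w * cnj (fourier_series (\<lambda>k. value_at h k * cnj (g (k - m))) w))"
      by (simp add: duality_integrand_def stft_eq_fourier_series[OF u(1) g] stft_eq_fourier_series[OF h(1) g])
    also have "\<dots> = (LINT k|lattice. (value_at u k * cnj (g (k - m))) * cnj (value_at h k * cnj (g (k - m))))"
      by (intro fourier_series_parseval integrable_translated_window value_at_poly_bounded u(1) h(1) g)
    finally show ?thesis by (simp add: p_def mult_ac)
  qed
  have int': "integrable (lattice \<Otimes>\<^sub>M torus) (case_prod (\<lambda>m w. duality_integrand g u h (m, w)))"
    using int by (simp add: ZT_def)
  have "(LINT z|ZT. duality_integrand g u h z) = (LINT m|lattice. LINT w|torus. duality_integrand g u h (m, w))"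
    using ZT.integral_fst[OF int'] by (simp add: ZT_def)
  also have "\<dots> = (LINT m|lattice. LINT k|lattice. p k * (g (k - m) * cnj (g (k - m))))"
    by (simp add: slice)
  also have "\<dots> = (LINT k|lattice. LINT m|lattice. p k * (g (k - m) * cnj (g (k - m))))"
  proof (rule integral_lattice_swap(2)[OF lattice.sigma_finite_measure_axioms])
    have "(\<integral>\<^sup>+ k. \<integral>\<^sup>+ m. ennreal (cmod (p k * (g (k - m) * cnj (g (k - m))))) \<partial>lattice \<partial>lattice)
      = (\<integral>\<^sup>+ k. \<integral>\<^sup>+ m. ennreal (cmod (p k)) * ennreal ((cmod (g (k - m)))\<^sup>2) \<partial>lattice \<partial>lattice)"
      by (simp add: norm_mult ennreal_mult power2_eq_square)
    also have "\<dots> = (\<integral>\<^sup>+ k. ennreal (cmod (p k)) * ennreal (window_energy g) \<partial>lattice)"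
    proof (rule nn_integral_cong)
      fix k
      have "(\<integral>\<^sup>+ m. ennreal (cmod (p k)) * ennreal ((cmod (g (k - m)))\<^sup>2) \<partial>lattice)
         = ennreal (cmod (p k)) * (\<integral>\<^sup>+ m. ennreal ((cmod (g (k - m)))\<^sup>2) \<partial>lattice)"
        by (rule nn_integral_cmult) simp
      also have "(\<integral>\<^sup>+ m. ennreal ((cmod (g (k - m)))\<^sup>2) \<partial>lattice) = ennreal (window_energy g)"
        using nn_integral_lattice_shift(2)[of "\<lambda>m. ennreal ((cmod (g m))\<^sup>2)" k] by (simp add: window_energy_eq[OF g])
      finally show "(\<integral>\<^sup>+ m. ennreal (cmod (p k)) * ennreal ((cmod (g (k - m)))\<^sup>2) \<partial>lattice)
          = ennreal (cmod (p k)) * ennreal (window_energy g)" .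
    qed
    also have "\<dots> = (\<integral>\<^sup>+ k. ennreal (cmod (p k)) \<partial>lattice) * ennreal (window_energy g)"
      by (rule nn_integral_multc) simp
    also have "\<dots> < \<infinity>" using p by (simp add: integrable_lattice_iff ennreal_mult_less_top)
    finally show "(\<integral>\<^sup>+ k. \<integral>\<^sup>+ m. ennreal (cmod (p k * (g (k - m) * cnj (g (k - m))))) \<partial>lattice \<partial>lattice) < \<infinity>" .
  qed simp
  also have "\<dots> = (LINT k|lattice. p k * of_real (window_energy g))"
  proof (rule Bochner_Integration.integral_cong[OF refl])
    fix k
    have "(LINT m|lattice. p k * (g (k - m) * cnj (g (k - m)))) = p k * (LINT m|lattice. g (k - m) * cnj (g (k - m)))"
      by (rule integral_mult_right_zero)
    also have "(LINT m|lattice. g (k - m) * cnj (g (k - m))) = of_real (window_energy g)"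
      using integral_lattice_reflect(1)[of "\<lambda>m. g m * cnj (g m)" k] by (simp add: window_energy_eq[OF g])
    finally show "(LINT m|lattice. p k * (g (k - m) * cnj (g (k - m)))) = p k * of_real (window_energy g)" .
  qed
  also have "\<dots> = of_real (window_energy g) * (LINT k|lattice. p k)"
    by (simp add: mult.commute)
  finally show "(LINT z|ZT. duality_integrand g u h z) = of_real (window_energy g) * (LINT k|lattice. value_at u k * cnj (value_at h k))"
    by (simp add: p_def[abs_def])
qed

section \<open>Point masses as test elements of the dual space\<close>

abbreviation point_mass :: "int ^ 'n \<Rightarrow> (int ^ 'n \<Rightarrow> complex) \<Rightarrow> complex" where
  "point_mass k \<equiv> distribution_of (unit_vector k)"

lemma point_mass_distribution: "point_mass k \<in> distributions"
  by (rule distribution_of_bounded[of _ 1]) simp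

text \<open>The transform of the point mass at k is bounded by |g(k - m)|, and the complementary
  function is at most quadratic near 0. The modular is therefore controlled by the l2 norm of the
  window.\<close>

lemma point_mass_in_dual:
  fixes g :: "int ^ 'n \<Rightarrow> complex" and \<Phi> :: "ennreal \<Rightarrow> ennreal" and a :: real
  assumes \<Phi>: "gauge \<Phi>" and g: "g \<in> schwartz" and a: "0 < a" "a \<le> exp (- 2 / 3)"
    and log: "\<And>x. x \<in> {0..a} \<Longrightarrow> \<Phi> (ennreal x) = ennreal (- (x ^ 2) * ln x)"
  shows "point_mass k \<in> mod_space g (complementary \<Phi>)"
proof -
  note \<Psi> = complementary_gauge[of \<Phi>]
  note [measurable] = gauge_measurable[OF \<Psi>]
  define L where "L = - ln a"
  have L: "L > 0" and quad: "\<And>y. 0 \<le> y \<Longrightarrow> y \<le> L * a \<Longrightarrow> complementary \<Phi> (ennreal y) \<le> ennreal (y ^ 2 / L)"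
    using log_young_quadratic[OF \<Phi> a log] by (auto simp: L_def)
  obtain B where B: "0 \<le> B" "\<And>j. cmod (g j) \<le> B" using schwartz_bounded[OF g] by blast
  define E where "E = window_energy g"
  have E: "0 \<le> E" unfolding E_def window_energy_def by simp
  \<comment> \<open>The first summand brings the arguments into the quadratic range, the second
    makes the resulting modular at most 1, and the 1 ensures b \<le> b^2.\<close>
  define b where "b = B / (L * a) + E / L + 1"
  have b1: "b \<ge> 1" using B E L a by (simp add: b_def)
  have V: "cmod (stft g (point_mass k) m w) \<le> cmod (g (k - m))" for m w
  proof -
    have "poly_bounded (unit_vector k)" by (rule bounded_imp_poly_bounded[of _ 1]) simp
    from fourier_series_bound[OF integrable_translated_window[OF this g]]
    have "cmod (stft g (point_mass k) m w) \<le> (LINT j|lattice. cmod (unit_vector k j * cnj (g (j - m))))"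
      by (simp only: stft_eq_fourier_series[OF point_mass_distribution g] value_at_distribution_of)
    also have "\<dots> = Re (LINT j|lattice. of_real (cmod (g (j - m))) * indicator {k} j)"
    proof -
      have "(LINT j|lattice. complex_of_real (cmod (unit_vector k j * cnj (g (j - m)))))
          = (LINT j|lattice. of_real (cmod (g (j - m))) * indicator {k} j)"
        by (rule Bochner_Integration.integral_cong) (auto simp: indicator_def)
      from arg_cong[OF this, of Re] show ?thesis
        by (simp only: integral_complex_of_real Re_complex_of_real)
    qed
    also have "\<dots> = cmod (g (k - m))" by (simp add: integral_lattice_single)
    finally show ?thesis .
  qed
  have "(\<integral>\<^sup>+ z. complementary \<Phi> (ennreal (cmod (case z of (m, w) \<Rightarrow> stft g (point_mass k) m w) / b)) \<partial>ZT)
     = (\<integral>\<^sup>+ m. \<integral>\<^sup>+ w. complementary \<Phi> (ennreal (cmod (stft g (point_mass k) m w) / b)) \<partial>torus \<partial>lattice)"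
    using stft_measurable[OF point_mass_distribution g, of k] by (subst nn_integral_ZT) auto
  also have "\<dots> \<le> (\<integral>\<^sup>+ m. \<integral>\<^sup>+ w. ennreal (1 / (b\<^sup>2 * L)) * ennreal ((cmod (g (k - m)))\<^sup>2) \<partial>(torus :: (real ^ 'n) measure) \<partial>lattice)"
  proof (intro nn_integral_mono)
    fix m and w :: "real ^ 'n"
    have "complementary \<Phi> (ennreal (cmod (stft g (point_mass k) m w) / b)) \<le> complementary \<Phi> (ennreal (cmod (g (k - m)) / b))"
      using V[of m w] b1 by (intro gauge_mono[OF \<Psi>] ennreal_leI divide_right_mono) auto
    also have "\<dots> \<le> ennreal ((cmod (g (k - m)) / b)\<^sup>2 / L)"
    proof (rule quad)
      have "B / (L * a) \<le> b" using E L by (simp add: b_def)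
      then have "B \<le> L * a * b" using L a by (simp add: pos_divide_le_eq mult_ac)
      then show "cmod (g (k - m)) / b \<le> L * a"
        using B(2)[of "k - m"] b1 by (simp add: pos_divide_le_eq)
      show "0 \<le> cmod (g (k - m)) / b" using b1 by simp
    qed
    also have "(cmod (g (k - m)) / b)\<^sup>2 / L = 1 / (b\<^sup>2 * L) * (cmod (g (k - m)))\<^sup>2"
      by (simp add: power_divide)
    also have "ennreal \<dots> = ennreal (1 / (b\<^sup>2 * L)) * ennreal ((cmod (g (k - m)))\<^sup>2)"
      using L by (intro ennreal_mult) auto
    finally show "complementary \<Phi> (ennreal (cmod (stft g (point_mass k) m w) / b))
        \<le> ennreal (1 / (b\<^sup>2 * L)) * ennreal ((cmod (g (k - m)))\<^sup>2)" .
  qed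
  also have "\<dots> = ennreal (1 / (b\<^sup>2 * L)) * (\<integral>\<^sup>+ m. ennreal ((cmod (g (k - m)))\<^sup>2) \<partial>lattice)"
    by (simp add: prob_space_torus nn_integral_cmult)
  also have "(\<integral>\<^sup>+ m. ennreal ((cmod (g (k - m)))\<^sup>2) \<partial>lattice) = ennreal E"
    using nn_integral_lattice_shift(2)[of "\<lambda>m. ennreal ((cmod (g m))\<^sup>2)" k] by (simp add: window_energy_eq[OF g] E_def)
  also have "ennreal (1 / (b\<^sup>2 * L)) * ennreal E \<le> 1"
  proof -
    have "E / L \<le> b" using B L a by (simp add: b_def)
    also have "b \<le> b\<^sup>2" using b1 by (simp add: power2_eq_square)
    finally have "E \<le> b\<^sup>2 * L" using L by (simp add: pos_divide_le_eq)
    then have "1 / (b\<^sup>2 * L) * E \<le> 1" using L b1 by (simp add: divide_le_eq)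
    then have "ennreal (1 / (b\<^sup>2 * L) * E) \<le> 1" by (metis ennreal_1 ennreal_leI)
    moreover have "ennreal (1 / (b\<^sup>2 * L) * E) = ennreal (1 / (b\<^sup>2 * L)) * ennreal E"
      using L E by (intro ennreal_mult) auto
    ultimately show ?thesis by (simp only:)
  qed
  finally have "modular_le (complementary \<Phi>) g (point_mass k) b"
    using b1 by (simp add: modular_le_def)
  then show ?thesis by (rule mod_spaceI[OF point_mass_distribution])
qed

section \<open>The localization operator\<close>

lemma fourier_series_periodic: "fourier_series a (w + rvec j) = fourier_series a w"
proof -
  have "unit_char (- ((w + rvec j) \<bullet> rvec k)) = unit_char (- (w \<bullet> rvec k))" for k
    using unit_char_periodic[of w j k] by (metis cnj_unit_char)
  then show ?thesis by (simp add: fourier_series_def)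
qed

text \<open>The Bochner integral of a non-integrable function is 0 by default, so the bound holds
  for every f.\<close>

lemma norm_integral_le_nn_integral:
  fixes f :: "'b \<Rightarrow> complex"
  shows "ennreal (cmod (LINT x|M. f x)) \<le> (\<integral>\<^sup>+ x. ennreal (cmod (f x)) \<partial>M)"
proof (cases "integrable M f")
  case True
  then show ?thesis by (rule integral_norm_bound_ennreal)
qed (simp add: not_integrable_integral_eq)

text \<open>The constant is 8 = 2 * 2 * 2: one factor from \<open>young_sum\<close>, one from each
  use of \<open>coefficient_modular\<close>. The first form fits the transform of f with window
  \<open>g1\<close>, the second that of h with window \<open>g2\<close>, where the two spaces
  exchange roles. Both are uniform in m.\<close>

lemma cross_bound:
  fixes p q :: "(int ^ 'n \<Rightarrow> complex) \<Rightarrow> complex"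
  assumes \<Phi>: "gauge \<Phi>" and g: "g \<in> schwartz" and nz: "g k0 \<noteq> 0"
    and p: "p \<in> distributions" "modular_le \<Phi> g p b"
    and q: "q \<in> distributions" "modular_le (complementary \<Phi>) g q c"
  shows "(\<integral>\<^sup>+ k. ennreal (cmod (value_at p k * cnj (value_at q (k - m)))) \<partial>lattice) \<le> ennreal (8 * b * c / (cmod (g k0))\<^sup>2)"
    and "(\<integral>\<^sup>+ k. ennreal (cmod (value_at q k * cnj (value_at p (k - m)))) \<partial>lattice) \<le> ennreal (8 * b * c / (cmod (g k0))\<^sup>2)"
proof -
  define \<gamma> where "\<gamma> = cmod (g k0)"
  have pos: "\<gamma> > 0" "b > 0" "c > 0" using nz p(2) q(2) by (auto simp: \<gamma>_def modular_le_def)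
  have cp: "(\<integral>\<^sup>+ k. \<Phi> (ennreal (\<gamma> / (2 * b) * cmod (value_at p k))) \<partial>lattice) \<le> 1"
    using p(2) unfolding \<gamma>_def modular_le_def by (intro coefficient_modular[OF \<Phi> p(1) g]) auto
  have cq: "(\<integral>\<^sup>+ k. complementary \<Phi> (ennreal (\<gamma> / (2 * c) * cmod (value_at q k))) \<partial>lattice) \<le> 1"
    using q(2) unfolding \<gamma>_def modular_le_def by (intro coefficient_modular[OF complementary_gauge q(1) g]) auto
  have cp': "(\<integral>\<^sup>+ k. \<Phi> (ennreal (\<gamma> / (2 * b) * cmod (value_at p (k - m)))) \<partial>lattice) \<le> 1"
    using cp nn_integral_lattice_shift(1)[of "\<lambda>k. \<Phi> (ennreal (\<gamma> / (2 * b) * cmod (value_at p k)))" m] by simp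
  have cq': "(\<integral>\<^sup>+ k. complementary \<Phi> (ennreal (\<gamma> / (2 * c) * cmod (value_at q (k - m)))) \<partial>lattice) \<le> 1"
    using cq nn_integral_lattice_shift(1)[of "\<lambda>k. complementary \<Phi> (ennreal (\<gamma> / (2 * c) * cmod (value_at q k)))" m] by simp
  have eq: "2 / (\<gamma> / (2 * b) * (\<gamma> / (2 * c))) = 8 * b * c / \<gamma>\<^sup>2"
    using pos by (simp add: power2_eq_square)
  have \<alpha>: "0 < \<gamma> / (2 * b)" "0 < \<gamma> / (2 * c)" using pos by auto
  show "(\<integral>\<^sup>+ k. ennreal (cmod (value_at p k * cnj (value_at q (k - m)))) \<partial>lattice) \<le> ennreal (8 * b * c / (cmod (g k0))\<^sup>2)"
    using young_sum[OF \<alpha> cp cq'] unfolding eq by (simp add: norm_mult \<gamma>_def)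
  show "(\<integral>\<^sup>+ k. ennreal (cmod (value_at q k * cnj (value_at p (k - m)))) \<partial>lattice) \<le> ennreal (8 * b * c / (cmod (g k0))\<^sup>2)"
    using young_sum[OF \<alpha> cp' cq] unfolding eq by (simp add: norm_mult mult.commute \<gamma>_def)
qed

lemma cross_stft:
  fixes p q :: "(int ^ 'n \<Rightarrow> complex) \<Rightarrow> complex"
  assumes K: "(\<integral>\<^sup>+ k. ennreal (cmod (value_at p k * cnj (value_at q (k - m)))) \<partial>lattice) \<le> ennreal K" and "0 \<le> K"
  shows "stft_term q p m w summable_on UNIV"
    and "stft_dist q p m w = fourier_series (\<lambda>k. value_at p k * cnj (value_at q (k - m))) w"
    and "cmod (stft_dist q p m w) \<le> K"
proof -
  have i: "integrable lattice (\<lambda>k. value_at p k * cnj (value_at q (k - m)))"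
    using K by (simp add: integrable_lattice_iff le_less_trans[OF _ ennreal_less_top])
  show "stft_term q p m w summable_on UNIV"
    and eq: "stft_dist q p m w = fourier_series (\<lambda>k. value_at p k * cnj (value_at q (k - m))) w"
    by (rule stft_dist_eq_fourier_series[OF i])+
  have "ennreal (LINT k|lattice. cmod (value_at p k * cnj (value_at q (k - m)))) \<le> ennreal K"
    using K integrable_norm[OF i] by (subst nn_integral_eq_integral[symmetric]) auto
  then have "(LINT k|lattice. cmod (value_at p k * cnj (value_at q (k - m)))) \<le> K"
    using \<open>0 \<le> K\<close> by simp
  then show "cmod (stft_dist q p m w) \<le> K"
    unfolding eq using fourier_series_bound[OF i, of w] by linarith
qed

section \<open>Construction of the image of one f, for fixed admissible bounds\<close>

context
  fixes g0 :: "int ^ 'n \<Rightarrow> complex" and k0 and \<Phi> and \<sigma> :: "int ^ 'n \<Rightarrow> real ^ 'n \<Rightarrow> complex" and g1 g2 f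
    and b1 b2 bf S :: real
  assumes \<Phi>: "gauge \<Phi>" and g0: "g0 \<in> schwartz" and nz: "g0 k0 \<noteq> 0"
    and point_mass: "\<And>k. point_mass k \<in> mod_space g0 (complementary \<Phi>)"
    and \<sigma>m: "(\<lambda>z. \<sigma> (fst z) (snd z)) \<in> borel_measurable ZT"
    and S: "S > 0" "(\<integral>\<^sup>+ z. ennreal (cmod (\<sigma> (fst z) (snd z))) \<partial>ZT) \<le> ennreal S"
    and f: "f \<in> distributions" "modular_le \<Phi> g0 f bf"
    and g1: "g1 \<in> distributions" "modular_le (complementary \<Phi>) g0 g1 b1"
    and g2: "g2 \<in> distributions" "modular_le \<Phi> g0 g2 b2"
begin

text \<open>Bounds \<open>stft_dist g1 f\<close> uniformly. Multiplied by the bound S for the L1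
  norm of \<sigma> it yields \<open>total_mass\<close>, a bound for the L1 norm of
  \<open>weighted_symbol\<close>.\<close>

definition "cross_const = 8 * bf * b1 / (cmod (g0 k0))\<^sup>2"

definition "total_mass = cross_const * S"

definition "weighted_symbol z = \<sigma> (fst z) (snd z) * stft_dist g1 f (fst z) (snd z)"

text \<open>What the weak identity prescribes when tested with the point mass at k, whose transform
  with window \<open>g2\<close> has the complex conjugate of the bracketed factor as its only
  term.\<close>

definition "image_coeff k =
  (LINT z|ZT. weighted_symbol z * (unit_char (snd z \<bullet> rvec k) * value_at g2 (k - fst z)))"

lemma constants_pos: "bf > 0" "b1 > 0" "b2 > 0" "cross_const > 0" "total_mass > 0" "window_energy g0 > 0"
  using f g1 g2 nz S window_energy_pos[OF g0 nz]
  by (auto simp: modular_le_def cross_const_def total_mass_def)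

lemma stft_dist_f:
  shows "stft_term g1 f m w summable_on UNIV"
    and "stft_dist g1 f m w = fourier_series (\<lambda>k. value_at f k * cnj (value_at g1 (k - m))) w"
    and "cmod (stft_dist g1 f m w) \<le> cross_const"
  using cross_stft[OF cross_bound(1)[OF \<Phi> g0 nz f g1, of m]] constants_pos(4)
  by (auto simp: cross_const_def)

lemma weighted_symbol_measurable [measurable]: "weighted_symbol \<in> borel_measurable ZT"
proof -
  have "(\<lambda>z. stft_dist g1 f (fst z) (snd z)) \<in> borel_measurable ZT"
    by (rule measurable_lattice_compose[where f = "stft_dist g1 f" and N = borel])
      (simp_all add: stft_dist_f(2)[abs_def])
  then show ?thesis unfolding weighted_symbol_def[abs_def] by (intro borel_measurable_times \<sigma>m)
qed

lemma weighted_symbol_mass: "(\<integral>\<^sup>+ z. ennreal (cmod (weighted_symbol z)) \<partial>ZT) \<le> ennreal total_mass"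
proof -
  have m: "(\<lambda>z. ennreal (cmod (\<sigma> (fst z) (snd z)))) \<in> borel_measurable ZT"
    using \<sigma>m by measurable
  have "(\<integral>\<^sup>+ z. ennreal (cmod (weighted_symbol z)) \<partial>ZT)
      \<le> (\<integral>\<^sup>+ z. ennreal cross_const * ennreal (cmod (\<sigma> (fst z) (snd z))) \<partial>ZT)"
  proof (rule nn_integral_mono)
    fix z :: "(int ^ 'n) \<times> (real ^ 'n)"
    have "cmod (weighted_symbol z) \<le> cross_const * cmod (\<sigma> (fst z) (snd z))"
      using mult_left_mono[OF stft_dist_f(3)[of "fst z" "snd z"], of "cmod (\<sigma> (fst z) (snd z))"]
      by (simp add: weighted_symbol_def norm_mult mult.commute)
    then show "ennreal (cmod (weighted_symbol z)) \<le> ennreal cross_const * ennreal (cmod (\<sigma> (fst z) (snd z)))"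
      using constants_pos(4) by (simp add: ennreal_leI flip: ennreal_mult)
  qed
  also have "\<dots> = ennreal cross_const * (\<integral>\<^sup>+ z. ennreal (cmod (\<sigma> (fst z) (snd z))) \<partial>ZT)"
    by (rule nn_integral_cmult[OF m])
  also have "\<dots> \<le> ennreal cross_const * ennreal S" by (rule mult_left_mono[OF S(2)]) simp
  also have "\<dots> = ennreal total_mass"
    using constants_pos(4) S(1) by (simp add: total_mass_def ennreal_mult)
  finally show ?thesis .
qed

text \<open>Pairing with the point mass at 0, shifted by k, leaves the single value of
  \<open>g2\<close> at k, and \<open>cross_bound\<close> is uniform in the shift.\<close>

lemma g2_bounded: "\<exists>B\<ge>0. \<forall>k. cmod (value_at g2 k) \<le> B"
proof -
  obtain c where c: "modular_le (complementary \<Phi>) g0 (point_mass 0) c"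
    using mod_spaceD(2)[OF point_mass[of 0]] by blast
  define B where "B = 8 * b2 * c / (cmod (g0 k0))\<^sup>2"
  have B: "0 \<le> B" using c constants_pos(3) by (auto simp: B_def modular_le_def)
  have "cmod (value_at g2 k) \<le> B" for k
  proof -
    have "ennreal (cmod (value_at g2 k)) = (\<integral>\<^sup>+ j. ennreal (cmod (value_at g2 j)) * indicator {k} j \<partial>lattice)"
      by simp
    also have "\<dots> \<le> (\<integral>\<^sup>+ j. ennreal (cmod (value_at g2 j * cnj (value_at (point_mass 0) (j - k)))) \<partial>lattice)"
      by (intro nn_integral_mono) (auto simp: indicator_def value_at_distribution_of)
    also have "\<dots> \<le> ennreal B"
      unfolding B_def by (rule cross_bound(1)[OF \<Phi> g0 nz g2 point_mass_distribution c])
    finally show ?thesis using B by simp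
  qed
  then show ?thesis using B by blast
qed

text \<open>Common to two applications: d a modulated translate of the window \<open>g0\<close>,
  where K comes from boundedness of \<open>g2\<close>, and d the conjugated values of a test element
  h, where K comes from \<open>cross_bound\<close>. The bound K must be uniform in m to survive
  integration against \<open>weighted_symbol\<close>.\<close>

lemma image_exchange:
  fixes d :: "int ^ 'n \<Rightarrow> complex"
  assumes K: "\<And>m. (\<integral>\<^sup>+ k. ennreal (cmod (d k) * cmod (value_at g2 (k - m))) \<partial>lattice) \<le> ennreal K"
  shows "integrable ZT (\<lambda>z. LINT k|lattice. d k * (weighted_symbol z * (unit_char (snd z \<bullet> rvec k) * value_at g2 (k - fst z))))"
    and "(LINT z|ZT. LINT k|lattice. d k * (weighted_symbol z * (unit_char (snd z \<bullet> rvec k) * value_at g2 (k - fst z))))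
      = (LINT k|lattice. d k * image_coeff k)"
proof -
  let ?F = "\<lambda>k z. d k * (weighted_symbol z * (unit_char (snd z \<bullet> rvec k) * value_at g2 (k - fst z)))"
  have g2m: "(\<lambda>z. value_at g2 (k - fst z)) \<in> borel_measurable ZT" for k
    by (rule measurable_compose[OF measurable_ZT_projections(1)]) simp
  have cm: "(\<lambda>z. unit_char (snd z \<bullet> rvec k)) \<in> borel_measurable (ZT :: ((int ^ 'n) \<times> (real ^ 'n)) measure)" for k
    by (rule measurable_compose[OF measurable_ZT_projections(2)]) measurable
  have Fm: "?F k \<in> borel_measurable ZT" for k
    by (intro borel_measurable_times borel_measurable_const weighted_symbol_measurable cm g2m)
  have fin: "(\<integral>\<^sup>+ k. \<integral>\<^sup>+ z. ennreal (cmod (?F k z)) \<partial>ZT \<partial>lattice) < \<infinity>"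
  proof -
    have "(\<integral>\<^sup>+ k. \<integral>\<^sup>+ z. ennreal (cmod (?F k z)) \<partial>ZT \<partial>lattice)
        = (\<integral>\<^sup>+ z. \<integral>\<^sup>+ k. ennreal (cmod (?F k z)) \<partial>lattice \<partial>ZT)"
      by (rule nn_integral_count_space_nn_integral[symmetric], simp) (rule measurable_compose[OF Fm], measurable)
    also have "\<dots> \<le> (\<integral>\<^sup>+ z. ennreal (cmod (weighted_symbol z)) * ennreal K \<partial>ZT)"
    proof (rule nn_integral_mono)
      fix z :: "(int ^ 'n) \<times> (real ^ 'n)"
      have "(\<integral>\<^sup>+ k. ennreal (cmod (?F k z)) \<partial>lattice)
          = (\<integral>\<^sup>+ k. ennreal (cmod (weighted_symbol z)) * ennreal (cmod (d k) * cmod (value_at g2 (k - fst z))) \<partial>lattice)"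
        by (intro nn_integral_cong) (simp add: norm_mult mult_ac flip: ennreal_mult)
      also have "\<dots> = ennreal (cmod (weighted_symbol z)) * (\<integral>\<^sup>+ k. ennreal (cmod (d k) * cmod (value_at g2 (k - fst z))) \<partial>lattice)"
        by (rule nn_integral_cmult) simp
      also have "\<dots> \<le> ennreal (cmod (weighted_symbol z)) * ennreal K"
        by (rule mult_left_mono[OF K]) simp
      finally show "(\<integral>\<^sup>+ k. ennreal (cmod (?F k z)) \<partial>lattice) \<le> ennreal (cmod (weighted_symbol z)) * ennreal K" .
    qed
    also have "\<dots> = (\<integral>\<^sup>+ z. ennreal (cmod (weighted_symbol z)) \<partial>ZT) * ennreal K"
      by (rule nn_integral_multc) measurable
    also have "\<dots> \<le> ennreal total_mass * ennreal K" by (rule mult_right_mono[OF weighted_symbol_mass]) simp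
    also have "\<dots> < \<infinity>" by (simp add: ennreal_mult_less_top)
    finally show ?thesis .
  qed
  show "integrable ZT (\<lambda>z. LINT k|lattice. ?F k z)"
    by (rule integral_lattice_swap(1)[OF sigma_finite_ZT Fm fin])
  have "(LINT z|ZT. LINT k|lattice. ?F k z) = (LINT k|lattice. LINT z|ZT. ?F k z)"
    by (rule integral_lattice_swap(2)[OF sigma_finite_ZT Fm fin])
  also have "\<dots> = (LINT k|lattice. d k * image_coeff k)"
    unfolding image_coeff_def by (simp only: integral_mult_right_zero)
  finally show "(LINT z|ZT. LINT k|lattice. ?F k z) = (LINT k|lattice. d k * image_coeff k)" .
qed

lemma image_coeff_bounded: "\<exists>B. \<forall>k. cmod (image_coeff k) \<le> B"
proof -
  obtain B where B: "0 \<le> B" "\<And>k. cmod (value_at g2 k) \<le> B" using g2_bounded by blast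
  have "cmod (image_coeff k) \<le> total_mass * B" for k
  proof -
    have "ennreal (cmod (image_coeff k))
        \<le> (\<integral>\<^sup>+ z. ennreal (cmod (weighted_symbol z * (unit_char (snd z \<bullet> rvec k) * value_at g2 (k - fst z)))) \<partial>ZT)"
      unfolding image_coeff_def by (rule norm_integral_le_nn_integral)
    also have "\<dots> \<le> (\<integral>\<^sup>+ z. ennreal (cmod (weighted_symbol z)) * ennreal B \<partial>ZT)"
      using B by (intro nn_integral_mono) (simp add: norm_mult mult_left_mono ennreal_leI flip: ennreal_mult)
    also have "\<dots> = (\<integral>\<^sup>+ z. ennreal (cmod (weighted_symbol z)) \<partial>ZT) * ennreal B"
      by (rule nn_integral_multc) measurable
    also have "\<dots> \<le> ennreal total_mass * ennreal B" by (rule mult_right_mono[OF weighted_symbol_mass]) simp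
    also have "\<dots> = ennreal (total_mass * B)" using constants_pos B by (simp add: ennreal_mult)
    finally show ?thesis using constants_pos B by simp
  qed
  then show ?thesis by blast
qed

definition "loc_image = distribution_of (\<lambda>k. image_coeff k / of_real (window_energy g0))"

lemma image_distribution: "loc_image \<in> distributions"
proof -
  obtain B where B: "\<And>k. cmod (image_coeff k) \<le> B" using image_coeff_bounded by blast
  have "cmod (image_coeff k / of_real (window_energy g0)) \<le> B / window_energy g0" for k
    using B[of k] constants_pos(6) by (simp add: norm_divide divide_right_mono)
  then show ?thesis unfolding loc_image_def by (rule distribution_of_bounded)
qed

lemma value_at_image: "value_at loc_image k = image_coeff k / of_real (window_energy g0)"
  unfolding loc_image_def by (rule value_at_distribution_of)

text \<open>Covariance of the transform: translating and modulating \<open>g2\<close> by (m, w)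
  changes its transform by a shift in both variables and a phase of modulus 1.\<close>

lemma stft_image_bound:
  "ennreal (cmod (stft g0 loc_image m' w'))
     \<le> ennreal (1 / window_energy g0)
        * (\<integral>\<^sup>+ z. ennreal (cmod (weighted_symbol z) * cmod (stft g0 g2 (m' - fst z) (w' - snd z))) \<partial>ZT)"
proof -
  obtain B where B: "0 \<le> B" "\<And>k. cmod (value_at g2 k) \<le> B" using g2_bounded by blast
  define d where "d k = cnj (g0 (k - m')) * unit_char (- (w' \<bullet> rvec k))" for k
  define J where "J z = (LINT k|lattice. d k * (weighted_symbol z * (unit_char (snd z \<bullet> rvec k) * value_at g2 (k - fst z))))" for z
  have ig: "integrable lattice (\<lambda>k. g0 (k - m'))" by (rule integrable_schwartz[OF schwartz_translation[OF g0]])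
  define K where "K = enn2real (\<integral>\<^sup>+ k. ennreal (cmod (g0 (k - m'))) \<partial>lattice) * B"
  have K: "(\<integral>\<^sup>+ k. ennreal (cmod (d k) * cmod (value_at g2 (k - m))) \<partial>lattice) \<le> ennreal K" for m
  proof -
    have "(\<integral>\<^sup>+ k. ennreal (cmod (d k) * cmod (value_at g2 (k - m))) \<partial>lattice)
        \<le> (\<integral>\<^sup>+ k. ennreal (cmod (g0 (k - m'))) * ennreal B \<partial>lattice)"
      using B by (intro nn_integral_mono) (simp add: d_def norm_mult mult_left_mono ennreal_leI flip: ennreal_mult)
    also have "\<dots> = (\<integral>\<^sup>+ k. ennreal (cmod (g0 (k - m'))) \<partial>lattice) * ennreal B"
      by (rule nn_integral_multc) simp
    also have "\<dots> = ennreal K"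
      using ig B unfolding K_def integrable_lattice_iff by (subst ennreal_mult) auto
    finally show ?thesis .
  qed
  have J: "cmod (J z) = cmod (weighted_symbol z) * cmod (stft g0 g2 (m' - fst z) (w' - snd z))" for z
  proof -
    define m where "m = fst z"
    define w where "w = snd z"
    have "J z = (LINT k|lattice. weighted_symbol z * (cnj (g0 (k - m')) * unit_char (- ((w' - w) \<bullet> rvec k)) * value_at g2 (k - m)))"
      unfolding J_def
    proof (rule Bochner_Integration.integral_cong[OF refl])
      fix k
      have "unit_char (- ((w' - w) \<bullet> rvec k)) = unit_char (- (w' \<bullet> rvec k)) * unit_char (w \<bullet> rvec k)"
        by (simp add: inner_diff_left flip: unit_char_add)
      then show "d k * (weighted_symbol z * (unit_char (snd z \<bullet> rvec k) * value_at g2 (k - fst z)))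
        = weighted_symbol z * (cnj (g0 (k - m')) * unit_char (- ((w' - w) \<bullet> rvec k)) * value_at g2 (k - m))"
        by (simp add: d_def m_def w_def mult_ac)
    qed
    also have "\<dots> = weighted_symbol z * (LINT k|lattice. cnj (g0 (k - m')) * unit_char (- ((w' - w) \<bullet> rvec k)) * value_at g2 (k - m))"
      by (rule integral_mult_right_zero)
    \<comment> \<open>Substituting k + m for k moves the shift from \<open>g2\<close> to the
      window.\<close>
    also have "(LINT k|lattice. cnj (g0 (k - m')) * unit_char (- ((w' - w) \<bullet> rvec k)) * value_at g2 (k - m))
        = (LINT k|lattice. cnj (g0 (k + m - m')) * unit_char (- ((w' - w) \<bullet> rvec (k + m))) * value_at g2 (k + m - m))"
      by (rule integral_lattice_reflect(2)[symmetric, where f = "\<lambda>k. cnj (g0 (k - m')) * unit_char (- ((w' - w) \<bullet> rvec k)) * value_at g2 (k - m)"])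
    also have "\<dots> = (LINT k|lattice. unit_char (- ((w' - w) \<bullet> rvec m)) * (value_at g2 k * cnj (g0 (k - (m' - m))) * unit_char (- ((w' - w) \<bullet> rvec k))))"
    proof (rule Bochner_Integration.integral_cong[OF refl])
      fix k
      have "unit_char (- ((w' - w) \<bullet> rvec (k + m))) = unit_char (- ((w' - w) \<bullet> rvec m)) * unit_char (- ((w' - w) \<bullet> rvec k))"
      proof -
        have "- ((w' - w) \<bullet> rvec (k + m)) = - ((w' - w) \<bullet> rvec m) + - ((w' - w) \<bullet> rvec k)"
          by (simp add: rvec_add inner_add_right)
        then show ?thesis by (simp only: unit_char_add)
      qed
      moreover have "g0 (k + m - m') = g0 (k - (m' - m))" by (rule arg_cong[where f = g0]) simp
      ultimately show "cnj (g0 (k + m - m')) * unit_char (- ((w' - w) \<bullet> rvec (k + m))) * value_at g2 (k + m - m)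
        = unit_char (- ((w' - w) \<bullet> rvec m)) * (value_at g2 k * cnj (g0 (k - (m' - m))) * unit_char (- ((w' - w) \<bullet> rvec k)))"
        by (simp add: mult_ac)
    qed
    also have "\<dots> = unit_char (- ((w' - w) \<bullet> rvec m)) * stft g0 g2 (m' - m) (w' - w)"
      unfolding stft_eq_fourier_series[OF g2(1) g0] fourier_series_def by (rule integral_mult_right_zero)
    finally show ?thesis by (simp add: norm_mult m_def w_def)
  qed
  have "stft g0 loc_image m' w' = (LINT k|lattice. of_real (1 / window_energy g0) * (d k * image_coeff k))"
    unfolding stft_eq_fourier_series[OF image_distribution g0] fourier_series_def value_at_image d_def
    by (simp add: field_simps)
  also have "\<dots> = of_real (1 / window_energy g0) * (LINT k|lattice. d k * image_coeff k)"
    by (rule integral_mult_right_zero)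
  also have "(LINT k|lattice. d k * image_coeff k) = (LINT z|ZT. J z)"
    unfolding J_def by (rule image_exchange(2)[OF K, symmetric])
  finally have "cmod (stft g0 loc_image m' w') = 1 / window_energy g0 * cmod (LINT z|ZT. J z)"
    using constants_pos(6) by (simp add: norm_divide)
  then have "ennreal (cmod (stft g0 loc_image m' w')) = ennreal (1 / window_energy g0) * ennreal (cmod (LINT z|ZT. J z))"
    using constants_pos(6) by (simp add: ennreal_mult[symmetric])
  also have "\<dots> \<le> ennreal (1 / window_energy g0) * (\<integral>\<^sup>+ z. ennreal (cmod (J z)) \<partial>ZT)"
    by (intro mult_left_mono norm_integral_le_nn_integral) simp
  finally show ?thesis by (simp add: J)
qed

text \<open>In the constant, the 2 is the loss in \<open>weak_jensen\<close>,
  \<open>total_mass\<close> normalizes the measure, \<open>b2\<close> normalizes \<open>g2\<close>,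
  and the energy is the divisor in \<open>loc_image\<close>.\<close>

lemma image_modular: "modular_le \<Phi> g0 loc_image (2 * total_mass * b2 / window_energy g0)"
proof -
  interpret ZTm: sigma_finite_measure "ZT :: ((int ^ 'n) \<times> (real ^ 'n)) measure" by (rule sigma_finite_ZT)
  interpret PP: pair_sigma_finite "ZT :: ((int ^ 'n) \<times> (real ^ 'n)) measure" "ZT :: ((int ^ 'n) \<times> (real ^ 'n)) measure" ..
  note [measurable] = gauge_measurable[OF \<Phi>]
  define c where "c = 2 * total_mass * b2 / window_energy g0"
  have c: "c > 0" using constants_pos by (simp add: c_def)
  define r where "r z = ennreal (cmod (weighted_symbol z) / total_mass)" for z
  have rm [measurable]: "r \<in> borel_measurable ZT" unfolding r_def by measurable
  have r1: "(\<integral>\<^sup>+ z. r z \<partial>ZT) \<le> 1"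
  proof -
    have "(\<integral>\<^sup>+ z. r z \<partial>ZT) = (\<integral>\<^sup>+ z. ennreal (1 / total_mass) * ennreal (cmod (weighted_symbol z)) \<partial>ZT)"
      unfolding r_def using constants_pos(5) by (intro nn_integral_cong) (simp flip: ennreal_mult)
    also have "\<dots> = ennreal (1 / total_mass) * (\<integral>\<^sup>+ z. ennreal (cmod (weighted_symbol z)) \<partial>ZT)"
      by (rule nn_integral_cmult) measurable
    also have "\<dots> \<le> ennreal (1 / total_mass) * ennreal total_mass"
      by (rule mult_left_mono[OF weighted_symbol_mass]) simp
    also have "\<dots> = 1" using constants_pos(5) by (simp flip: ennreal_mult)
    finally show ?thesis .
  qed
  \<comment> \<open>\<open>total_mass\<close> is an upper bound for the mass, so D has mass at most
    1, as \<open>weak_jensen\<close> asks.\<close>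
  define D where "D = density ZT r"
  have D1: "emeasure D (space D) \<le> 1"
    using r1 by (simp add: D_def emeasure_density cong: nn_integral_cong)
  define Q where "Q z' z = cmod (stft g0 g2 (fst z' - fst z) (snd z' - snd z)) / b2" for z' z
  have stm: "stft g0 g2 j \<in> borel_measurable borel" for j
    unfolding stft_eq_fourier_series[OF g2(1) g0, abs_def] by measurable
  have [measurable]: "(\<lambda>x. stft g0 g2 (fst (fst x) - fst (snd x)) (snd (fst x) - snd (snd x))) \<in> borel_measurable (ZT \<Otimes>\<^sub>M ZT)"
    by (rule measurable_lattice_compose[OF stm measurable_lattice_diff]) measurable
  have Qm2 [measurable]: "(\<lambda>x. Q (fst x) (snd x)) \<in> borel_measurable (ZT \<Otimes>\<^sub>M ZT)"
    unfolding Q_def by measurable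
  have Qm [measurable]: "(\<lambda>z. Q z' z) \<in> borel_measurable ZT" "(\<lambda>z. Q z z') \<in> borel_measurable ZT" for z'
  proof -
    have [measurable]: "(\<lambda>z. stft g0 g2 (fst z' - fst z) (snd z' - snd z)) \<in> borel_measurable ZT"
      "(\<lambda>z. stft g0 g2 (fst z - fst z') (snd z - snd z')) \<in> borel_measurable ZT"
      by (rule measurable_lattice_compose[OF stm measurable_lattice_diff]; measurable)+
    show "(\<lambda>z. Q z' z) \<in> borel_measurable ZT" "(\<lambda>z. Q z z') \<in> borel_measurable ZT"
      unfolding Q_def by measurable
  qed
  \<comment> \<open>Gives the finite mean required by \<open>weak_jensen\<close>: the values of
    \<open>g2\<close> are bounded and the window is summable.\<close>
  have Qb: "\<exists>C. \<forall>z' z. Q z' z \<le> C"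
  proof -
    obtain B where B: "0 \<le> B" "\<And>k. cmod (value_at g2 k) \<le> B" using g2_bounded by blast
    define I where "I = (LINT k|lattice. cmod (g0 k))"
    have "cmod (stft g0 g2 j v) \<le> B * I" for j v
    proof -
      have i: "integrable lattice (\<lambda>k. value_at g2 k * cnj (g0 (k - j)))"
        by (rule integrable_translated_window[OF value_at_poly_bounded[OF g2(1)] g0])
      have ig: "integrable lattice (\<lambda>k. cmod (g0 (k - j)))"
        by (intro integrable_norm integrable_schwartz schwartz_translation g0)
      have "cmod (stft g0 g2 j v) \<le> (LINT k|lattice. cmod (value_at g2 k * cnj (g0 (k - j))))"
        unfolding stft_eq_fourier_series[OF g2(1) g0] by (rule fourier_series_bound[OF i])
      also have "\<dots> \<le> (LINT k|lattice. B * cmod (g0 (k - j)))"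
        using B ig by (intro integral_mono integrable_norm[OF i]) (auto simp: norm_mult intro!: mult_right_mono)
      also have "\<dots> = B * (LINT k|lattice. cmod (g0 (k - j)))" by (rule integral_mult_right_zero)
      also have "(LINT k|lattice. cmod (g0 (k - j))) = I"
        unfolding I_def using integral_bij_count_space[OF bij_diff_right[of j], of "\<lambda>k. cmod (g0 k)"] by simp
      finally show ?thesis .
    qed
    then have "Q z' z \<le> B * I / b2" for z' z
      unfolding Q_def using constants_pos(3) by (intro divide_right_mono) auto
    then show ?thesis by blast
  qed
  have point: "\<Phi> (ennreal (cmod (stft g0 loc_image (fst z') (snd z')) / c)) \<le> (\<integral>\<^sup>+ z. r z * \<Phi> (ennreal (Q z' z)) \<partial>ZT)" for z'
  proof -
    have "ennreal (cmod (stft g0 loc_image (fst z') (snd z')) / c) = ennreal (1 / c) * ennreal (cmod (stft g0 loc_image (fst z') (snd z')))"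
      using c by (simp flip: ennreal_mult)
    also have "\<dots> \<le> ennreal (1 / c) * (ennreal (1 / window_energy g0)
        * (\<integral>\<^sup>+ z. ennreal (cmod (weighted_symbol z) * cmod (stft g0 g2 (fst z' - fst z) (snd z' - snd z))) \<partial>ZT))"
      by (rule mult_left_mono[OF stft_image_bound]) simp
    also have "(\<integral>\<^sup>+ z. ennreal (cmod (weighted_symbol z) * cmod (stft g0 g2 (fst z' - fst z) (snd z' - snd z))) \<partial>ZT)
        = (\<integral>\<^sup>+ z. ennreal (total_mass * b2) * (r z * ennreal (Q z' z)) \<partial>ZT)"
      using constants_pos by (intro nn_integral_cong) (simp add: r_def Q_def flip: ennreal_mult)
    also have "\<dots> = ennreal (total_mass * b2) * (\<integral>\<^sup>+ z. r z * ennreal (Q z' z) \<partial>ZT)"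
      by (rule nn_integral_cmult) measurable
    also have "ennreal (1 / c) * (ennreal (1 / window_energy g0) * (ennreal (total_mass * b2) * (\<integral>\<^sup>+ z. r z * ennreal (Q z' z) \<partial>ZT)))
        = ennreal (1 / c * (1 / window_energy g0 * (total_mass * b2))) * (\<integral>\<^sup>+ z. r z * ennreal (Q z' z) \<partial>ZT)"
    proof -
      have "ennreal x * (ennreal y * (ennreal v * q)) = ennreal (x * (y * v)) * q"
        if "0 \<le> x" "0 \<le> y" "0 \<le> v" for x y v q
        using that by (simp add: ennreal_mult mult.assoc)
      then show ?thesis using c constants_pos by simp
    qed
    also have "1 / c * (1 / window_energy g0 * (total_mass * b2)) = 1 / 2"
      using constants_pos by (simp add: c_def)
    also have "ennreal (1 / 2) * (\<integral>\<^sup>+ z. r z * ennreal (Q z' z) \<partial>ZT) = (\<integral>\<^sup>+ z. ennreal (Q z' z) \<partial>D) / 2"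
    proof -
      have "(\<integral>\<^sup>+ z. ennreal (Q z' z) \<partial>D) = (\<integral>\<^sup>+ z. r z * ennreal (Q z' z) \<partial>ZT)"
        unfolding D_def by (rule nn_integral_density) measurable
      moreover have "ennreal (1 / 2) * y = y / 2" for y
        using divide_ennreal[of 1 2] by (simp add: divide_ennreal_def mult.commute)
      ultimately show ?thesis by simp
    qed
    finally have "\<Phi> (ennreal (cmod (stft g0 loc_image (fst z') (snd z')) / c)) \<le> \<Phi> ((\<integral>\<^sup>+ z. ennreal (Q z' z) \<partial>D) / 2)"
      by (rule gauge_mono[OF \<Phi>])
    also have "\<dots> \<le> (\<integral>\<^sup>+ z. \<Phi> (ennreal (Q z' z)) \<partial>D)"
    proof (rule weak_jensen[OF \<Phi> _ _ D1])
      show "(\<lambda>z. ennreal (Q z' z)) \<in> borel_measurable D" unfolding D_def by measurable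
      show "ennreal (Q z' z) < \<infinity>" for z by simp
      obtain C where C: "\<And>z' z. Q z' z \<le> C" using Qb by blast
      have "(\<integral>\<^sup>+ z. ennreal (Q z' z) \<partial>D) \<le> (\<integral>\<^sup>+ z. ennreal C \<partial>D)"
        by (intro nn_integral_mono ennreal_leI C)
      also have "\<dots> = ennreal C * emeasure D (space D)" by simp
      also have "\<dots> \<le> ennreal C * 1" by (rule mult_left_mono[OF D1]) simp
      also have "\<dots> < \<infinity>" by simp
      finally show "(\<integral>\<^sup>+ z. ennreal (Q z' z) \<partial>D) < \<infinity>" .
    qed
    also have "\<dots> = (\<integral>\<^sup>+ z. r z * \<Phi> (ennreal (Q z' z)) \<partial>ZT)"
      unfolding D_def by (rule nn_integral_density) measurable
    finally show ?thesis .
  qed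
  \<comment> \<open>The transform of \<open>g2\<close> is periodic in its second variable, so
    shifting both variables does not change its modular. Admissibility of \<open>b2\<close> enters
    here.\<close>
  have shift: "(\<integral>\<^sup>+ z'. \<Phi> (ennreal (Q z' z)) \<partial>ZT) \<le> 1" for z
  proof -
    have per: "\<Phi> (ennreal (cmod (stft g0 g2 j (w + rvec k)) / b2)) = \<Phi> (ennreal (cmod (stft g0 g2 j w) / b2))" for j w k
      by (simp add: stft_eq_fourier_series[OF g2(1) g0] fourier_series_periodic)
    note [measurable] = stm
    have "(\<integral>\<^sup>+ z'. \<Phi> (ennreal (Q z' z)) \<partial>ZT) = (\<integral>\<^sup>+ m. \<integral>\<^sup>+ w. \<Phi> (ennreal (cmod (stft g0 g2 (m - fst z) (w + (- snd z))) / b2)) \<partial>torus \<partial>lattice)"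
    proof -
      have "(\<lambda>z'. \<Phi> (ennreal (Q z' z))) \<in> borel_measurable ZT" by measurable
      from nn_integral_ZT[OF this] show ?thesis by (simp add: Q_def)
    qed
    also have "\<dots> = (\<integral>\<^sup>+ m. \<integral>\<^sup>+ w. \<Phi> (ennreal (cmod (stft g0 g2 (m - fst z) w) / b2)) \<partial>torus \<partial>lattice)"
      by (intro nn_integral_cong nn_integral_torus_shift per) measurable
    also have "\<dots> = (\<integral>\<^sup>+ m. \<integral>\<^sup>+ w. \<Phi> (ennreal (cmod (stft g0 g2 m w) / b2)) \<partial>torus \<partial>lattice)"
      by (rule nn_integral_lattice_shift)
    also have "\<dots> = (\<integral>\<^sup>+ z. \<Phi> (ennreal (cmod (case z of (m, w) \<Rightarrow> stft g0 g2 m w) / b2)) \<partial>ZT)"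
      using stft_measurable[OF g2(1) g0] by (subst nn_integral_ZT) auto
    also have "\<dots> \<le> 1" using g2(2) by (simp add: modular_le_def)
    finally show ?thesis .
  qed
  have "(\<integral>\<^sup>+ z'. \<Phi> (ennreal (cmod (case z' of (m, w) \<Rightarrow> stft g0 loc_image m w) / c)) \<partial>ZT)
      \<le> (\<integral>\<^sup>+ z'. \<integral>\<^sup>+ z. r z * \<Phi> (ennreal (Q z' z)) \<partial>ZT \<partial>ZT)"
    by (rule nn_integral_mono) (use point in \<open>simp add: case_prod_beta'\<close>)
  also have "\<dots> = (\<integral>\<^sup>+ z. \<integral>\<^sup>+ z'. r z * \<Phi> (ennreal (Q z' z)) \<partial>ZT \<partial>ZT)"
  proof -
    have "(\<lambda>(z', z). r z * \<Phi> (ennreal (Q z' z))) \<in> borel_measurable (ZT \<Otimes>\<^sub>M ZT)"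
      unfolding case_prod_beta' by measurable
    from PP.Fubini'[OF this] show ?thesis by simp
  qed
  also have "\<dots> \<le> (\<integral>\<^sup>+ z. r z \<partial>ZT)"
  proof (rule nn_integral_mono)
    fix z
    have "(\<integral>\<^sup>+ z'. r z * \<Phi> (ennreal (Q z' z)) \<partial>ZT) = r z * (\<integral>\<^sup>+ z'. \<Phi> (ennreal (Q z' z)) \<partial>ZT)"
      by (rule nn_integral_cmult) measurable
    also have "\<dots> \<le> r z * 1" by (rule mult_left_mono[OF shift]) simp
    finally show "(\<integral>\<^sup>+ z'. r z * \<Phi> (ennreal (Q z' z)) \<partial>ZT) \<le> r z" by simp
  qed
  also note r1
  finally show ?thesis using c unfolding modular_le_def c_def[symmetric] by blast
qed

lemma loc_integrand_eq:
  assumes h: "h \<in> distributions" "modular_le (complementary \<Phi>) g0 h bh"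
  shows "stft_term g2 h m w summable_on UNIV"
    and "loc_integrand \<sigma> g1 g2 f h z
      = (LINT k|lattice. cnj (value_at h k) * (weighted_symbol z * (unit_char (snd z \<bullet> rvec k) * value_at g2 (k - fst z))))"
proof -
  have K: "0 \<le> 8 * b2 * bh / (cmod (g0 k0))\<^sup>2"
    using h(2) constants_pos by (auto simp: modular_le_def)
  note cs = cross_stft[OF cross_bound(2)[OF \<Phi> g0 nz g2 h] K]
  show "stft_term g2 h m w summable_on UNIV" by (rule cs)
  have "cnj (stft_dist g2 h (fst z) (snd z))
      = (LINT k|lattice. cnj (value_at h k * cnj (value_at g2 (k - fst z)) * unit_char (- (snd z \<bullet> rvec k))))"
    unfolding cs(2) fourier_series_def by (rule Bochner_Integration.integral_cnj[symmetric])
  also have "\<dots> = (LINT k|lattice. cnj (value_at h k) * (unit_char (snd z \<bullet> rvec k) * value_at g2 (k - fst z)))"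
    by (simp add: cnj_unit_char mult_ac)
  finally have "weighted_symbol z * cnj (stft_dist g2 h (fst z) (snd z))
      = (LINT k|lattice. weighted_symbol z * (cnj (value_at h k) * (unit_char (snd z \<bullet> rvec k) * value_at g2 (k - fst z))))"
    by (simp only: integral_mult_right_zero)
  then show "loc_integrand \<sigma> g1 g2 f h z
      = (LINT k|lattice. cnj (value_at h k) * (weighted_symbol z * (unit_char (snd z \<bullet> rvec k) * value_at g2 (k - fst z))))"
    by (simp add: loc_integrand_def weighted_symbol_def case_prod_beta' mult_ac)
qed

text \<open>Both sides equal the sum of the image coefficients against the conjugated values of h:
  the right-hand one by \<open>image_exchange\<close>, the left-hand one by
  \<open>duality_formula\<close>, whose energy factor cancels the divisor in
  \<open>loc_image\<close>.\<close>

lemma image_weak_loc_image: "weak_loc_image g0 \<Phi> (complementary \<Phi>) \<sigma> g1 g2 f loc_image"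
  unfolding weak_loc_image_def
proof (intro conjI allI ballI)
  show "loc_image \<in> mod_space g0 \<Phi>" by (rule mod_spaceI[OF image_distribution image_modular])
  show "stft_term g1 f m w summable_on UNIV" for m w by (rule stft_dist_f)
  fix h assume "h \<in> mod_space g0 (complementary \<Phi>)"
  then obtain bh where h: "h \<in> distributions" "modular_le (complementary \<Phi>) g0 h bh"
    using mod_spaceD by blast
  show "stft_term g2 h m w summable_on UNIV" for m w by (rule loc_integrand_eq(1)[OF h])
  show "integrable ZT (duality_integrand g0 loc_image h)"
    by (rule duality_formula(1)[OF \<Phi> g0 nz image_distribution image_modular h])
  have K: "(\<integral>\<^sup>+ k. ennreal (cmod (cnj (value_at h k)) * cmod (value_at g2 (k - m))) \<partial>lattice)
      \<le> ennreal (8 * b2 * bh / (cmod (g0 k0))\<^sup>2)" for m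
    using cross_bound(2)[OF \<Phi> g0 nz g2 h, of m] by (simp add: norm_mult)
  note loc = loc_integrand_eq(2)[OF h, abs_def]
  show "integrable ZT (loc_integrand \<sigma> g1 g2 f h)"
    unfolding loc by (rule image_exchange(1)[OF K])
  have "(LINT z|ZT. loc_integrand \<sigma> g1 g2 f h z) = (LINT k|lattice. cnj (value_at h k) * image_coeff k)"
    unfolding loc by (rule image_exchange(2)[OF K])
  also have "\<dots> = (LINT k|lattice. of_real (window_energy g0) * (value_at loc_image k * cnj (value_at h k)))"
    using constants_pos(6) by (simp add: value_at_image mult_ac)
  also have "\<dots> = of_real (window_energy g0) * (LINT k|lattice. value_at loc_image k * cnj (value_at h k))"
    by (rule integral_mult_right_zero)
  also have "\<dots> = (LINT z|ZT. duality_integrand g0 loc_image h z)"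
    by (rule duality_formula(2)[OF \<Phi> g0 nz image_distribution image_modular h, symmetric])
  finally show "(LINT z|ZT. duality_integrand g0 loc_image h z) = (LINT z|ZT. loc_integrand \<sigma> g1 g2 f h z)" by simp
qed

text \<open>Here 16 = 2 * 8, from \<open>image_modular\<close> and \<open>cross_const\<close>. The
  factor depending on the window is separated from the four bounds, in which the estimate is
  multiplicative.\<close>

lemma weak_loc_image_exists:
  "\<exists>u. weak_loc_image g0 \<Phi> (complementary \<Phi>) \<sigma> g1 g2 f u \<and>
     mod_norm g0 \<Phi> u \<le> ennreal (16 / ((cmod (g0 k0))\<^sup>2 * window_energy g0) * S * b1 * b2 * bf)"
proof -
  have "2 * total_mass * b2 / window_energy g0 = 16 / ((cmod (g0 k0))\<^sup>2 * window_energy g0) * S * b1 * b2 * bf"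
    by (simp add: total_mass_def cross_const_def)
  then show ?thesis using image_weak_loc_image mod_norm_le[OF image_modular] by auto
qed

end

text \<open>The pairing with the point mass at k collapses to the value at k. All values of a weak
  image are thus determined by f, which yields both uniqueness and linearity.\<close>

lemma weak_loc_image_value:
  assumes \<Phi>: "gauge \<Phi>" and g0: "g0 \<in> schwartz" and nz: "g0 k0 \<noteq> 0"
    and point_mass: "\<And>k. point_mass k \<in> mod_space g0 (complementary \<Phi>)"
    and u: "weak_loc_image g0 \<Phi> (complementary \<Phi>) \<sigma> g1 g2 f u"
  shows "of_real (window_energy g0) * value_at u k = (LINT z|ZT. loc_integrand \<sigma> g1 g2 f (point_mass k) z)"
proof -
  have "u \<in> mod_space g0 \<Phi>" using u by (simp add: weak_loc_image_def)
  then obtain b where b: "u \<in> distributions" "modular_le \<Phi> g0 u b" using mod_spaceD by blast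
  obtain c where c: "modular_le (complementary \<Phi>) g0 (point_mass k) c" using mod_spaceD(2)[OF point_mass] by blast
  have "(LINT j|lattice. value_at u j * cnj (value_at (point_mass k) j)) = (LINT j|lattice. value_at u j * indicator {k} j)"
    by (rule Bochner_Integration.integral_cong) (auto simp: value_at_distribution_of indicator_def)
  then have "of_real (window_energy g0) * value_at u k = (LINT z|ZT. duality_integrand g0 u (point_mass k) z)"
    using duality_formula(2)[OF \<Phi> g0 nz b point_mass_distribution c] by (simp add: integral_lattice_single)
  also have "\<dots> = (LINT z|ZT. loc_integrand \<sigma> g1 g2 f (point_mass k) z)"
    using u point_mass[of k] unfolding weak_loc_image_def by blast
  finally show ?thesis .
qed

lemma weak_loc_image_unique:
  assumes \<Phi>: "gauge \<Phi>" and g0: "g0 \<in> schwartz" and nz: "g0 k0 \<noteq> 0"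
    and point_mass: "\<And>k. point_mass k \<in> mod_space g0 (complementary \<Phi>)"
    and u: "weak_loc_image g0 \<Phi> (complementary \<Phi>) \<sigma> g1 g2 f u"
    and v: "weak_loc_image g0 \<Phi> (complementary \<Phi>) \<sigma> g1 g2 f v"
  shows "u = v"
proof (rule distribution_eqI)
  show "u \<in> distributions" "v \<in> distributions"
    using u v by (simp_all add: weak_loc_image_def mod_space_def)
  fix k
  have "of_real (window_energy g0) * value_at u k = of_real (window_energy g0) * value_at v k"
    using weak_loc_image_value[OF \<Phi> g0 nz point_mass u] weak_loc_image_value[OF \<Phi> g0 nz point_mass v] by simp
  then show "value_at u k = value_at v k" using window_energy_pos[OF g0 nz] by simp
qed

text \<open>The convergence clauses of \<open>weak_loc_image\<close> make the series and the
  integrals additive in f, so the values of both sides agree at every k.\<close>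

lemma weak_loc_image_linear:
  assumes \<Phi>: "gauge \<Phi>" and g0: "g0 \<in> schwartz" and nz: "g0 k0 \<noteq> 0"
    and point_mass: "\<And>k. point_mass k \<in> mod_space g0 (complementary \<Phi>)"
    and u: "weak_loc_image g0 \<Phi> (complementary \<Phi>) \<sigma> g1 g2 f u"
    and v: "weak_loc_image g0 \<Phi> (complementary \<Phi>) \<sigma> g1 g2 h v"
    and w: "weak_loc_image g0 \<Phi> (complementary \<Phi>) \<sigma> g1 g2 (\<lambda>\<phi>. a * f \<phi> + b * h \<phi>) w"
  shows "w = (\<lambda>\<phi>. a * u \<phi> + b * v \<phi>)"
proof (rule distribution_eqI)
  show "w \<in> distributions" "(\<lambda>\<phi>. a * u \<phi> + b * v \<phi>) \<in> distributions"
    using u v w by (auto simp: weak_loc_image_def mod_space_def intro: distributions_linear)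
  fix k
  have sf: "stft_term g1 f m y summable_on UNIV" and sh: "stft_term g1 h m y summable_on UNIV" for m y
    using u v by (simp_all add: weak_loc_image_def)
  have "stft_dist g1 (\<lambda>\<phi>. a * f \<phi> + b * h \<phi>) m y = a * stft_dist g1 f m y + b * stft_dist g1 h m y" for m y
  proof -
    have "stft_term g1 (\<lambda>\<phi>. a * f \<phi> + b * h \<phi>) m y = (\<lambda>j. a * stft_term g1 f m y j + b * stft_term g1 h m y j)"
      by (simp add: fun_eq_iff stft_term_def value_at_linear algebra_simps)
    moreover have "infsum (\<lambda>j. a * stft_term g1 f m y j + b * stft_term g1 h m y j) UNIV
        = infsum (\<lambda>j. a * stft_term g1 f m y j) UNIV + infsum (\<lambda>j. b * stft_term g1 h m y j) UNIV"
      by (intro infsum_add summable_on_cmult_right sf sh)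
    ultimately show ?thesis
      by (simp add: stft_dist_def infsum_cmult_right[OF sf] infsum_cmult_right[OF sh])
  qed
  then have loc: "loc_integrand \<sigma> g1 g2 (\<lambda>\<phi>. a * f \<phi> + b * h \<phi>) (point_mass k) z
      = a * loc_integrand \<sigma> g1 g2 f (point_mass k) z + b * loc_integrand \<sigma> g1 g2 h (point_mass k) z" for z
    by (cases z) (simp add: loc_integrand_def algebra_simps)
  have i: "integrable ZT (loc_integrand \<sigma> g1 g2 f (point_mass k))"
    "integrable ZT (loc_integrand \<sigma> g1 g2 h (point_mass k))"
    using u v point_mass[of k] unfolding weak_loc_image_def by blast+
  have "of_real (window_energy g0) * value_at w k
      = a * (LINT z|ZT. loc_integrand \<sigma> g1 g2 f (point_mass k) z) + b * (LINT z|ZT. loc_integrand \<sigma> g1 g2 h (point_mass k) z)"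
    unfolding weak_loc_image_value[OF \<Phi> g0 nz point_mass w] loc using i by simp
  also have "\<dots> = of_real (window_energy g0) * (a * value_at u k + b * value_at v k)"
    unfolding weak_loc_image_value[OF \<Phi> g0 nz point_mass u, symmetric] weak_loc_image_value[OF \<Phi> g0 nz point_mass v, symmetric]
    by (simp add: algebra_simps)
  finally show "value_at w k = value_at (\<lambda>\<phi>. a * u \<phi> + b * v \<phi>) k"
    using window_energy_pos[OF g0 nz] by (simp add: value_at_linear)
qed

text \<open>Admissible bounds only approach the norms, so each factor carries an \<epsilon>; the
  product is continuous as \<epsilon> tends to 0 from the right.\<close>

lemma le_ennreal_product_limit:
  fixes x :: ennreal and c s p q r :: real
  assumes "\<And>\<epsilon>. \<epsilon> > 0 \<Longrightarrow> x \<le> ennreal (c * (s + \<epsilon>) * (p + \<epsilon>) * (q + \<epsilon>) * (r + \<epsilon>))"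
  shows "x \<le> ennreal (c * s * p * q * r)"
proof (rule tendsto_lowerbound)
  have "((\<lambda>\<epsilon>. c * (s + \<epsilon>) * (p + \<epsilon>) * (q + \<epsilon>) * (r + \<epsilon>)) \<longlongrightarrow> c * (s + 0) * (p + 0) * (q + 0) * (r + 0)) (at_right 0)"
    by (intro tendsto_intros)
  then show "((\<lambda>\<epsilon>. ennreal (c * (s + \<epsilon>) * (p + \<epsilon>) * (q + \<epsilon>) * (r + \<epsilon>))) \<longlongrightarrow> ennreal (c * s * p * q * r)) (at_right 0)"
    by (intro tendsto_ennrealI) simp
  show "eventually (\<lambda>\<epsilon>. x \<le> ennreal (c * (s + \<epsilon>) * (p + \<epsilon>) * (q + \<epsilon>) * (r + \<epsilon>))) (at_right 0)"
    using eventually_at_right_less[of 0] by eventually_elim (rule assms)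
qed simp

lemma ex_modular_le_near_norm:
  assumes "mod_norm g Y f < \<infinity>" "\<epsilon> > 0"
  shows "\<exists>b. modular_le Y g f b \<and> b \<le> enn2real (mod_norm g Y f) + \<epsilon>"
proof -
  define p where "p = enn2real (mod_norm g Y f)"
  have p: "mod_norm g Y f = ennreal p" "0 \<le> p" using assms by (auto simp: p_def)
  have "mod_norm g Y f < ennreal (p + \<epsilon>)" using p assms(2) by (simp add: ennreal_less_iff)
  then obtain b where "modular_le Y g f b" "ennreal b < ennreal (p + \<epsilon>)" using mod_norm_lessD by blast
  then have "b \<le> p + \<epsilon>" by (metis ennreal_leI linorder_not_less order_less_imp_le)
  then show ?thesis using \<open>modular_le Y g f b\<close> by (auto simp: p_def)
qed

theorem proposition4p10:
  fixes g0 :: "int ^ 'n \<Rightarrow> complex" and G :: "int ^ 'n \<Rightarrow> real ^ 'n \<Rightarrow> complex"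
  assumes "g0 \<in> schwartz" and "\<exists>k. g0 k \<noteq> 0"
    and "G \<in> schwartz_ZT" and "\<exists>k y. G k y \<noteq> 0"
  shows "\<exists>c::real. c > 0 \<and>
    (\<forall>\<Phi> \<Psi> a \<sigma> g1 g2.
      complementary_young_pair \<Phi> \<Psi> \<longrightarrow>
      local_Delta2 \<Phi> \<longrightarrow>
      continuous_on UNIV \<Phi> \<longrightarrow>
      0 < a \<and> a \<le> exp (- 2 / 3) \<and>
        (\<forall>x\<in>{0..a}. \<Phi> (ennreal x) = ennreal (- (x ^ 2) * ln x)) \<longrightarrow>
      \<sigma> \<in> M1_space (\<lambda>k y. complex_of_real c * G k y) \<longrightarrow>
      g1 \<in> mod_space g0 \<Psi> \<longrightarrow>
      g2 \<in> mod_space g0 \<Phi> \<longrightarrow>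
        (\<forall>f\<in>mod_space g0 \<Phi>. \<exists>!u. weak_loc_image g0 \<Phi> \<Psi> \<sigma> g1 g2 f u) \<and>
        bounded_linear_on_mod_space g0 \<Phi> (loc_op g0 \<Phi> \<Psi> \<sigma> g1 g2) \<and>
        op_norm g0 \<Phi> (loc_op g0 \<Phi> \<Psi> \<sigma> g1 g2)
          \<le> M1_norm (\<lambda>k y. complex_of_real c * G k y) \<sigma> * mod_norm g0 \<Psi> g1 * mod_norm g0 \<Phi> g2)"
proof -
  obtain k0 where nz: "g0 k0 \<noteq> 0" using assms(2) by blast
  obtain kG yG where nzG: "G kG yG \<noteq> 0" using assms(4) by blast
  note g0 = assms(1) and G = assms(3)
  \<comment> \<open>The constant of \<open>weak_loc_image_exists\<close>, relative to the L1 norm of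
    \<sigma>.\<close>
  define A where "A = 16 / ((cmod (g0 k0))\<^sup>2 * window_energy g0)"
  have A: "A > 0" using nz window_energy_pos[OF g0 nz] by (simp add: A_def)
  define n1 where "n1 = enn2real (\<integral>\<^sup>+ z. ennreal (cmod (G (fst z) (snd z)) ^ 1) \<partial>ZT)"
  define n2 where "n2 = enn2real (\<integral>\<^sup>+ z. ennreal (cmod (G (fst z) (snd z)) ^ 2) \<partial>ZT)"
  have n1: "n1 > 0" "(\<integral>\<^sup>+ z. ennreal (cmod (G (fst z) (snd z)) ^ 1) \<partial>ZT) = ennreal n1"
    using window_norms[OF G nzG, of 1] unfolding n1_def by (auto simp: enn2real_positive_iff less_top)
  have n2: "n2 > 0" "(\<integral>\<^sup>+ z. ennreal (cmod (G (fst z) (snd z)) ^ 2) \<partial>ZT) = ennreal n2"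
    using window_norms[OF G nzG, of 2] unfolding n2_def by (auto simp: enn2real_positive_iff less_top)
  \<comment> \<open>The quotient \<open>n1 / n2\<close> bounds the L1 norm by the M1 norm for the
    window \<open>G\<close>. Passing to the window c G multiplies the M1 norm by exactly this c,
    which leaves the constant 1.\<close>
  define c where "c = A * (n1 / n2)"
  have c: "c > 0" using A n1 n2 by (simp add: c_def)
  show ?thesis
  proof (intro exI[of _ c] conjI[OF c] allI impI)
    fix \<Phi> \<Psi> :: "ennreal \<Rightarrow> ennreal" and a :: real and \<sigma> :: "int ^ 'n \<Rightarrow> real ^ 'n \<Rightarrow> complex"
      and g1 g2 :: "(int ^ 'n \<Rightarrow> complex) \<Rightarrow> complex"
    assume pair: "complementary_young_pair \<Phi> \<Psi>"
      and log: "0 < a \<and> a \<le> exp (- 2 / 3) \<and> (\<forall>x\<in>{0..a}. \<Phi> (ennreal x) = ennreal (- (x ^ 2) * ln x))"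
      and \<sigma>: "\<sigma> \<in> M1_space (\<lambda>k y. complex_of_real c * G k y)"
      and g1: "g1 \<in> mod_space g0 \<Psi>" and g2: "g2 \<in> mod_space g0 \<Phi>"
    have \<Psi>: "\<Psi> = complementary \<Phi>" and \<Phi>: "gauge \<Phi>"
      using pair young_gauge by (auto simp: complementary_young_pair_def)
    have point_mass: "point_mass k \<in> mod_space g0 (complementary \<Phi>)" for k
      by (rule point_mass_in_dual[OF \<Phi> g0, of a]) (use log in auto)
    have temp: "\<sigma> \<in> tempered_functions" and fin: "M1_norm (\<lambda>k y. complex_of_real c * G k y) \<sigma> < \<infinity>"
      using \<sigma> by (auto simp: M1_space_def)
    have M1c: "M1_norm (\<lambda>k y. complex_of_real c * G k y) \<sigma> = ennreal c * M1_norm G \<sigma>"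
      by (rule M1_norm_cmult[OF G temp c])
    define s where "s = enn2real (M1_norm G \<sigma>)"
    have s: "M1_norm G \<sigma> = ennreal s" "0 \<le> s"
      using fin c unfolding M1c s_def by (auto simp: ennreal_mult_less_top)
    have \<sigma>m: "(\<lambda>z. \<sigma> (fst z) (snd z)) \<in> borel_measurable ZT"
      using temp by (simp add: tempered_functions_def case_prod_beta')
    have L1: "(\<integral>\<^sup>+ z. ennreal (cmod (\<sigma> (fst z) (snd z))) \<partial>ZT) \<le> ennreal (n1 / n2 * s)"
    proof -
      let ?I = "\<integral>\<^sup>+ z. ennreal (cmod (\<sigma> (fst z) (snd z))) \<partial>ZT"
      have "ennreal n2 * ?I \<le> ennreal n1 * ennreal s"
        using M1_controls_L1[OF G temp nzG] unfolding n1(2) n2(2) s(1) .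
      then have "ennreal (1 / n2) * (ennreal n2 * ?I) \<le> ennreal (1 / n2) * (ennreal n1 * ennreal s)"
        by (rule mult_left_mono) simp
      moreover have "ennreal (1 / n2) * (ennreal n2 * ?I) = ?I"
        using n2(1) by (simp add: mult.assoc[symmetric] ennreal_mult[symmetric])
      moreover have "ennreal (1 / n2) * (ennreal n1 * ennreal s) = ennreal (n1 / n2 * s)"
        using n1(1) n2(1) s(2) by (simp add: ennreal_mult[symmetric])
      ultimately show ?thesis by simp
    qed
    define p q where "p = enn2real (mod_norm g0 \<Psi> g1)" and "q = enn2real (mod_norm g0 \<Phi> g2)"
    have pq: "mod_norm g0 \<Psi> g1 = ennreal p" "0 \<le> p" "mod_norm g0 \<Phi> g2 = ennreal q" "0 \<le> q"
      using g1 g2 by (auto simp: p_def q_def mod_space_def)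
    note unique = weak_loc_image_unique[OF \<Phi> g0 nz point_mass]
    have near: "\<exists>u. weak_loc_image g0 \<Phi> (complementary \<Phi>) \<sigma> g1 g2 f u \<and>
        mod_norm g0 \<Phi> u \<le> ennreal (c * (s + \<epsilon>) * (p + \<epsilon>) * (q + \<epsilon>) * (enn2real (mod_norm g0 \<Phi> f) + \<epsilon>))"
      if f: "f \<in> mod_space g0 \<Phi>" and \<epsilon>: "\<epsilon> > 0" for f \<epsilon>
    proof -
      have "mod_norm g0 \<Phi> f < \<infinity>" "mod_norm g0 \<Psi> g1 < \<infinity>" "mod_norm g0 \<Phi> g2 < \<infinity>"
        using f g1 g2 by (auto simp: mod_space_def)
      then obtain bf b1 b2
        where bf: "modular_le \<Phi> g0 f bf" "bf \<le> enn2real (mod_norm g0 \<Phi> f) + \<epsilon>"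
          and b1: "modular_le (complementary \<Phi>) g0 g1 b1" "b1 \<le> p + \<epsilon>"
          and b2: "modular_le \<Phi> g0 g2 b2" "b2 \<le> q + \<epsilon>"
        using ex_modular_le_near_norm[OF _ \<epsilon>] unfolding p_def q_def \<Psi> by metis
      have pos: "bf > 0" "b1 > 0" "b2 > 0" using bf b1 b2 by (auto simp: modular_le_def)
      \<comment> \<open>A strictly positive bound on the L1 norm of \<sigma> is asked for; adding
        \<epsilon> provides one also when s = 0.\<close>
      have S: "n1 / n2 * (s + \<epsilon>) > 0" using n1 n2 s \<epsilon> by simp
      have "(\<integral>\<^sup>+ z. ennreal (cmod (\<sigma> (fst z) (snd z))) \<partial>ZT) \<le> ennreal (n1 / n2 * (s + \<epsilon>))"
        using n1 n2 \<epsilon> by (intro order_trans[OF L1] ennreal_leI mult_left_mono) auto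
      from weak_loc_image_exists[OF \<Phi> g0 nz point_mass \<sigma>m S this mod_spaceD(1)[OF f] bf(1)
        mod_spaceD(1)[OF g1] b1(1) mod_spaceD(1)[OF g2] b2(1)]
      obtain u where u: "weak_loc_image g0 \<Phi> (complementary \<Phi>) \<sigma> g1 g2 f u"
        "mod_norm g0 \<Phi> u \<le> ennreal (A * (n1 / n2 * (s + \<epsilon>)) * b1 * b2 * bf)"
        unfolding A_def by blast
      have "A * (n1 / n2 * (s + \<epsilon>)) * b1 * b2 * bf
          \<le> c * (s + \<epsilon>) * (p + \<epsilon>) * (q + \<epsilon>) * (enn2real (mod_norm g0 \<Phi> f) + \<epsilon>)"
        unfolding c_def mult.assoc[of A "n1 / n2", symmetric] mult.assoc[of "A * (n1 / n2)" "s + \<epsilon>"]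
        using A S pos bf(2) b1(2) b2(2) n1 n2 s pq \<epsilon>
        by (intro mult_mono mult_nonneg_nonneg) auto
      then show ?thesis using u by (blast intro: order_trans ennreal_leI)
    qed
    have ex1: "\<exists>!u. weak_loc_image g0 \<Phi> \<Psi> \<sigma> g1 g2 f u" if f: "f \<in> mod_space g0 \<Phi>" for f
      unfolding \<Psi> using near[OF f zero_less_one] unique by blast
    have op: "weak_loc_image g0 \<Phi> \<Psi> \<sigma> g1 g2 f (loc_op g0 \<Phi> \<Psi> \<sigma> g1 g2 f)" if "f \<in> mod_space g0 \<Phi>" for f
      unfolding loc_op_def by (rule theI'[OF ex1[OF that]])
    have bound: "mod_norm g0 \<Phi> (loc_op g0 \<Phi> \<Psi> \<sigma> g1 g2 f) \<le> ennreal (c * s * p * q) * mod_norm g0 \<Phi> f"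
      if f: "f \<in> mod_space g0 \<Phi>" for f
    proof -
      define r where "r = enn2real (mod_norm g0 \<Phi> f)"
      have r: "mod_norm g0 \<Phi> f = ennreal r" "0 \<le> r" using f by (auto simp: r_def mod_space_def)
      have "mod_norm g0 \<Phi> (loc_op g0 \<Phi> \<Psi> \<sigma> g1 g2 f) \<le> ennreal (c * s * p * q * r)"
      \<comment> \<open>For each \<epsilon> some weak image satisfies the bound. By uniqueness it is
        always the value of \<open>loc_op\<close> at f, so the limit concerns one fixed
        norm.\<close>
      proof (rule le_ennreal_product_limit)
        fix \<epsilon> :: real assume "\<epsilon> > 0"
        then obtain u where u: "weak_loc_image g0 \<Phi> (complementary \<Phi>) \<sigma> g1 g2 f u"
          "mod_norm g0 \<Phi> u \<le> ennreal (c * (s + \<epsilon>) * (p + \<epsilon>) * (q + \<epsilon>) * (r + \<epsilon>))"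
          using near[OF f] unfolding r_def by blast
        have "u = loc_op g0 \<Phi> \<Psi> \<sigma> g1 g2 f" using unique[OF u(1) op[OF f, unfolded \<Psi>]] by (simp add: \<Psi>)
        then show "mod_norm g0 \<Phi> (loc_op g0 \<Phi> \<Psi> \<sigma> g1 g2 f)
            \<le> ennreal (c * (s + \<epsilon>) * (p + \<epsilon>) * (q + \<epsilon>) * (r + \<epsilon>))" using u(2) by simp
      qed
      also have "\<dots> = ennreal (c * s * p * q) * mod_norm g0 \<Phi> f"
        using c s pq r by (simp add: ennreal_mult[symmetric])
      finally show ?thesis .
    qed
    show "(\<forall>f\<in>mod_space g0 \<Phi>. \<exists>!u. weak_loc_image g0 \<Phi> \<Psi> \<sigma> g1 g2 f u) \<and>
        bounded_linear_on_mod_space g0 \<Phi> (loc_op g0 \<Phi> \<Psi> \<sigma> g1 g2) \<and>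
        op_norm g0 \<Phi> (loc_op g0 \<Phi> \<Psi> \<sigma> g1 g2)
          \<le> M1_norm (\<lambda>k y. complex_of_real c * G k y) \<sigma> * mod_norm g0 \<Psi> g1 * mod_norm g0 \<Phi> g2"
    proof (intro conjI ballI)
      show "\<exists>!u. weak_loc_image g0 \<Phi> \<Psi> \<sigma> g1 g2 f u" if "f \<in> mod_space g0 \<Phi>" for f
        using ex1[OF that] .
      show "bounded_linear_on_mod_space g0 \<Phi> (loc_op g0 \<Phi> \<Psi> \<sigma> g1 g2)"
        unfolding bounded_linear_on_mod_space_def
      proof (intro conjI ballI allI)
        show "loc_op g0 \<Phi> \<Psi> \<sigma> g1 g2 f \<in> mod_space g0 \<Phi>" if "f \<in> mod_space g0 \<Phi>" for f
          using op[OF that] by (simp add: weak_loc_image_def)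
        show "loc_op g0 \<Phi> \<Psi> \<sigma> g1 g2 (\<lambda>\<phi>. \<alpha> * f \<phi> + \<beta> * h \<phi>)
            = (\<lambda>\<phi>. \<alpha> * loc_op g0 \<Phi> \<Psi> \<sigma> g1 g2 f \<phi> + \<beta> * loc_op g0 \<Phi> \<Psi> \<sigma> g1 g2 h \<phi>)"
          if f: "f \<in> mod_space g0 \<Phi>" and h: "h \<in> mod_space g0 \<Phi>" for f h \<alpha> \<beta>
          by (rule weak_loc_image_linear[OF \<Phi> g0 nz point_mass op[OF f, unfolded \<Psi>] op[OF h, unfolded \<Psi>]
            op[OF mod_space_linear[OF \<Phi> g0 f h], unfolded \<Psi>], folded \<Psi>])
        show "\<exists>C. \<forall>f\<in>mod_space g0 \<Phi>. mod_norm g0 \<Phi> (loc_op g0 \<Phi> \<Psi> \<sigma> g1 g2 f) \<le> ennreal C * mod_norm g0 \<Phi> f"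
          using bound by blast
      qed
      have "mod_norm g0 \<Phi> (loc_op g0 \<Phi> \<Psi> \<sigma> g1 g2 f) \<le> ennreal (c * s * p * q)"
        if "f \<in> mod_space g0 \<Phi>" "mod_norm g0 \<Phi> f \<le> 1" for f
        using order_trans[OF bound[OF that(1)] mult_left_mono[OF that(2)]] by simp
      then have "op_norm g0 \<Phi> (loc_op g0 \<Phi> \<Psi> \<sigma> g1 g2) \<le> ennreal (c * s * p * q)"
        unfolding op_norm_def by (intro SUP_least) auto
      also have "\<dots> = M1_norm (\<lambda>k y. complex_of_real c * G k y) \<sigma> * mod_norm g0 \<Psi> g1 * mod_norm g0 \<Phi> g2"
        unfolding M1c s(1) pq using c s pq by (simp add: ennreal_mult[symmetric])
      finally show "op_norm g0 \<Phi> (loc_op g0 \<Phi> \<Psi> \<sigma> g1 g2)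
          \<le> M1_norm (\<lambda>k y. complex_of_real c * G k y) \<sigma> * mod_norm g0 \<Psi> g1 * mod_norm g0 \<Phi> g2" .
    qed
  qed
qed

end
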